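(* Let $\alpha\in(0,1)$ and let $\{\tau_k\}_{k\ge1}$ be the steps of a nonuniform mesh $0=t_0<t_1<t_2<\cdots$, $\tau_k=t_k-t_{k-1}$, with ratios $\rho_k=\tau_k/\tau_{k-1}$, $k\ge2$. With the constants $\rho_*,\rho^*,\xi_1,\xi_2$ defined in the context, assume that $$\rho_*<\rho_2,\qquad \rho_*<\rho_3<\rho^*,\qquad 2+\frac{2}{1+\rho_3}+\frac{4\rho_2}{1+\rho_2}-\frac{\rho_2^3}{(1+\rho_2)^2}\ge0,\qquad \frac1{\rho_3}\ge\frac{1}{\rho_2^2(1+\rho_2)}-3,$$ and that for every $k\ge3$ $$\begin{cases}\rho_*<\rho_{k+1}\le\dfrac{\rho_k^2(1+\rho_k)}{1-3\rho_k^2(1+\rho_k)}, & \text{if }\rho_*<\rho_k<\xi_1,\\[2mm] \rho_*<\rho_{k+1}<\rho^*, & \text{if }\xi_1\le\rho_k\le\xi_2,\\[1mm] \rho_*<\rho_{k+1}\le\dfrac{-\rho_k^2+4\rho_k+2}{\rho_k^2-3\rho_k-1}, & \text{if }\xi_2<\rho_k<\rho^*.\end{cases}$$ Then for any function $u$ defined on $[0,\infty)\times\Omega$ (with $u^k=u(t_k,\cdot)\in L^2(\Omega)$ for all $k$) and any $n\ge2$, $$\mathcal B_n(u,u)=\sum_{k=1}^n\langle L_k^\alpha u,\delta_k u\rangle\ \ge\ \sum_{k=1}^n\frac{g_k(\alpha)}{2\Gamma(3-\alpha)}\|\delta_k u\|_{L^2(\Omega)}^2\ \ge\ 0,$$ where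 $$g_k(\alpha)=\begin{cases}\dfrac{1}{\tau_1^\alpha}\,\hat g(\alpha), & k=1,2,\\[2mm] \dfrac{\alpha}{\tau_k^\alpha}\left(\dfrac{(1+\alpha)(2-\alpha)}{\alpha}+\dfrac{\rho_{k+1}-1+\alpha}{(1+\rho_{k+1})^\alpha}-\dfrac{2\rho_{k+1}^{2-\alpha}}{1+\rho_{k+1}}-\dfrac{\rho_k(\rho_k-2)}{1+\rho_k}\right), & 3\le k\le n-1,\\[2mm] \dfrac{\alpha}{\tau_n^\alpha}\left(\dfrac{(1+\alpha)(2-\alpha)}{\alpha}-\dfrac{\rho_n(\rho_n-2)}{1+\rho_n}\right), & k=n\ne2,\end{cases}$$ are positive for all $\alpha\in(0,1)$, and $\hat g(\alpha)$ (defined in the context) depends only on $\alpha,\rho_2,\rho_3$.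
   Context: $\Omega\subset\mathbb R^d$ is a domain, $\langle\cdot,\cdot\rangle$ is the $L^2(\Omega)$ inner product, and $\delta_k u=u^k-u^{k-1}$. Constants: $\rho_*\approx0.356341$ is the positive root of $\rho(1+\rho)=1-3\rho^2(1+\rho)$; $$\rho^*=\frac12\left[\frac{4+3\rho_*}{1+\rho_*}+\sqrt{\Big(\frac{4+3\rho_*}{1+\rho_*}\Big)^2+4\,\frac{2+\rho_*}{1+\rho_*}}\right]\approx4.155358;$$ $\xi_1\approx0.459770$ is the positive root of $\frac{\rho^2(1+\rho)}{1-3\rho^2(1+\rho)}=\rho^*$; $\xi_2\approx3.532016$ is the positive root of $\frac{-\rho^2+4\rho+2}{\rho^2-3\rho-1}=\rho^*$. L2 operator: for $j\ge1$ let $H_2^j$ be the quadratic Lagrange polynomial in $t$ interpolating $u^{j-1},u^j,u^{j+1}$ at $t_{j-1},t_j,t_{j+1}$. Then $$L_1^\alpha u=\frac{u^1-u^0}{\Gamma(2-\alpha)\tau_1^\alpha},\qquad L_k^\alpha u=\frac1{\Gamma(1-\alpha)}\left(\sum_{j=1}^{k-1}\int_{t_{j-1}}^{t_j}\frac{\partial_sH_2^j(s)}{(t_k-s)^\alpha}ds+\int_{t_{k-1}}^{t_k}\frac{\partial_sH_2^{k-1}(s)}{(t_k-s)^\alpha}ds\right),\quad k\ge2.$$ Definition of $\hat g$: for $1\le j\le k-1$ put $$a_j^{(k)}=\int_{t_{j-1}}^{t_j}\frac{2s-t_j-t_{j+1}}{\tau_j(\tau_j+\tau_{j+1})}\frac{ds}{(t_k-s)^\alpha},\qquad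 c_j^{(k)}=\int_{t_{j-1}}^{t_j}\frac{2s-t_{j-1}-t_j}{\tau_{j+1}(\tau_j+\tau_{j+1})}\frac{ds}{(t_k-s)^\alpha},$$ and for $k\ge2$ $$a_k^{(k)}=\int_{t_{k-1}}^{t_k}\frac{2s-t_{k-1}-t_k}{\tau_{k-1}(\tau_{k-1}+\tau_k)}\frac{ds}{(t_k-s)^\alpha},\qquad c_k^{(k)}=\int_{t_{k-1}}^{t_k}\frac{2s-t_{k-2}-t_{k-1}}{\tau_k(\tau_{k-1}+\tau_k)}\frac{ds}{(t_k-s)^\alpha}.$$ Let $d_2^{(3)}=c_1^{(3)}-a_2^{(3)}$, $2\beta_1=-a_1^{(2)}$, $2\beta_2=d_2^{(3)}+a_1^{(3)}-a_1^{(2)}$, and let $\mathbf C$ be the symmetric $2\times2$ matrix with $$[\mathbf C]_{11}=\frac{2}{(1-\alpha)\tau_1^\alpha}-2\beta_1,\quad [\mathbf C]_{12}=[\mathbf C]_{21}=-a_2^{(2)},\quad [\mathbf C]_{22}=2c_1^{(2)}+2c_2^{(2)}-2\beta_2-a_3^{(3)}.$$ Then $$\hat g(\alpha)=(2-\alpha)(1-\alpha)\tau_1^\alpha\cdot\frac{[\mathbf C]_{11}+[\mathbf C]_{22}-\sqrt{([\mathbf C]_{11}-[\mathbf C]_{22})^2+4[\mathbf C]_{12}[\mathbf C]_{21}}}{2}.$$ *)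

theory Defs
  imports "HOL-Analysis.Analysis"
begin

definition is_mesh :: "(nat \<Rightarrow> real) \<Rightarrow> bool" where
  "is_mesh t \<longleftrightarrow> t 0 = 0 \<and> strict_mono t"

definition tau :: "(nat \<Rightarrow> real) \<Rightarrow> nat \<Rightarrow> real" where
  "tau t k = t k - t (k - 1)"

definition ratio :: "(nat \<Rightarrow> real) \<Rightarrow> nat \<Rightarrow> real" where
  "ratio t k = tau t k / tau t (k - 1)"

(* Each THE below is well defined: after clearing denominators, which do not vanish
   at a solution, the equation has exactly one positive root. *)

definition rho_low :: real where
  "rho_low = (THE r. r > 0 \<and> r * (1 + r) = 1 - 3 * r\<^sup>2 * (1 + r))"

definition rho_high :: real where
  "rho_high = (1 / 2) * ((4 + 3 * rho_low) / (1 + rho_low)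
     + sqrt (((4 + 3 * rho_low) / (1 + rho_low))\<^sup>2 + 4 * ((2 + rho_low) / (1 + rho_low))))"

definition xi1 :: real where
  "xi1 = (THE r. r > 0 \<and> r\<^sup>2 * (1 + r) / (1 - 3 * r\<^sup>2 * (1 + r)) = rho_high)"

definition xi2 :: real where
  "xi2 = (THE r. r > 0 \<and> (- (r\<^sup>2) + 4 * r + 2) / (r\<^sup>2 - 3 * r - 1) = rho_high)"

definition in_L2 :: "'a::euclidean_space set \<Rightarrow> ('a \<Rightarrow> real) \<Rightarrow> bool" where
  "in_L2 \<Omega> f \<longleftrightarrow> f \<in> borel_measurable (lebesgue_on \<Omega>) \<and> integrable (lebesgue_on \<Omega>) (\<lambda>x. (f x)\<^sup>2)"

definition L2_inner :: "'a::euclidean_space set \<Rightarrow> ('a \<Rightarrow> real) \<Rightarrow> ('a \<Rightarrow> real) \<Rightarrow> real" where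
  "L2_inner \<Omega> f g = (LINT x|lebesgue_on \<Omega>. f x * g x)"

definition L2_norm :: "'a::euclidean_space set \<Rightarrow> ('a \<Rightarrow> real) \<Rightarrow> real" where
  "L2_norm \<Omega> f = sqrt (L2_inner \<Omega> f f)"

definition delta :: "(nat \<Rightarrow> real) \<Rightarrow> (real \<Rightarrow> 'a \<Rightarrow> real) \<Rightarrow> nat \<Rightarrow> 'a \<Rightarrow> real" where
  "delta t u k x = u (t k) x - u (t (k - 1)) x"

definition H2 :: "(nat \<Rightarrow> real) \<Rightarrow> (real \<Rightarrow> 'a \<Rightarrow> real) \<Rightarrow> nat \<Rightarrow> 'a \<Rightarrow> real \<Rightarrow> real" where
  "H2 t u j x s =
     u (t (j - 1)) x * ((s - t j) * (s - t (j + 1)))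
       / ((t (j - 1) - t j) * (t (j - 1) - t (j + 1)))
   + u (t j) x * ((s - t (j - 1)) * (s - t (j + 1)))
       / ((t j - t (j - 1)) * (t j - t (j + 1)))
   + u (t (j + 1)) x * ((s - t (j - 1)) * (s - t j))
       / ((t (j + 1) - t (j - 1)) * (t (j + 1) - t j))"

definition L2_op ::
  "real \<Rightarrow> (nat \<Rightarrow> real) \<Rightarrow> (real \<Rightarrow> 'a \<Rightarrow> real) \<Rightarrow> nat \<Rightarrow> 'a \<Rightarrow> real" where
  "L2_op \<alpha> t u k x =
    (if k = 1 then (u (t 1) x - u (t 0) x) / (Gamma (2 - \<alpha>) * tau t 1 powr \<alpha>)
     else 1 / Gamma (1 - \<alpha>) *
       ((\<Sum>j = 1..k - 1. integral {t (j - 1)..t j}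
            (\<lambda>s. deriv (H2 t u j x) s / (t k - s) powr \<alpha>))
        + integral {t (k - 1)..t k}
            (\<lambda>s. deriv (H2 t u (k - 1) x) s / (t k - s) powr \<alpha>)))"

definition B_form ::
  "'a::euclidean_space set \<Rightarrow> real \<Rightarrow> (nat \<Rightarrow> real) \<Rightarrow> nat \<Rightarrow> (real \<Rightarrow> 'a \<Rightarrow> real) \<Rightarrow> real" where
  "B_form \<Omega> \<alpha> t n u = (\<Sum>k = 1..n. L2_inner \<Omega> (L2_op \<alpha> t u k) (delta t u k))"

(* coef_a \<alpha> t j k and coef_c \<alpha> t j k carry the superscript (k) as last argument; they are
   meant for 1 \<le> j \<le> k with k \<ge> 2, and the else-branch is the case j = k. *)

definition coef_a :: "real \<Rightarrow> (nat \<Rightarrow> real) \<Rightarrow> nat \<Rightarrow> nat \<Rightarrow> real" where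
  "coef_a \<alpha> t j k =
    (if j < k then
       integral {t (j - 1)..t j}
         (\<lambda>s. (2 * s - t j - t (j + 1)) / (tau t j * (tau t j + tau t (j + 1)))
               * (1 / (t k - s) powr \<alpha>))
     else
       integral {t (k - 1)..t k}
         (\<lambda>s. (2 * s - t (k - 1) - t k) / (tau t (k - 1) * (tau t (k - 1) + tau t k))
               * (1 / (t k - s) powr \<alpha>)))"

definition coef_c :: "real \<Rightarrow> (nat \<Rightarrow> real) \<Rightarrow> nat \<Rightarrow> nat \<Rightarrow> real" where
  "coef_c \<alpha> t j k =
    (if j < k then
       integral {t (j - 1)..t j}
         (\<lambda>s. (2 * s - t (j - 1) - t j) / (tau t (j + 1) * (tau t j + tau t (j + 1)))
               * (1 / (t k - s) powr \<alpha>))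
     else
       integral {t (k - 1)..t k}
         (\<lambda>s. (2 * s - t (k - 2) - t (k - 1)) / (tau t k * (tau t (k - 1) + tau t k))
               * (1 / (t k - s) powr \<alpha>)))"

definition d23 :: "real \<Rightarrow> (nat \<Rightarrow> real) \<Rightarrow> real" where
  "d23 \<alpha> t = coef_c \<alpha> t 1 3 - coef_a \<alpha> t 2 3"

definition beta1 :: "real \<Rightarrow> (nat \<Rightarrow> real) \<Rightarrow> real" where
  "beta1 \<alpha> t = (- coef_a \<alpha> t 1 2) / 2"

definition beta2 :: "real \<Rightarrow> (nat \<Rightarrow> real) \<Rightarrow> real" where
  "beta2 \<alpha> t = (d23 \<alpha> t + coef_a \<alpha> t 1 3 - coef_a \<alpha> t 1 2) / 2"

definition mat_C :: "real \<Rightarrow> (nat \<Rightarrow> real) \<Rightarrow> real^2^2" where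
  "mat_C \<alpha> t = vector
    [vector [2 / ((1 - \<alpha>) * tau t 1 powr \<alpha>) - 2 * beta1 \<alpha> t, - coef_a \<alpha> t 2 2],
     vector [- coef_a \<alpha> t 2 2,
             2 * coef_c \<alpha> t 1 2 + 2 * coef_c \<alpha> t 2 2 - 2 * beta2 \<alpha> t - coef_a \<alpha> t 3 3]]"

definition g_hat :: "real \<Rightarrow> (nat \<Rightarrow> real) \<Rightarrow> real" where
  "g_hat \<alpha> t = (let C = mat_C \<alpha> t in
    (2 - \<alpha>) * (1 - \<alpha>) * tau t 1 powr \<alpha> *
      ((C$1$1 + C$2$2 - sqrt ((C$1$1 - C$2$2)\<^sup>2 + 4 * (C$1$2) * (C$2$1))) / 2))"

(* For n = 2 the index k = n = 2 falls under the first case. *)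
definition g_coef :: "real \<Rightarrow> (nat \<Rightarrow> real) \<Rightarrow> nat \<Rightarrow> nat \<Rightarrow> real" where
  "g_coef \<alpha> t n k =
    (if k \<le> 2 then 1 / tau t 1 powr \<alpha> * g_hat \<alpha> t
     else if k \<le> n - 1 then
       \<alpha> / tau t k powr \<alpha> *
         ((1 + \<alpha>) * (2 - \<alpha>) / \<alpha>
          + (ratio t (k + 1) - 1 + \<alpha>) / (1 + ratio t (k + 1)) powr \<alpha>
          - 2 * ratio t (k + 1) powr (2 - \<alpha>) / (1 + ratio t (k + 1))
          - ratio t k * (ratio t k - 2) / (1 + ratio t k))
     else
       \<alpha> / tau t n powr \<alpha> *
         ((1 + \<alpha>) * (2 - \<alpha>) / \<alpha> - ratio t n * (ratio t n - 2) / (1 + ratio t n)))"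

end

theory Submission
  imports Defs
begin

text \<open>Up to the factor \<open>1 / Gamma (1 - \<alpha>)\<close>, the bilinear form is the quadratic form in the
  increments \<open>\<delta>\<^sub>k u\<close> of a lower triangular matrix whose entries \<open>d\<^sub>j(\<phi>)\<close> with \<open>j < k\<close>
  are integrals against \<open>\<phi> s = (t\<^sub>k - s) powr (- \<alpha>)\<close>, corrected on the subdiagonal by
  \<open>- a\<^sub>k\<close>. For every nonnegative, increasing and convex \<open>\<phi>\<close> the ratio condition
  \<open>1 / \<rho>\<^sub>j\<^sub>+\<^sub>1 \<ge> 1 / (\<rho>\<^sub>j\<^sup>2 (1 + \<rho>\<^sub>j)) - 3\<close> gives
  \<open>d\<^sub>j(\<phi>) \<le> \<phi>(t\<^sub>j) + c\<^sub>j(\<phi>) \<le> d\<^sub>j\<^sub>+\<^sub>1(\<phi>)\<close>. Taking for \<open>\<phi>\<close> the kernel and the differences of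
  two kernels, the entries are increasing along rows and have mixed differences of one sign, so with a
  suitable diagonal \<open>2 \<beta>\<^sub>k\<close> they form a combination of squares of partial sums with nonnegative weights.
  The remaining diagonal is bounded below by the left half of the same inequality, the subdiagonal
  correction is absorbed by the inequality of arithmetic and geometric means for \<open>k \<ge> 3\<close>, and the first
  two increments are governed by the smaller eigenvalue of the matrix \<open>C\<close>.\<close>

section \<open>Elementary inequalities\<close>

text \<open>The delicate point is the positivity of \<open>g_coef\<close>. As \<alpha> tends to 1,
  the cubic condition on \<open>ratio t 2\<close> and \<open>ratio t 3\<close> and the bound of the
  third branch become exactly the nonnegativity of the limits, with equality allowed. Hence there is
  no margin uniform in \<alpha>: with \<open>e = 1 - \<alpha>\<close>, the gain away from the limit
  must be shown to be of first order in \<open>e\<close> and not to be consumed by the powers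
  \<open>x powr e\<close>. These powers are replaced by tangents in \<open>x\<close> and by cubic
  polynomials in \<open>e\<close> with rational coefficients, so that polynomial inequalities
  remain. The monotone part needs no such care: it is decided by linear \<open>\<phi>\<close>, so
  its condition on the ratios is free of \<alpha>.\<close>

lemma two_powr_le:
  fixes e :: real
  assumes "0 \<le> e" "e \<le> 1"
  shows "2 powr e \<le> 1 + 7/10 * e + 1/4 * e^2 + 3/25 * e^3"
proof -
  define y where "y = e * ln 2"
  have y0: "0 \<le> y" using assms by (simp add: y_def)
  have ye: "y \<le> 25/36 * e" unfolding y_def using mult_left_mono[OF ln2_le_25_over_36 assms(1)] by simp
  obtain t where t: "\<bar>t\<bar> \<le> \<bar>y\<bar>" "exp y = (\<Sum>m<3. y^m / fact m) + exp t / fact 3 * y^3"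
    using Maclaurin_exp_le by blast
  have "y \<le> ln 2" unfolding y_def using mult_right_mono[OF assms(2), of "ln 2"] by simp
  hence "exp t \<le> exp (ln 2)" using t(1) y0 by (subst exp_le_cancel_iff) linarith
  hence et: "exp t \<le> 2" by simp
  have "exp y \<le> 1 + y + y^2/2 + y^3/3"
    using t(2) mult_right_mono[OF et, of "y^3"] y0 by (simp add: numeral_eq_Suc field_simps)
  also have "\<dots> \<le> 1 + (25/36*e) + (25/36*e)^2/2 + (25/36*e)^3/3"
    using y0 ye by (intro add_mono divide_right_mono power_mono) auto
  \<comment> \<open>Rounding up: 25/36, its square over 2 and its cube over 3 lie below 7/10, 1/4
    and 3/25.\<close>
  also have "\<dots> \<le> 1 + 7/10 * e + 1/4 * e^2 + 3/25 * e^3"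
    using assms(1) zero_le_power[OF assms(1), of 2] zero_le_power[OF assms(1), of 3]
    unfolding power_mult_distrib power_divide by (simp, linarith?)
  finally show ?thesis by (simp add: powr_def y_def)
qed

text \<open>Since \<open>e\<close> is at most 1, \<open>p\<close> pushes every power above the third
  into \<open>e^3\<close>; so the square of the bound for base 2 is cubic again. The product for
  base 8 is treated in the same way.\<close>

lemma four_powr_le:
  fixes e :: real
  assumes "0 \<le> e" "e \<le> 1"
  shows "4 powr e \<le> 1 + 7/5 * e + 99/100 * e^2 + 9/10 * e^3"
proof -
  have p: "e^n \<le> e^3" if "3 \<le> n" for n using that assms by (intro power_decreasing) auto
  have "(4::real) powr e = (2 powr e)^2"
    using powr_mult[of 2 2 e] by (simp add: power2_eq_square)
  also have "\<dots> \<le> (1 + 7/10 * e + 1/4 * e^2 + 3/25 * e^3)^2"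
    by (intro power_mono two_powr_le assms) auto
  also have "\<dots> = 1 + 7/5 * e + 99/100 * e^2 + 59/100 * e^3 + (1/16 + 42/250)*e^4 + 6/100 * e^5 + 9/625*e^6"
    by (simp add: power2_eq_square algebra_simps numeral_eq_Suc)
  also have "\<dots> \<le> 1 + 7/5 * e + 99/100 * e^2 + 9/10 * e^3"
    using p[OF order.refl] p[of 4, simplified] p[of 5, simplified] p[of 6, simplified] zero_le_power[OF assms(1), of 3]
    by (simp, linarith?)
  finally show ?thesis .
qed

lemma eight_powr_le:
  fixes e :: real
  assumes "0 \<le> e" "e \<le> 1"
  shows "8 powr e \<le> 1 + 21/10 * e + 111/50 * e^2 + 18/5 * e^3"
proof -
  have p: "e^n \<le> e^3" if "3 \<le> n" for n using that assms by (intro power_decreasing) auto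
  have "(8::real) powr e = 4 powr e * 2 powr e"
    using powr_mult[of 4 2 e] by simp
  also have "\<dots> \<le> (1 + 7/5 * e + 99/100 * e^2 + 9/10 * e^3) * (1 + 7/10 * e + 1/4 * e^2 + 3/25 * e^3)"
    using assms by (intro mult_mono two_powr_le four_powr_le) auto
  also have "\<dots> = 1 + 21/10 * e + 111/50 * e^2 + (12/100+35/100+693/1000+9/10) * e^3
      + (168/1000 + 2475/10000 + 63/100)*e^4 + (1188/10000 + 225/1000) * e^5 + 108/1000*e^6"
    by (simp add: algebra_simps numeral_eq_Suc)
  also have "\<dots> \<le> 1 + 21/10 * e + 111/50 * e^2 + 18/5 * e^3"
    using p[OF order.refl] p[of 4, simplified] p[of 5, simplified] p[of 6, simplified] zero_le_power[OF assms(1), of 3]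
    by (simp, linarith?)
  finally show ?thesis .
qed

text \<open>The power is concave in \<open>x\<close>, and the right-hand side is its tangent at
  \<open>c\<close>. The main uses take \<open>c = 4\<close> for \<open>x\<close> up to 21/5 and
  \<open>c = 8\<close> for arguments up to 10, bases whose powers are bounded above.\<close>

lemma powr_le_scaled:
  fixes e x c :: real
  assumes "0 \<le> e" "e \<le> 1" "0 \<le> x" "0 < c"
  shows "x powr e \<le> c powr e * (1 + e * (x / c - 1))"
proof -
  have "(x / c) powr e \<le> 1 + e * (x / c - 1)"
  proof (cases "x = 0")
    case False
    have "(x / c) powr e * 1 powr (1 - e) \<le> e * (x / c) + (1 - e) * 1"
      using Youngs_inequality_0[of e "1 - e" "x / c" 1] assms False by simp
    thus ?thesis by (simp add: algebra_simps)
  qed (use assms in simp)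
  hence "c powr e * (x / c) powr e \<le> c powr e * (1 + e * (x / c - 1))"
    by (rule mult_left_mono) simp
  moreover have "c powr e * (x / c) powr e = x powr e"
    using assms by (simp add: powr_divide)
  ultimately show ?thesis by simp
qed

text \<open>The part of the bracket in \<open>g\<^sub>k\<close> that does not involve \<open>\<rho>\<^sub>k\<close>; its limit as
  \<open>\<alpha>\<close> tends to \<open>1\<close> is \<open>1 + 1 / (1 + \<rho>\<^sub>k\<^sub>+\<^sub>1)\<close>.\<close>

definition next_term :: "real \<Rightarrow> real \<Rightarrow> real" where
  "next_term \<alpha> x = (1 + \<alpha>) * (2 - \<alpha>) / \<alpha> + (x - 1 + \<alpha>) / (1 + x) powr \<alpha> - 2 * x powr (2 - \<alpha>) / (1 + x)"

text \<open>The excess over the limit at \<alpha> = 1 has its form from \<open>det_ineq\<close>: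
  \<open>(2 + 3/2 * x) / (1 + x)\<close> is half of \<open>3 + 1 / (1 + x)\<close>, the upper bound
  for the quantity \<open>c\<close> there. For \<open>g_bracket_pos\<close> its positivity
  suffices.\<close>

lemma next_term_ge:
  assumes a: "0 < \<alpha>" "\<alpha> < 1" and x: "0 < x" "x \<le> 21/5"
  shows "next_term \<alpha> x \<ge> 1 + 1 / (1 + x) + (1 - \<alpha>) * (2 + 3/2 * x) / (1 + x)"
proof -
  define e where "e = 1 - \<alpha>"
  have e: "0 < e" "e < 1" using a by (auto simp: e_def)
  have ae: "\<alpha> = 1 - e" by (simp add: e_def)
  define X where "X = x powr e"
  define Y where "Y = (1 + x) powr e"
  have x2: "x powr (2 - \<alpha>) = x * X"
    using x powr_add[of x 1 e] by (simp add: X_def ae)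
  have y2: "(1 + x) powr \<alpha> = (1 + x) / Y"
    using x powr_diff[of "1 + x" 1 e] by (simp add: Y_def ae)
  have XY: "X \<le> Y" "0 < X" "0 < Y" using x e by (auto simp: X_def Y_def intro!: powr_mono2)
  \<comment> \<open>The geometric series of \<open>1 / (1 - e)\<close>, cut after the
    square.\<close>
  have ia: "1 / \<alpha> \<ge> 1 + e + e^2"
  proof -
    have "(1 + e + e^2) * \<alpha> = 1 - e^3" by (simp add: ae algebra_simps numeral_eq_Suc)
    also have "\<dots> \<le> 1" using e by simp
    finally show ?thesis using a by (simp add: field_simps)
  qed
  have eq: "(1 + x) * (next_term \<alpha> x - (1 + 1 / (1 + x) + e * (2 + 3/2 * x) / (1 + x)))
     = e * (2 * (1 / \<alpha>) + 1) * (1 + x) + (x - e) * Y - 2 * x * X + x - e * (2 + 3/2 * x)"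
  proof -
    define q where "q = 1 / \<alpha>"
    have "\<alpha> * q = 1" using a by (simp add: q_def)
    hence "(1 + \<alpha>) * (2 - \<alpha>) = \<alpha> * (2 + e * (2 * q + 1))" unfolding e_def by algebra
    hence 1: "(1 + \<alpha>) * (2 - \<alpha>) / \<alpha> = 2 + e * (2 * (1 / \<alpha>) + 1)"
      using a by (simp add: q_def)
    define r where "r = 1 / (1 + x)"
    have r: "(1 + x) * r = 1" using x by (simp add: r_def)
    have "next_term \<alpha> x = 2 + e * (2 * q + 1) + (x - e) * Y * r - 2 * (x * X) * r"
      unfolding next_term_def 1 x2 y2 using x XY by (simp add: r_def q_def ae)
    hence "(1 + x) * (next_term \<alpha> x - (1 + r + e * (2 + 3/2 * x) * r))
      = e * (2 * q + 1) * (1 + x) + (x - e) * Y - 2 * x * X + x - e * (2 + 3/2 * x)"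
      using r by algebra
    thus ?thesis by (simp add: r_def q_def)
  qed
  have "0 \<le> e * (2 * (1 / \<alpha>) + 1) * (1 + x) + (x - e) * Y - 2 * x * X + x - e * (2 + 3/2 * x)"
  \<comment> \<open>The sign of \<open>x - e\<close>, the coefficient of \<open>Y\<close>, decides
    the estimate: if it is nonnegative, \<open>Y\<close> is replaced by the smaller
    \<open>X\<close>; otherwise \<open>Y\<close> needs an upper bound.\<close>
  proof (cases "e \<le> x")
    case True
    have "X \<le> 4 powr e * (1 + e * (x / 4 - 1))"
      unfolding X_def using e x by (intro powr_le_scaled) auto
    also have "\<dots> \<le> (1 + 7/5 * e + 99/100 * e^2 + 9/10 * e^3) * (1 + e * (x / 4 - 1))"
    proof (rule mult_right_mono)
      have "e * (x / 4 - 1) \<ge> -1" 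
        using mult_left_mono[of "-1" "x/4 - 1" e] e x by simp
      thus "0 \<le> 1 + e * (x / 4 - 1)" by simp
    qed (use e four_powr_le in auto)
    finally have X: "X \<le> (1 + 7/5 * e + 99/100 * e^2 + 9/10 * e^3) * (1 + e * (x / 4 - 1))" .
    \<comment> \<open>concave in \<open>x\<close>, hence at least its linear interpolation between \<open>x = 0\<close> and \<open>x = 21/5\<close>\<close>
    have "0 \<le> e * ((1 - 5/21 * x) * (8/5*e + 241/100*e^2 + 9/100*e^3 + 9/10*e^4)
        + 5/21 * x * (21/100 + 2249/500*e + 53521/10000*e^2 - 2277/2000*e^3 - 9/200*e^4)
        + 1/4 * (1 + 7/5 * e + 99/100 * e^2 + 9/10 * e^3) * x * (21/5 - x))"
    proof (intro mult_nonneg_nonneg add_nonneg_nonneg)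
      have "e^3 \<le> e^2" "e^4 \<le> e^2" using e by (auto intro!: power_decreasing)
      thus "0 \<le> 21/100 + 2249/500*e + 53521/10000*e^2 - 2277/2000*e^3 - 9/200*e^4"
        using e zero_le_power2[of e] by linarith
    qed (use e x in auto)
    also have "\<dots> = e * (2 * (1 + e + e^2) + 1) * (1 + x) + x 
       - (x + e) * ((1 + 7/5 * e + 99/100 * e^2 + 9/10 * e^3) * (1 + e * (x / 4 - 1))) - e * (2 + 3/2 * x)"
      by (simp add: field_simps numeral_eq_Suc)
    also have "\<dots> \<le> e * (2 * (1 + e + e^2) + 1) * (1 + x) + x - (x + e) * X - e * (2 + 3/2 * x)"
      using mult_left_mono[OF X, of "x + e"] e x by simp
    also have "\<dots> \<le> e * (2 * (1 / \<alpha>) + 1) * (1 + x) + x - (x + e) * X - e * (2 + 3/2 * x)"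
    proof -
      have "e * (2 * (1 + e + e^2) + 1) * (1 + x) \<le> e * (2 * (1 / \<alpha>) + 1) * (1 + x)"
        using ia e x by (intro mult_right_mono mult_left_mono) auto
      thus ?thesis by simp
    qed
    also have "\<dots> \<le> e * (2 * (1 / \<alpha>) + 1) * (1 + x) + (x - e) * Y - 2 * x * X + x - e * (2 + 3/2 * x)"
      using mult_left_mono[OF XY(1), of "x - e"] True by (simp add: algebra_simps)
    finally show ?thesis .
  next
    case False
    hence x1: "x < e" by simp
    have Y: "Y \<le> 1 + e * x"
      using powr_le_scaled[of e "1 + x" 1] e x by (simp add: Y_def)
    have "X \<le> 1" unfolding X_def using x x1 e powr_mono2[of e x 1] by simp
    hence xX: "2 * x * X \<le> 2 * x" using x by simp
    have "(e - x) * Y \<le> (e - x) * (1 + e * x)" using Y x1 by (intro mult_left_mono) auto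
    moreover have "e * (2 * 1 + 1) * (1 + x) \<le> e * (2 * (1 / \<alpha>) + 1) * (1 + x)"
      using a e x by (intro mult_right_mono mult_left_mono) (auto simp: field_simps)
    moreover have "0 \<le> e * (3 * (1 + x)) - (e - x) * (1 + e * x) - 2 * x + x - e * (2 + 3/2 * x)"
    proof -
      have "e * (3 * (1 + x)) - (e - x) * (1 + e * x) - 2 * x + x - e * (2 + 3/2 * x)
         = e * x * (1/2 + x + (1 - e))" by (simp add: algebra_simps)
      also have "\<dots> \<ge> 0" using e x by simp
      finally show ?thesis .
    qed
    ultimately show ?thesis using xX by (simp add: algebra_simps)
  qed
  hence "0 \<le> (1 + x) * (next_term \<alpha> x - (1 + 1 / (1 + x) + e * (2 + 3/2 * x) / (1 + x)))"
    unfolding eq .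
  thus ?thesis using x by (simp add: zero_le_mult_iff e_def)
qed


text \<open>This is \<open>main\<close> of \<open>det_ineq\<close> with \<open>b powr e\<close> and
  \<open>(1 + b) powr e\<close> replaced by their tangents at 8 and \<open>8 powr e\<close> by its
  cubic bound. The first power raises the left side and the second lowers the right side, so the
  replacement only strengthens the claim.\<close>

lemma det_poly_pos:
  fixes e b :: real
  assumes e: "0 < e" "e < 1" and b: "0 \<le> b" "b \<le> 9"
  defines "E \<equiv> 1 + 21/10 * e + 111/50 * e^2 + 18/5 * e^3"
  shows "(1 - e) * (1 + b) * (E * (1 + e * (b / 8 - 1)))
    < ((1 + e) * (1 + b) - e * (E * (1 + e * ((1 + b) / 8 - 1)))) * (1 + e / 2)"
proof -
  \<comment> \<open>The difference of the two sides is concave in \<open>b\<close>. \<open>e * A\<close> and \<open>e * B\<close> are its values at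
    \<open>b = 0\<close> and \<open>b = 9\<close>, divided with remainder by a square that vanishes near the minimum.\<close>
  define A where "A = (e - 11/20)^2 * (344663/320000 + 50463/16000*e + 363/800*e^2 + 63/40*e^3)
      + (9495777/128000000 - 91437/6400000*e)"
  define B where "B = (e - 5/12)^2 * (129581/19200 + 47651/1600*e + 459/400*e^2 - 9/20*e^3)
      + (63955/110592 + 147/5120*e)"
  have "0 < A" unfolding A_def using e by (intro add_nonneg_pos mult_nonneg_nonneg add_nonneg_nonneg) auto
  have "e^3 \<le> 1" using e by (intro power_le_one) auto
  hence "0 \<le> 129581/19200 + 47651/1600*e + 459/400*e^2 - 9/20*e^3"
    using e zero_le_power2[of e] by linarith
  hence "0 < B" unfolding B_def using e by (intro add_nonneg_pos mult_nonneg_nonneg) auto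
  have "0 < (1 - b/9) * A + b/9 * B"
  proof (cases "b = 9")
    case False
    thus ?thesis using \<open>0 < A\<close> \<open>0 < B\<close> b by (intro add_pos_nonneg mult_nonneg_nonneg mult_pos_pos) auto
  qed (use \<open>0 < B\<close> in simp)
  moreover have "0 \<le> (1 - e) * E * b * (9 - b) / 8"
    unfolding E_def using e b by (intro divide_nonneg_nonneg mult_nonneg_nonneg add_nonneg_nonneg) auto
  ultimately have "0 < e * ((1 - b/9) * A + b/9 * B + (1 - e) * E * b * (9 - b) / 8)"
    by (intro mult_pos_pos[OF e(1)] add_pos_nonneg[where b = "(1 - e) * E * b * (9 - b) / 8"])
  also have "\<dots> = ((1 + e) * (1 + b) - e * (E * (1 + e * ((1 + b) / 8 - 1)))) * (1 + e / 2)
      - (1 - e) * (1 + b) * (E * (1 + e * (b / 8 - 1)))"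
    unfolding A_def B_def E_def by (simp add: field_simps numeral_eq_Suc)
  finally show ?thesis by simp
qed

text \<open>Up to positive factors, \<open>P\<close> is the first diagonal entry of
  \<open>mat_C\<close>, the other factor on the right bounds the second entry from below, and the
  left side is the square of the off-diagonal entry. At \<alpha> = 1 one has \<open>P = 2\<close>,
  and the nonstrict inequality is \<open>cond\<close>, that is
  \<open>b^3 / (1 + b)\<^sup>2 \<le> 2 * c\<close>. For smaller \<alpha> the factor
  \<open>1 + e / 2\<close> gained from \<open>next_term_ge\<close> outweighs the change of the
  powers.\<close>

lemma det_ineq:
  fixes \<alpha> b x :: real
  assumes a: "0 < \<alpha>" "\<alpha> < 1" and b: "0 < b" and x: "1/3 \<le> x" "x \<le> 21/5"
    and cond: "2 + 2 / (1 + x) + 4 * b / (1 + b) - b^3 / (1 + b)\<^sup>2 \<ge> 0"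
  defines "P \<equiv> 2 * (2 - \<alpha>) + (\<alpha> * b - 2 * (1 - \<alpha>)) * (1 + b) powr (- \<alpha>) - \<alpha> * b powr (2 - \<alpha>) / (1 + b)"
  shows "0 < P" "\<alpha> * b powr (4 - \<alpha>) / (1 + b)\<^sup>2 < P * (next_term \<alpha> x + 2 * b / (1 + b))"
proof -
  define e where "e = 1 - \<alpha>"
  have e: "0 < e" "e < 1" using a by (auto simp: e_def)
  have ae: "\<alpha> = 1 - e" by (simp add: e_def)
  define X where "X = b powr e"
  define Y where "Y = (1 + b) powr e"
  have XY: "X \<le> Y" "0 < X" "0 < Y" using b e by (auto simp: X_def Y_def intro!: powr_mono2)
  define c where "c = 1 + 1 / (1 + x) + 2 * b / (1 + b)"
  have D: "b^3 / (1 + b)\<^sup>2 \<le> 2 * c" using cond by (simp add: c_def)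
  have c4: "c \<le> 3 + 1 / (1 + x)" using b by (simp add: c_def field_simps)
  have c0: "0 < c" unfolding c_def using b x by (intro add_pos_pos) auto
  \<comment> \<open>The left side of \<open>D\<close> grows linearly in \<open>b\<close> while the
    right side stays bounded, so \<open>cond\<close> confines \<open>b\<close>; 9 is where the
    polynomial in \<open>s = b - 9\<close> has positive coefficients.\<close>
  have b9: "b \<le> 9"
  proof (rule ccontr)
    assume "\<not> b \<le> 9"
    have "1 / (1 + x) \<le> 3/4" using x by (simp add: field_simps)
    hence "2 * c \<le> 2 + 3/2 + 4 * b / (1 + b)" unfolding c_def by simp
    hence "b^3 / (1 + b)\<^sup>2 \<le> 2 + 3/2 + 4 * b / (1 + b)" using D by linarith
    also have "\<dots> = ((7/2) * (1 + b)^2 + 4 * b * (1 + b)) / (1 + b)^2"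
      using b by (simp add: add_divide_distrib power2_eq_square)
    finally have "b^3 \<le> (7/2) * (1 + b)^2 + 4 * b * (1 + b)" using b by (simp add: divide_le_cancel)
    moreover obtain s where s: "b = 9 + s" "0 < s" using \<open>\<not> b \<le> 9\<close> by (metis add_diff_cancel_left' diff_gt_0_iff_gt le_add_diff_inverse not_le less_eq_real_def)
    moreover have "b^3 - ((7/2) * (1 + b)^2 + 4 * b * (1 + b)) = s^3 + 39/2 * s^2 + 97 * s + 19"
      unfolding s by (simp add: algebra_simps numeral_eq_Suc)
    moreover have "0 < s^3 + 39/2 * s^2 + 97 * s + 19" using s by (intro add_pos_pos) auto
    ultimately show False by linarith
  qed
  have b2: "b powr (2 - \<alpha>) = b * X"
    using b powr_add[of b 1 e] by (simp add: X_def ae)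
  have b4: "b powr (4 - \<alpha>) = b^3 * X"
    using b powr_add[of b 3 e] by (simp add: X_def ae)
  have y2: "(1 + b) powr - \<alpha> = Y / (1 + b)"
    using b powr_diff[of "1 + b" e 1] by (simp add: Y_def ae)
  define E where "E = 1 + 21/10 * e + 111/50 * e^2 + 18/5 * e^3"
  have XE: "X \<le> E * (1 + e * (b / 8 - 1))" and YE: "Y \<le> E * (1 + e * ((1 + b) / 8 - 1))"
  proof -
    have *: "z powr e \<le> E * (1 + e * (z / 8 - 1))" if "0 < z" for z
    proof -
      have "e * (z / 8 - 1) \<ge> - e" using mult_left_mono[of "-1" "z/8 - 1" e] e that by simp
      hence "8 powr e * (1 + e * (z / 8 - 1)) \<le> E * (1 + e * (z / 8 - 1))"
        unfolding E_def using e by (intro mult_right_mono eight_powr_le) auto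
      thus ?thesis using powr_le_scaled[of e z 8] e that by simp
    qed
    show "X \<le> E * (1 + e * (b / 8 - 1))" "Y \<le> E * (1 + e * ((1 + b) / 8 - 1))"
      unfolding X_def Y_def using * b by auto
  qed
  \<comment> \<open>What is discarded is \<open>\<alpha> * b * (Y - X)\<close>, which is
    nonnegative.\<close>
  have PY: "2 * ((1 + e) * (1 + b) - e * Y) \<le> P * (1 + b)"
  proof -
    define r where "r = 1 / (1 + b)"
    have r: "(1 + b) * r = 1" using b by (simp add: r_def)
    have "P = 2 * (1 + e) + (\<alpha> * b - 2 * e) * (Y * r) - \<alpha> * (b * X) * r"
      unfolding P_def b2 y2 by (simp add: r_def ae)
    hence "P * (1 + b) = 2 * ((1 + e) * (1 + b) - e * Y) + \<alpha> * b * (Y - X)"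
      using r by algebra
    thus ?thesis using XY a b by simp
  qed
  have main: "(1 - e) * (1 + b) * X < ((1 + e) * (1 + b) - e * Y) * (1 + e / 2)"
  proof -
    have "(1 - e) * (1 + b) * X \<le> (1 - e) * (1 + b) * (E * (1 + e * (b / 8 - 1)))"
      using XE e b by (intro mult_left_mono) auto
    also have "\<dots> < ((1 + e) * (1 + b) - e * (E * (1 + e * ((1 + b) / 8 - 1)))) * (1 + e / 2)"
      unfolding E_def using det_poly_pos[OF e, of b] b b9 by simp
    also have "\<dots> \<le> ((1 + e) * (1 + b) - e * Y) * (1 + e / 2)"
      using YE e b by (intro mult_right_mono diff_left_mono mult_left_mono) auto
    finally show ?thesis .
  qed
  have "0 < (1 - e) * (1 + b) * X" using e b XY by simp
  hence "0 < ((1 + e) * (1 + b) - e * Y) * (1 + e / 2)" using main by linarith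
  hence "0 < (1 + e) * (1 + b) - e * Y" using e by (simp add: zero_less_mult_iff)
  hence "0 < 2 * ((1 + e) * (1 + b) - e * Y)" by simp
  hence "0 < P * (1 + b)" using PY by (rule less_le_trans)
  thus P0: "0 < P" using b by (simp add: zero_less_mult_iff)
  have GL: "c + e * (c / 2) \<le> next_term \<alpha> x + 2 * b / (1 + b)"
  proof -
    have "c / 2 \<le> (2 + 3/2 * x) / (1 + x)" using c4 x by (simp add: field_simps)
    hence "e * (c / 2) \<le> e * ((2 + 3/2 * x) / (1 + x))" using e by (intro mult_left_mono) auto
    moreover have "1 + 1 / (1 + x) + e * ((2 + 3/2 * x) / (1 + x)) \<le> next_term \<alpha> x"
      using next_term_ge[OF a, of x] x by (simp add: e_def)
    moreover have "c = 1 + 1 / (1 + x) + 2 * b / (1 + b)" by (simp add: c_def)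
    ultimately show ?thesis by linarith
  qed
  have "\<alpha> * b powr (4 - \<alpha>) / (1 + b)\<^sup>2 = \<alpha> * X * (b^3 / (1 + b)\<^sup>2)"
    unfolding b4 by simp
  also have "\<dots> \<le> \<alpha> * X * (2 * c)" using D a XY by (intro mult_left_mono) auto
  also have "\<dots> = 2 * c / (1 + b) * ((1 - e) * (1 + b) * X)" using b by (simp add: ae)
  also have "\<dots> < 2 * c / (1 + b) * (((1 + e) * (1 + b) - e * Y) * (1 + e / 2))"
    using main c0 b by (intro mult_strict_left_mono) auto
  also have "\<dots> = (2 * ((1 + e) * (1 + b) - e * Y)) * (c * (1 + e / 2) / (1 + b))" by (simp add: field_simps)
  also have "\<dots> \<le> (P * (1 + b)) * (c * (1 + e / 2) / (1 + b))"
    using PY c0 e b by (intro mult_right_mono) auto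
  also have "\<dots> = P * (c + e * (c / 2))" using b by (simp add: field_simps)
  also have "\<dots> \<le> P * (next_term \<alpha> x + 2 * b / (1 + b))" using GL P0 by (intro mult_left_mono) auto
  finally show "\<alpha> * b powr (4 - \<alpha>) / (1 + b)\<^sup>2 < P * (next_term \<alpha> x + 2 * b / (1 + b))" .
qed

section \<open>Quadratic forms\<close>

text \<open>Abel summation: on the left, \<open>x l\<close> is multiplied by the increments of
  \<open>f\<close> up to \<open>l\<close>, which telescope to \<open>f l\<close>.\<close>

lemma sum_telescope_weighted:
  fixes f x :: "nat \<Rightarrow> real"
  assumes "f 0 = 0"
  shows "(\<Sum>i=1..n. (f i - f (i - 1)) * (\<Sum>l=i..n. x l)) = (\<Sum>j=1..n. f j * x j)"
proof (induction n)
  case (Suc n)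
  have tele: "(\<Sum>i=1..m. f i - f (i - 1)) = f m" for m
    using assms by (induction m) auto
  have "(\<Sum>i=1..Suc n. (f i - f (i - 1)) * (\<Sum>l=i..Suc n. x l))
      = (\<Sum>i=1..Suc n. (f i - f (i - 1)) * (\<Sum>l=i..n. x l)) + (\<Sum>i=1..Suc n. f i - f (i - 1)) * x (Suc n)"
    unfolding sum_distrib_right sum.distrib[symmetric]
    by (intro sum.cong) (auto simp: algebra_simps)
  also have "\<dots> = (\<Sum>i=1..n. (f i - f (i - 1)) * (\<Sum>l=i..n. x l)) + f (Suc n) * x (Suc n)"
    unfolding tele by simp
  finally show ?case using Suc by simp
qed auto

text \<open>Writing each entry of a row as a sum of row increments turns the cross terms of row
  \<open>k\<close> into increments times \<open>2 * Y * x k\<close>, with \<open>Y\<close> a partial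
  sum ending at \<open>k - 1\<close>. Completing the square makes this the difference of the squares
  of two consecutive partial sums, and collecting equal squares produces the mixed differences. The
  prescribed diagonal pays for the completion. The last sum carries weights from row
  \<open>n + 1\<close>, which is what the induction needs in order to continue.\<close>

lemma sum_of_squares_repr:
  fixes S :: "nat \<Rightarrow> nat \<Rightarrow> real" and x :: "nat \<Rightarrow> real"
  assumes S0: "\<And>k. S k 0 = 0"
  shows "(\<Sum>k=1..n. (S k (k - 1) + S (k + 1) k - S (k + 1) (k - 1)) * (x k)\<^sup>2
            + 2 * (\<Sum>j=1..<k. S k j * x j) * x k)
    = (\<Sum>m=1..n. \<Sum>i=1..<m. (S m i - S m (i - 1) - (S (m + 1) i - S (m + 1) (i - 1))) * (\<Sum>l=i..m. x l)\<^sup>2)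
      + (\<Sum>i=1..n. (S (n + 1) i - S (n + 1) (i - 1)) * (\<Sum>l=i..n. x l)\<^sup>2)"
proof (induction n)
  case (Suc n)
  define y where "y = x (Suc n)"
  define Y where "Y i = (\<Sum>l=i..n. x l)" for i
  define d where "d k i = S k i - S k (i - 1)" for k i
  have tele: "(\<Sum>i=1..m. d k i) = S k m" for m k
    using S0 by (induction m) (auto simp: d_def)
  have Y: "(\<Sum>l=i..Suc n. x l) = Y i + y" if "i \<le> Suc n" for i
    using that by (simp add: Y_def y_def)
  have abel: "(\<Sum>i=1..n. d (Suc n) i * Y i) = (\<Sum>j=1..n. S (Suc n) j * x j)"
    unfolding d_def Y_def using sum_telescope_weighted[of "S (Suc n)" x n] S0 by simp
  have "(\<Sum>i=1..<Suc n. (d (Suc n) i - d (Suc n + 1) i) * (\<Sum>l=i..Suc n. x l)\<^sup>2)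
      + (\<Sum>i=1..Suc n. d (Suc n + 1) i * (\<Sum>l=i..Suc n. x l)\<^sup>2) - (\<Sum>i=1..n. d (n + 1) i * (Y i)\<^sup>2)
      = (\<Sum>i=1..n. (d (Suc n) i - d (Suc n + 1) i) * (Y i + y)\<^sup>2)
      + (\<Sum>i=1..n. d (Suc n + 1) i * (Y i + y)\<^sup>2) + d (Suc n + 1) (Suc n) * y\<^sup>2 - (\<Sum>i=1..n. d (Suc n) i * (Y i)\<^sup>2)"
  proof -
    have "(\<Sum>i=1..n. c i * (\<Sum>l=i..Suc n. x l)\<^sup>2) = (\<Sum>i=1..n. c i * (Y i + y)\<^sup>2)" for c
      by (intro sum.cong refl) (simp only: Y atLeastAtMost_iff le_SucI)
    thus ?thesis by (simp add: atLeastLessThanSuc_atLeastAtMost y_def del: sum.cl_ivl_Suc add: sum.cl_ivl_Suc[of _ "Suc 0"])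
  qed
  \<comment> \<open>The weights of the row after \<open>Suc n\<close> cancel, and
    \<open>(Y i + y)\<^sup>2 - (Y i)\<^sup>2\<close> is left.\<close>
  also have "\<dots> = (\<Sum>i=1..n. d (Suc n) i * (Y i * (2 * y) + y\<^sup>2)) + d (Suc n + 1) (Suc n) * y\<^sup>2"
    by (simp add: sum.distrib[symmetric] sum_subtractf[symmetric] algebra_simps power2_eq_square
          cong: sum.cong)
  also have "\<dots> = (\<Sum>i=1..n. d (Suc n) i * Y i) * (2 * y) + (\<Sum>i=1..n. d (Suc n) i) * y\<^sup>2 + d (Suc n + 1) (Suc n) * y\<^sup>2"
    unfolding sum_distrib_right by (simp add: sum.distrib[symmetric] algebra_simps)
  also have "\<dots> = (S (Suc n) n + S (Suc n + 1) (Suc n) - S (Suc n + 1) n) * y\<^sup>2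
     + 2 * (\<Sum>j=1..n. S (Suc n) j * x j) * y"
    unfolding abel tele by (simp add: d_def algebra_simps)
  finally have step: "(\<Sum>i=1..<Suc n. (d (Suc n) i - d (Suc n + 1) i) * (\<Sum>l=i..Suc n. x l)\<^sup>2)
      + (\<Sum>i=1..Suc n. d (Suc n + 1) i * (\<Sum>l=i..Suc n. x l)\<^sup>2) - (\<Sum>i=1..n. d (n + 1) i * (Y i)\<^sup>2)
      = (S (Suc n) n + S (Suc n + 1) (Suc n) - S (Suc n + 1) n) * y\<^sup>2 + 2 * (\<Sum>j=1..n. S (Suc n) j * x j) * y" .
  have outer: "sum f {1..Suc n} = sum f {1..n} + f (Suc n)" for f :: "nat \<Rightarrow> real" by simp
  have "(\<Sum>k=1..Suc n. (S k (k - 1) + S (k + 1) k - S (k + 1) (k - 1)) * (x k)\<^sup>2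
            + 2 * (\<Sum>j=1..<k. S k j * x j) * x k)
      = (\<Sum>m=1..n. \<Sum>i=1..<m. (d m i - d (m + 1) i) * (\<Sum>l=i..m. x l)\<^sup>2) + (\<Sum>i=1..n. d (n + 1) i * (Y i)\<^sup>2)
        + ((S (Suc n) n + S (Suc n + 1) (Suc n) - S (Suc n + 1) n) * y\<^sup>2 + 2 * (\<Sum>j=1..n. S (Suc n) j * x j) * y)"
    unfolding outer Suc.IH by (simp add: d_def Y_def y_def atLeastLessThanSuc_atLeastAtMost)
  also have "\<dots> = (\<Sum>m=1..Suc n. \<Sum>i=1..<m. (d m i - d (m + 1) i) * (\<Sum>l=i..m. x l)\<^sup>2)
      + (\<Sum>i=1..Suc n. d (Suc n + 1) i * (\<Sum>l=i..Suc n. x l)\<^sup>2)"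
    unfolding step[symmetric] outer[of "\<lambda>m. \<Sum>i=1..<m. (d m i - d (m + 1) i) * (\<Sum>l=i..m. x l)\<^sup>2"]
    by simp
  finally show ?case unfolding d_def .
qed auto

lemma monotone_kernel_nonneg:
  fixes S :: "nat \<Rightarrow> nat \<Rightarrow> real" and x :: "nat \<Rightarrow> real"
  assumes S0: "\<And>k. S k 0 = 0"
    and row: "\<And>i. 1 \<le> i \<Longrightarrow> i < n \<Longrightarrow> S n (i - 1) \<le> S n i"
    and mix: "\<And>i m. 1 \<le> i \<Longrightarrow> i < m \<Longrightarrow> m < n \<Longrightarrow> S (m + 1) i - S (m + 1) (i - 1) \<le> S m i - S m (i - 1)"
  shows "0 \<le> (\<Sum>k=1..n. (S k (k - 1) + (if k < n then S (k + 1) k - S (k + 1) (k - 1) else 0)) * (x k)\<^sup>2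
            + 2 * (\<Sum>j=1..<k. S k j * x j) * x k)"
proof -
  \<comment> \<open>Rows after \<open>n\<close> are set to zero. The boundary sum then vanishes, the
    mixed difference at \<open>m = n\<close> is the row increment controlled by \<open>row\<close>,
    and the diagonal at \<open>n\<close> loses the entries of the next row.\<close>
  define T where "T k j = (if k \<le> n then S k j else 0)" for k j
  have "(\<Sum>k=1..n. (S k (k - 1) + (if k < n then S (k + 1) k - S (k + 1) (k - 1) else 0)) * (x k)\<^sup>2
            + 2 * (\<Sum>j=1..<k. S k j * x j) * x k)
     = (\<Sum>k=1..n. (T k (k - 1) + T (k + 1) k - T (k + 1) (k - 1)) * (x k)\<^sup>2
            + 2 * (\<Sum>j=1..<k. T k j * x j) * x k)"
    by (intro sum.cong) (auto simp: T_def)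
  also have "\<dots> = (\<Sum>m=1..n. \<Sum>i=1..<m. (T m i - T m (i - 1) - (T (m + 1) i - T (m + 1) (i - 1))) * (\<Sum>l=i..m. x l)\<^sup>2)"
    using sum_of_squares_repr[of T x n] S0 by (simp add: T_def)
  also have "\<dots> \<ge> 0"
  proof (intro sum_nonneg mult_nonneg_nonneg)
    fix m i assume "m \<in> {1..n}" "i \<in> {1..<m}"
    thus "0 \<le> T m i - T m (i - 1) - (T (m + 1) i - T (m + 1) (i - 1))"
      using row[of i] mix[of i m] by (cases "m = n") (auto simp: T_def)
  qed auto
  finally show ?thesis .
qed

section \<open>The smaller eigenvalue of the symmetric matrix with rows (p, q) and (q, r)\<close>

definition min_eig :: "real \<Rightarrow> real \<Rightarrow> real \<Rightarrow> real" where
  "min_eig p q r = (p + r - sqrt ((p - r)\<^sup>2 + 4 * q\<^sup>2)) / 2"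

text \<open>Cauchy-Schwarz for the vectors \<open>(p - r, 2 * q)\<close> and
  \<open>(x\<^sup>2 - y\<^sup>2, 2 * x * y)\<close>: their lengths are \<open>s\<close> and
  \<open>x\<^sup>2 + y\<^sup>2\<close>, and the defect is the square of their cross product.\<close>

lemma min_eig_le:
  "min_eig p q r * (x\<^sup>2 + y\<^sup>2) \<le> p * x\<^sup>2 + 2 * q * x * y + r * y\<^sup>2"
proof -
  define s where "s = sqrt ((p - r)\<^sup>2 + 4 * q\<^sup>2)"
  have "(p - r) * (x\<^sup>2 - y\<^sup>2) + (2 * q) * (2 * x * y) \<ge> - (s * (x\<^sup>2 + y\<^sup>2))"
  proof -
    have "\<bar>(p - r) * (x\<^sup>2 - y\<^sup>2) + (2 * q) * (2 * x * y)\<bar> \<le> \<bar>s * (x\<^sup>2 + y\<^sup>2)\<bar>"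
    proof (rule power2_le_imp_le)
      have s2: "s\<^sup>2 = (p - r)\<^sup>2 + 4 * q\<^sup>2" unfolding s_def by simp
      have "(s * (x\<^sup>2 + y\<^sup>2))\<^sup>2 - ((p - r) * (x\<^sup>2 - y\<^sup>2) + (2 * q) * (2 * x * y))\<^sup>2
          = ((p - r) * (2 * x * y) - 2 * q * (x\<^sup>2 - y\<^sup>2))\<^sup>2"
        unfolding power_mult_distrib s2 by algebra
      thus "\<bar>(p - r) * (x\<^sup>2 - y\<^sup>2) + (2 * q) * (2 * x * y)\<bar>\<^sup>2 \<le> \<bar>s * (x\<^sup>2 + y\<^sup>2)\<bar>\<^sup>2"
        by (metis diff_ge_0_iff_ge power2_abs zero_le_power2)
    qed simp
    moreover have "0 \<le> s * (x\<^sup>2 + y\<^sup>2)" by (simp add: s_def)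
    ultimately show ?thesis by linarith
  qed
  thus ?thesis unfolding min_eig_def s_def[symmetric] by (simp add: field_simps)
qed

lemma min_eig_pos:
  assumes "0 < p" "q\<^sup>2 < p * r"
  shows "0 < min_eig p q r"
proof -
  have "0 < p * r" using assms(2) zero_le_power2[of q] by linarith
  hence r: "0 < r" using assms(1) by (simp add: zero_less_mult_iff)
  have "sqrt ((p - r)\<^sup>2 + 4 * q\<^sup>2) < p + r"
  proof (rule real_less_lsqrt)
    show "(p - r)\<^sup>2 + 4 * q\<^sup>2 < (p + r)\<^sup>2" using assms by (simp add: power2_eq_square algebra_simps)
  qed (use assms r in auto)
  thus ?thesis by (simp add: min_eig_def)
qed

text \<open>\<open>D k\<close> is twice the diagonal minus what
  \<open>monotone_kernel_nonneg\<close> consumes. For \<open>k\<close> from 3 on, the mixed term of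
  \<open>a k\<close> is charged in equal parts to the squares with indices \<open>k - 1\<close> and
  \<open>k\<close>. Only \<open>a 2\<close>, which couples the first two increments, is kept as an
  off-diagonal entry; thus \<open>a 3\<close> enters the condition on \<open>r\<close>, whereas
  \<open>a 2\<close> does not.\<close>

lemma quad_form_lower:
  fixes S :: "nat \<Rightarrow> nat \<Rightarrow> real" and x a m g :: "nat \<Rightarrow> real"
  assumes n: "2 \<le> n"
    and S0: "\<And>k. S k 0 = 0"
    and row: "\<And>i. 1 \<le> i \<Longrightarrow> i < n \<Longrightarrow> S n (i - 1) \<le> S n i"
    and mix: "\<And>i m. 1 \<le> i \<Longrightarrow> i < m \<Longrightarrow> m < n \<Longrightarrow> S (m + 1) i - S (m + 1) (i - 1) \<le> S m i - S m (i - 1)"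
    and a: "\<And>k. 2 \<le> k \<Longrightarrow> k \<le> n \<Longrightarrow> 0 \<le> a k"
  defines "D \<equiv> \<lambda>k. 2 * m k - S k (k - 1) - (if k < n then S (k + 1) k - S (k + 1) (k - 1) else 0)"
  assumes D1: "p \<le> D 1" and D2: "r \<le> D 2 - (if 2 < n then a 3 else 0)"
    and Dk: "\<And>k. 3 \<le> k \<Longrightarrow> k \<le> n \<Longrightarrow> g k \<le> D k - a k - (if k < n then a (k + 1) else 0)"
  shows "min_eig p (- a 2) r * ((x 1)\<^sup>2 + (x 2)\<^sup>2) + (\<Sum>k=3..n. g k * (x k)\<^sup>2)
     \<le> 2 * (\<Sum>k=1..n. ((\<Sum>j=1..<k. S k j * x j) + m k * x k - (if 2 \<le> k then a k * x (k - 1) else 0)) * x k)"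
proof -
  have split: "(\<Sum>k=1..n. f k) = f 1 + (f 2 + (\<Sum>k=3..n. f k))" for f :: "nat \<Rightarrow> real"
    using n by (simp add: sum.atLeast_Suc_atMost numeral_eq_Suc)
  \<comment> \<open>Moves the charges to the index of the square that they hit; the one of
    \<open>a 3\<close> falls on index 2, outside the remaining sum.\<close>
  have shift: "(\<Sum>k=3..n. a k * (x (k - 1))\<^sup>2) = (if 2 < n then a 3 * (x 2)\<^sup>2 else 0)
      + (\<Sum>k=3..n. (if k < n then a (k + 1) else 0) * (x k)\<^sup>2)"
    using n
  proof (induction n rule: dec_induct)
    case (step n)
    have "(\<Sum>k=3..Suc n. (if k < Suc n then a (k + 1) else 0) * (x k)\<^sup>2)
       = (\<Sum>k=3..n. (if k < Suc n then a (k + 1) else 0) * (x k)\<^sup>2)"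
      using step by simp
    also have "\<dots> = (\<Sum>k=3..n. (if k < n then a (k + 1) else 0) * (x k)\<^sup>2) + (if 3 \<le> n then a (n + 1) * (x n)\<^sup>2 else 0)"
    proof (cases "3 \<le> n")
      case True
      then obtain k where k: "n = Suc k" "3 \<le> Suc k" by (cases n) auto
      have "(\<Sum>i=3..k. (if i < Suc n then a (i + 1) else 0) * (x i)\<^sup>2) = (\<Sum>i=3..k. (if i < n then a (i + 1) else 0) * (x i)\<^sup>2)"
        using k by (intro sum.cong) auto
      thus ?thesis using k by simp
    qed simp
    finally show ?case using step by (cases "n = 2") (auto simp: numeral_eq_Suc)
  qed simp
  have eq: "2 * (\<Sum>k=1..n. ((\<Sum>j=1..<k. S k j * x j) + m k * x k - (if 2 \<le> k then a k * x (k - 1) else 0)) * x k)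
     = (\<Sum>k=1..n. (S k (k - 1) + (if k < n then S (k + 1) k - S (k + 1) (k - 1) else 0)) * (x k)\<^sup>2
            + 2 * (\<Sum>j=1..<k. S k j * x j) * x k)
       + (\<Sum>k=1..n. D k * (x k)\<^sup>2 - (if 2 \<le> k then 2 * a k * x (k - 1) * x k else 0))"
    unfolding sum.distrib[symmetric]
    by (subst sum_distrib_left, intro sum.cong) (auto simp: D_def algebra_simps power2_eq_square)
  have "min_eig p (- a 2) r * ((x 1)\<^sup>2 + (x 2)\<^sup>2) + (\<Sum>k=3..n. g k * (x k)\<^sup>2)
    \<le> p * (x 1)\<^sup>2 + 2 * (- a 2) * x 1 * x 2 + r * (x 2)\<^sup>2
       + (\<Sum>k=3..n. (D k - a k - (if k < n then a (k + 1) else 0)) * (x k)\<^sup>2)"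
    by (intro add_mono min_eig_le sum_mono mult_right_mono Dk) auto
  also have "\<dots> \<le> D 1 * (x 1)\<^sup>2 - 2 * a 2 * x 1 * x 2 + (D 2 - (if 2 < n then a 3 else 0)) * (x 2)\<^sup>2
       + (\<Sum>k=3..n. (D k - a k - (if k < n then a (k + 1) else 0)) * (x k)\<^sup>2)"
    using mult_right_mono[OF D1, of "(x 1)\<^sup>2"] mult_right_mono[OF D2, of "(x 2)\<^sup>2"] by simp
  also have "\<dots> = D 1 * (x 1)\<^sup>2 - 2 * a 2 * x 1 * x 2 + D 2 * (x 2)\<^sup>2
       + (\<Sum>k=3..n. D k * (x k)\<^sup>2 - a k * (x k)\<^sup>2) - (\<Sum>k=3..n. a k * (x (k - 1))\<^sup>2)"
    unfolding shift by (simp add: algebra_simps sum.distrib sum_subtractf)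
  also have "\<dots> = D 1 * (x 1)\<^sup>2 - 2 * a 2 * x 1 * x 2 + D 2 * (x 2)\<^sup>2
       + (\<Sum>k=3..n. D k * (x k)\<^sup>2 - a k * ((x (k - 1))\<^sup>2 + (x k)\<^sup>2))"
    by (simp add: algebra_simps sum.distrib sum_subtractf)
  also have "\<dots> \<le> D 1 * (x 1)\<^sup>2 - 2 * a 2 * x 1 * x 2 + D 2 * (x 2)\<^sup>2
       + (\<Sum>k=3..n. D k * (x k)\<^sup>2 - (if 2 \<le> k then 2 * a k * x (k - 1) * x k else 0))"
  proof (intro add_left_mono sum_mono)
    fix k assume k: "k \<in> {3..n}"
    have "2 * x (k - 1) * x k \<le> (x (k - 1))\<^sup>2 + (x k)\<^sup>2" by (rule sum_squares_bound)
    hence "a k * (2 * x (k - 1) * x k) \<le> a k * ((x (k - 1))\<^sup>2 + (x k)\<^sup>2)"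
      using a[of k] k by (intro mult_left_mono) auto
    thus "D k * (x k)\<^sup>2 - a k * ((x (k - 1))\<^sup>2 + (x k)\<^sup>2)
       \<le> D k * (x k)\<^sup>2 - (if 2 \<le> k then 2 * a k * x (k - 1) * x k else 0)"
      using k by (simp add: algebra_simps)
  qed
  also have "\<dots> = (\<Sum>k=1..n. D k * (x k)\<^sup>2 - (if 2 \<le> k then 2 * a k * x (k - 1) * x k else 0))"
    unfolding split by simp
  also have "\<dots> \<le> 2 * (\<Sum>k=1..n. ((\<Sum>j=1..<k. S k j * x j) + m k * x k - (if 2 \<le> k then a k * x (k - 1) else 0)) * x k)"
    unfolding eq using monotone_kernel_nonneg[of S n x, OF S0 row mix] by simp
  finally show ?thesis .
qed

section \<open>Integrals against convex kernels\<close>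

definition kern :: "real \<Rightarrow> real \<Rightarrow> real \<Rightarrow> real" where
  "kern \<alpha> T s = 1 / (T - s) powr \<alpha>"

text \<open>For nodes \<open>p < q < r\<close>, the weights of \<open>int_a\<close> and
  \<open>int_c\<close> are the derivatives of the quadratic Lagrange basis polynomials belonging to
  \<open>p\<close> and to \<open>r\<close>. The kernel is an argument so that differences of kernels
  and tangent lines can be inserted.\<close>

definition int_a :: "real \<Rightarrow> real \<Rightarrow> real \<Rightarrow> (real \<Rightarrow> real) \<Rightarrow> real" where
  "int_a p q r \<phi> = integral {p..q} (\<lambda>s. (2 * s - q - r) / ((q - p) * ((q - p) + (r - q))) * \<phi> s)"

definition int_c :: "real \<Rightarrow> real \<Rightarrow> real \<Rightarrow> (real \<Rightarrow> real) \<Rightarrow> real" where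
  "int_c p q r \<phi> = integral {p..q} (\<lambda>s. (2 * s - p - q) / ((r - q) * ((q - p) + (r - q))) * \<phi> s)"

lemma integrable_affine_times:
  fixes \<phi> :: "real \<Rightarrow> real"
  assumes "continuous_on {p..q} \<phi>"
  shows "(\<lambda>s. (2 * s - u - v) / w * \<phi> s) integrable_on {p..q}"
  unfolding divide_inverse by (intro integrable_continuous_real continuous_intros assms)

lemma int_a_diff:
  assumes "continuous_on {p..q} \<phi>" "continuous_on {p..q} \<psi>"
  shows "int_a p q r (\<lambda>s. \<phi> s - \<psi> s) = int_a p q r \<phi> - int_a p q r \<psi>"
  unfolding int_a_def right_diff_distrib
  by (intro integral_diff integrable_affine_times assms)

lemma int_c_diff:
  assumes "continuous_on {p..q} \<phi>" "continuous_on {p..q} \<psi>"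
  shows "int_c p q r (\<lambda>s. \<phi> s - \<psi> s) = int_c p q r \<phi> - int_c p q r \<psi>"
  unfolding int_c_def right_diff_distrib
  by (intro integral_diff integrable_affine_times assms)

lemma integral_affine_affine:
  fixes p q u w m e :: real
  assumes "p \<le> q"
  shows "integral {p..q} (\<lambda>s. (2 * s - u - v) / w * (m * s + e))
    = (m * (2/3 * (q^3 - p^3) - (u + v) / 2 * (q^2 - p^2)) + e * (q^2 - p^2 - (u + v) * (q - p))) / w"
proof -
  define F where "F s = (m * (2/3 * s^3 - (u + v) / 2 * s^2) + e * (s^2 - (u + v) * s)) / w" for s
  have "((\<lambda>s. (2 * s - u - v) / w * (m * s + e)) has_integral (F q - F p)) {p..q}"
  proof (rule fundamental_theorem_of_calculus[OF assms])
    fix s assume "s \<in> {p..q}"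
    have "(F has_real_derivative (2 * s - u - v) / w * (m * s + e)) (at s within {p..q})"
      unfolding F_def
      by (cases "w = 0") (auto intro!: derivative_eq_intros simp: field_simps power2_eq_square)
    thus "(F has_vector_derivative (2 * s - u - v) / w * (m * s + e)) (at s within {p..q})"
      by (simp add: has_real_derivative_iff_has_vector_derivative)
  qed
  moreover have "F q - F p = (m * (2/3 * (q^3 - p^3) - (u + v) / 2 * (q^2 - p^2)) + e * (q^2 - p^2 - (u + v) * (q - p))) / w"
    unfolding F_def diff_divide_distrib[symmetric] by (simp add: algebra_simps diff_divide_distrib)
  ultimately show ?thesis by (metis integral_unique)
qed

text \<open>The basis polynomial of \<open>p\<close> falls from 1 at \<open>p\<close> to 0 at
  \<open>q\<close>, so its derivative has total mass -1. The one of \<open>r\<close> vanishes at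
  both ends, whence the 0 in \<open>int_c_const\<close>.\<close>

lemma int_a_const:
  assumes "p < q" "q < r"
  shows "int_a p q r (\<lambda>s. e) = - e"
proof -
  have "(q - p) * ((q - p) + (r - q)) \<noteq> 0" using assms by simp
  moreover have "e * (q^2 - p^2 - (q + r) * (q - p)) = - e * ((q - p) * ((q - p) + (r - q)))"
    by (simp add: algebra_simps power2_eq_square)
  ultimately show ?thesis
    unfolding int_a_def
    using integral_affine_affine[of p q q r "(q - p) * ((q - p) + (r - q))" 0 e] assms
    by (simp add: eq_divide_eq divide_eq_eq)
qed

lemma int_c_const:
  assumes "p < q"
  shows "int_c p q r (\<lambda>s. e) = 0"
proof -
  have "q^2 - p^2 - (p + q) * (q - p) = 0"
    by (simp add: algebra_simps power2_eq_square)
  thus ?thesis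
    unfolding int_c_def
    using integral_affine_affine[of p q p q "(r - q) * ((q - p) + (r - q))" 0 e] assms
    by simp
qed

lemma int_a_linear:
  assumes "p < q" "q < r"
  shows "int_a p q r (\<lambda>s. m * s) = m * ((q - p) * (4 * (q - p) + 3 * (r - q)) / (6 * (r - p)) - q)"
proof -
  have "(q - p) * ((q - p) + (r - q)) \<noteq> 0" "r - p \<noteq> 0" using assms by auto
  moreover have "2/3 * (q^3 - p^3) - (q + r) / 2 * (q^2 - p^2)
    = (q - p)^2 * (4 * (q - p) + 3 * (r - q)) / 6 - q * ((q - p) * (r - p))"
    by (simp add: field_simps power2_eq_square power3_eq_cube)
  ultimately show ?thesis
    unfolding int_a_def
    using integral_affine_affine[of p q q r "(q - p) * ((q - p) + (r - q))" m 0] assms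
    by (simp add: divide_simps power2_eq_square) (simp add: algebra_simps)
qed

lemma int_c_linear:
  assumes "p < q"
  shows "int_c p q r (\<lambda>s. m * s) = m * ((q - p)^3 / (6 * ((r - q) * (r - p))))"
proof -
  have "2/3 * (q^3 - p^3) - (p + q) / 2 * (q^2 - p^2) = (q - p)^3 / 6"
    by (simp add: field_simps power2_eq_square power3_eq_cube)
  hence "int_c p q r (\<lambda>s. m * s) = (m * ((q - p)^3 / 6)) / ((r - q) * ((q - p) + (r - q)))"
    unfolding int_c_def
    using integral_affine_affine[OF less_imp_le[OF assms], of p q "(r - q) * ((q - p) + (r - q))" m 0]
    by (simp only: add_0_right mult_zero_left)
  thus ?thesis by simp
qed

text \<open>The weight is nonpositive up to \<open>q\<close> and has mass -1, so
  \<open>- int_a p q r \<phi>\<close> is a weighted mean of \<open>\<phi>\<close>.\<close>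

lemma int_a_bounds:
  assumes pq: "p < q" "q < r" and c: "continuous_on {p..q} \<phi>" and m: "mono_on {p..q} \<phi>"
  shows "int_a p q r \<phi> \<le> - \<phi> p" "- \<phi> q \<le> int_a p q r \<phi>"
proof -
  have w: "(2 * s - q - r) / ((q - p) * ((q - p) + (r - q))) \<le> 0" if "s \<in> {p..q}" for s
    using that pq by (intro divide_nonpos_pos) auto
  have "int_a p q r \<phi> \<le> int_a p q r (\<lambda>s. \<phi> p)"
    unfolding int_a_def using pq
    by (intro integral_le integrable_affine_times c continuous_intros mult_left_mono_neg w mono_onD[OF m]) auto
  thus "int_a p q r \<phi> \<le> - \<phi> p" using int_a_const[OF pq] by simp
  have "int_a p q r (\<lambda>s. \<phi> q) \<le> int_a p q r \<phi>"
    unfolding int_a_def using pq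
    by (intro integral_le integrable_affine_times c continuous_intros mult_left_mono_neg w mono_onD[OF m]) auto
  thus "- \<phi> q \<le> int_a p q r \<phi>" using int_a_const[OF pq] by simp
qed

text \<open>The weight of \<^const>\<open>int_c\<close> is antisymmetric about the midpoint, so a constant may be
  subtracted from \<open>\<phi>\<close> to make the integrand pointwise nonnegative.\<close>

lemma int_c_nonneg:
  assumes pq: "p < q" "q < r" and c: "continuous_on {p..q} \<phi>" and m: "mono_on {p..q} \<phi>"
  shows "0 \<le> int_c p q r \<phi>"
proof -
  have "int_c p q r (\<lambda>s. \<phi> ((p + q) / 2)) \<le> int_c p q r \<phi>"
    unfolding int_c_def
  proof (intro integral_le integrable_affine_times c continuous_intros)
    fix s assume s: "s \<in> {p..q}"
    have "0 \<le> (2 * s - p - q) * (\<phi> s - \<phi> ((p + q) / 2))"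
    proof (cases "s \<le> (p + q) / 2")
      case True
      hence "\<phi> s \<le> \<phi> ((p + q) / 2)" using s pq by (intro mono_onD[OF m]) auto
      thus ?thesis using True by (intro mult_nonpos_nonpos) auto
    next
      case False
      hence "\<phi> ((p + q) / 2) \<le> \<phi> s" using s pq by (intro mono_onD[OF m]) auto
      thus ?thesis using False by (intro mult_nonneg_nonneg) auto
    qed
    moreover have "0 < (r - q) * ((q - p) + (r - q))" using pq by simp
    ultimately have "0 \<le> (2 * s - p - q) * (\<phi> s - \<phi> ((p + q) / 2)) / ((r - q) * ((q - p) + (r - q)))"
      by (intro divide_nonneg_nonneg) auto
    thus "(2 * s - p - q) / ((r - q) * ((q - p) + (r - q))) * \<phi> ((p + q) / 2)
       \<le> (2 * s - p - q) / ((r - q) * ((q - p) + (r - q))) * \<phi> s"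
      by (metis diff_ge_0_iff_ge right_diff_distrib times_divide_eq_left)
  qed
  thus ?thesis using int_c_const[OF pq(1)] by simp
qed

lemma int_c_nonpos:
  assumes pq: "p < q" "q < r" and c: "continuous_on {p..q} \<phi>" and m: "antimono_on {p..q} \<phi>"
  shows "int_c p q r \<phi> \<le> 0"
proof -
  have "0 \<le> int_c p q r (\<lambda>s. - \<phi> s)"
    using m by (intro int_c_nonneg pq continuous_intros c) (auto simp: monotone_on_def)
  also have "int_c p q r (\<lambda>s. - \<phi> s) = - int_c p q r \<phi>"
    using int_c_diff[of p q "\<lambda>_. 0" \<phi> r] c int_c_const[OF pq(1), of r 0] by simp
  finally show ?thesis by simp
qed

text \<open>Convexity is recorded through supporting slopes: subtracting a line of slope
  \<open>m\<close> leaves a function that decreases before \<open>p\<close> and increases after it.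
  This is the form in which the sign lemmas for \<open>int_a\<close> and \<open>int_c\<close>, which
  ask for monotone functions, can be applied. The half-line ends at \<open>b\<close> because the
  kernels are singular further right.\<close>

definition conv_kernel :: "real \<Rightarrow> (real \<Rightarrow> real) \<Rightarrow> bool" where
  "conv_kernel b \<phi> \<longleftrightarrow> continuous_on {..b} \<phi> \<and> (\<forall>s\<le>b. 0 \<le> \<phi> s) \<and> mono_on {..b} \<phi> \<and>
     (\<forall>p\<le>b. \<exists>m\<ge>0. antimono_on {..p} (\<lambda>s. \<phi> s - m * s) \<and> mono_on {p..b} (\<lambda>s. \<phi> s - m * s))"

lemma conv_kernelI:
  assumes d: "\<And>s. s \<le> b \<Longrightarrow> (\<phi> has_real_derivative \<phi>' s) (at s)"
    and m: "mono_on {..b} \<phi>'" and nn: "\<And>s. s \<le> b \<Longrightarrow> 0 \<le> \<phi>' s" "\<And>s. s \<le> b \<Longrightarrow> 0 \<le> \<phi> s"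
  shows "conv_kernel b \<phi>"
  unfolding conv_kernel_def
proof (intro conjI allI impI)
  show "continuous_on {..b} \<phi>"
    using d by (intro DERIV_continuous_on[where D = \<phi>']) (auto intro: has_field_derivative_at_within)
  show "mono_on {..b} \<phi>"
  proof (rule mono_onI)
    fix r s assume "r \<in> {..b}" "s \<in> {..b}" "r \<le> s"
    thus "\<phi> r \<le> \<phi> s"
      using d nn(1) by (intro DERIV_nonneg_imp_nondecreasing[of r s \<phi>]) (auto, meson order.trans)
  qed
  fix p assume p: "p \<le> b"
  have d': "((\<lambda>s. \<phi> s - \<phi>' p * s) has_real_derivative \<phi>' s - \<phi>' p) (at s)" if "s \<le> b" for s
    using d[OF that] by (auto intro!: derivative_eq_intros)
  show "\<exists>m\<ge>0. antimono_on {..p} (\<lambda>s. \<phi> s - m * s) \<and> mono_on {p..b} (\<lambda>s. \<phi> s - m * s)"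
  proof (intro exI[of _ "\<phi>' p"] conjI)
    show "antimono_on {..p} (\<lambda>s. \<phi> s - \<phi>' p * s)"
    proof (rule monotone_onI)
      fix r s assume rs: "r \<in> {..p}" "s \<in> {..p}" "r \<le> s"
      show "\<phi> s - \<phi>' p * s \<le> \<phi> r - \<phi>' p * r"
      proof (rule DERIV_nonpos_imp_nonincreasing[OF rs(3)])
        fix x assume "r \<le> x" "x \<le> s"
        thus "\<exists>y. ((\<lambda>s. \<phi> s - \<phi>' p * s) has_real_derivative y) (at x) \<and> y \<le> 0"
          using d'[of x] mono_onD[OF m, of x p] rs p by (intro exI[of _ "\<phi>' x - \<phi>' p"]) auto
      qed
    qed
    show "mono_on {p..b} (\<lambda>s. \<phi> s - \<phi>' p * s)"
    proof (rule mono_onI)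
      fix r s assume rs: "r \<in> {p..b}" "s \<in> {p..b}" "r \<le> s"
      show "\<phi> r - \<phi>' p * r \<le> \<phi> s - \<phi>' p * s"
      proof (rule DERIV_nonneg_imp_nondecreasing[OF rs(3)])
        fix x assume "r \<le> x" "x \<le> s"
        thus "\<exists>y. ((\<lambda>s. \<phi> s - \<phi>' p * s) has_real_derivative y) (at x) \<and> y \<ge> 0"
          using d'[of x] mono_onD[OF m, of p x] rs p by (intro exI[of _ "\<phi>' x - \<phi>' p"]) auto
      qed
    qed
  qed (use nn p in auto)
qed (use nn in auto)

lemma conv_kernel_continuous:
  assumes "conv_kernel b \<phi>" "q \<le> b"
  shows "continuous_on {p..q} \<phi>"
  using assms unfolding conv_kernel_def by (auto elim!: continuous_on_subset)

lemma conv_kernel_mono: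
  assumes "conv_kernel b \<phi>" "q \<le> b"
  shows "mono_on {p..q} \<phi>"
  using assms unfolding conv_kernel_def by (auto elim!: mono_on_subset)

lemma kern_deriv:
  assumes "s < T"
  shows "(kern \<alpha> T has_real_derivative \<alpha> * kern (\<alpha> + 1) T s) (at s)"
proof -
  have "((\<lambda>s. (T - s) powr (- \<alpha>)) has_real_derivative \<alpha> * (T - s) powr (- \<alpha> - 1)) (at s)"
    using assms by (auto intro!: derivative_eq_intros)
  thus ?thesis unfolding kern_def[abs_def] by (simp add: powr_minus_divide powr_diff powr_add)
qed

lemma kern_mono:
  assumes "0 \<le> \<alpha>" "s \<le> s'" "s' < T" "T \<le> T'"
  shows "kern \<alpha> T s \<le> kern \<alpha> T s'" "kern \<alpha> T' s \<le> kern \<alpha> T s" "0 < kern \<alpha> T s"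
  using assms unfolding kern_def by (auto intro!: divide_left_mono powr_mono2)

lemma conv_kernel_kern:
  assumes a: "0 < \<alpha>" and b: "b < T"
  shows "conv_kernel b (kern \<alpha> T)"
proof (rule conv_kernelI[where \<phi>' = "\<lambda>s. \<alpha> * kern (\<alpha> + 1) T s"])
  show "mono_on {..b} (\<lambda>s. \<alpha> * kern (\<alpha> + 1) T s)"
    using a b by (intro mono_onI mult_left_mono kern_mono(1)) auto
qed (use a b kern_mono(3)[of _ _ _ T T] in \<open>auto intro!: kern_deriv mult_nonneg_nonneg less_imp_le\<close>)

text \<open>Differentiating a kernel gives a positive multiple of the kernel with exponent one
  larger, and every kernel decreases in its singular point \<open>T\<close>. So the difference and
  its first two derivatives are all nonnegative.\<close>

lemma conv_kernel_kern_diff: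
  assumes a: "0 < \<alpha>" and b: "b < T" "T \<le> T'"
  shows "conv_kernel b (\<lambda>s. kern \<alpha> T s - kern \<alpha> T' s)"
proof (rule conv_kernelI[where \<phi>' = "\<lambda>s. \<alpha> * kern (\<alpha> + 1) T s - \<alpha> * kern (\<alpha> + 1) T' s"])
  fix s assume s: "s \<le> b"
  show "((\<lambda>s. kern \<alpha> T s - kern \<alpha> T' s) has_real_derivative \<alpha> * kern (\<alpha> + 1) T s - \<alpha> * kern (\<alpha> + 1) T' s) (at s)"
    using s b by (intro DERIV_diff kern_deriv) auto
  show "0 \<le> \<alpha> * kern (\<alpha> + 1) T s - \<alpha> * kern (\<alpha> + 1) T' s" "0 \<le> kern \<alpha> T s - kern \<alpha> T' s"
    using kern_mono(2)[of "\<alpha> + 1" s s T T'] kern_mono(2)[of \<alpha> s s T T'] s a b by auto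
next
  show "mono_on {..b} (\<lambda>s. \<alpha> * kern (\<alpha> + 1) T s - \<alpha> * kern (\<alpha> + 1) T' s)"
  proof (rule mono_onI)
    fix r s assume rs: "r \<in> {..b}" "s \<in> {..b}" "r \<le> s"
    show "\<alpha> * kern (\<alpha> + 1) T r - \<alpha> * kern (\<alpha> + 1) T' r \<le> \<alpha> * kern (\<alpha> + 1) T s - \<alpha> * kern (\<alpha> + 1) T' s"
    proof (rule DERIV_nonneg_imp_nondecreasing[OF rs(3)])
      fix x assume x: "r \<le> x" "x \<le> s"
      have "((\<lambda>x. \<alpha> * kern (\<alpha> + 1) T x - \<alpha> * kern (\<alpha> + 1) T' x) has_real_derivative
          \<alpha> * ((\<alpha> + 1) * kern (\<alpha> + 1 + 1) T x) - \<alpha> * ((\<alpha> + 1) * kern (\<alpha> + 1 + 1) T' x)) (at x)"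
        using x rs b by (intro DERIV_diff DERIV_cmult kern_deriv) auto
      moreover have "kern (\<alpha> + 1 + 1) T' x \<le> kern (\<alpha> + 1 + 1) T x"
        using x rs a b by (intro kern_mono(2)[of _ _ x]) auto
      hence "0 \<le> \<alpha> * ((\<alpha> + 1) * kern (\<alpha> + 1 + 1) T x) - \<alpha> * ((\<alpha> + 1) * kern (\<alpha> + 1 + 1) T' x)"
        using a by simp
      ultimately show "\<exists>y. ((\<lambda>x. \<alpha> * kern (\<alpha> + 1) T x - \<alpha> * kern (\<alpha> + 1) T' x) has_real_derivative y) (at x) \<and> 0 \<le> y"
        by blast
    qed
  qed
qed

text \<open>Subtracting the tangent of \<open>\<phi>\<close> at \<open>p\<close> reduces the claim to linear \<open>\<phi>\<close>, for which
  it is exactly the condition on the ratios.\<close>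

lemma int_c_minus_int_a_le:
  assumes z: "z < p" "p < q" "q < r" and k: "conv_kernel q \<phi>"
    and ratios: "1 / ((r - q) / (q - p)) \<ge> 1 / (((q - p) / (p - z))\<^sup>2 * (1 + (q - p) / (p - z))) - 3"
  shows "int_c z p q \<phi> - int_a p q r \<phi> \<le> \<phi> q + int_c p q r \<phi>"
proof -
  obtain m where m: "0 \<le> m" "antimono_on {..p} (\<lambda>s. \<phi> s - m * s)" "mono_on {p..q} (\<lambda>s. \<phi> s - m * s)"
    using k z unfolding conv_kernel_def by (meson less_imp_le)
  define g where "g = p - z"
  define h where "h = q - p"
  define l where "l = r - q"
  have pos: "0 < g" "0 < h" "0 < l" using z by (auto simp: g_def h_def l_def)
  have cont: "continuous_on {z..p} \<phi>" "continuous_on {p..q} \<phi>"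
    using z by (auto intro!: conv_kernel_continuous[OF k])
  \<comment> \<open>What remains after subtracting the line decreases on the interval of the first
    \<open>int_c\<close> and increases on that of \<open>int_a\<close> and the second
    \<open>int_c\<close>; this makes all three estimates point in the right direction.\<close>
  have 1: "int_c z p q \<phi> \<le> m * (g^3 / (6 * (h * (g + h))))"
  proof -
    have "int_c z p q (\<lambda>s. \<phi> s - m * s) \<le> 0"
      using z m(2) by (intro int_c_nonpos continuous_intros cont) (auto elim: monotone_on_subset)
    thus ?thesis
      using int_c_diff[OF cont(1), of "\<lambda>s. m * s" q] int_c_linear[OF z(1), of q m]
      by (simp add: continuous_intros g_def h_def)
  qed
  have 2: "- (\<phi> q - m * q) + m * (h * (4 * h + 3 * l) / (6 * (h + l)) - q) \<le> int_a p q r \<phi>"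
  proof -
    have "- (\<phi> q - m * q) \<le> int_a p q r (\<lambda>s. \<phi> s - m * s)"
      using z m(3) by (intro int_a_bounds(2) continuous_intros cont) auto
    thus ?thesis
      using int_a_diff[OF cont(2), of "\<lambda>s. m * s" r] int_a_linear[OF z(2,3), of m]
      by (simp add: continuous_intros h_def l_def)
  qed
  have 3: "m * (h^3 / (6 * (l * (h + l)))) \<le> int_c p q r \<phi>"
  proof -
    have "0 \<le> int_c p q r (\<lambda>s. \<phi> s - m * s)"
      using z m(3) by (intro int_c_nonneg continuous_intros cont) auto
    thus ?thesis
      using int_c_diff[OF cont(2), of "\<lambda>s. m * s" r] int_c_linear[OF z(2), of r m]
      by (simp add: continuous_intros h_def l_def)
  qed
  have "g^3 / (h^2 * (g + h)) \<le> h / l + 3"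
  proof -
    have "1 / ((h / g)\<^sup>2 * (1 + h / g)) = g^3 / (h^2 * (g + h))"
      using pos by (simp add: field_simps power2_eq_square power3_eq_cube)
    thus ?thesis using ratios unfolding g_def[symmetric] h_def[symmetric] l_def[symmetric] by simp
  qed
  \<comment> \<open>Multiplied by \<open>h / 6\<close>, the condition on the ratios compares the
    linear parts of \<open>1\<close>, \<open>2\<close> and \<open>3\<close>.\<close>
  hence "h / 6 * (g^3 / (h^2 * (g + h))) \<le> h / 6 * (h / l + 3)"
    using pos by (intro mult_left_mono) auto
  also have "h / 6 * (g^3 / (h^2 * (g + h))) = g^3 / (6 * (h * (g + h)))"
    using pos by (simp add: power2_eq_square)
  also have "h / 6 * (h / l + 3) = h * (4 * h + 3 * l) / (6 * (h + l)) + h^3 / (6 * (l * (h + l)))"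
    using pos by (simp add: divide_simps) (simp add: algebra_simps power3_eq_cube)
  finally have "m * (g^3 / (6 * (h * (g + h)))) \<le> m * (h * (4 * h + 3 * l) / (6 * (h + l)) + h^3 / (6 * (l * (h + l))))"
    using m(1) by (rule mult_left_mono)
  thus ?thesis using 1 2 3 by (simp add: algebra_simps)
qed

section \<open>The coefficients on a mesh\<close>

lemma is_meshD:
  assumes "is_mesh t" "i < j"
  shows "t i < t j"
  using assms by (auto simp: is_mesh_def strict_mono_def)

lemma coef_a_eq:
  assumes "1 \<le> j" "j < k"
  shows "coef_a \<alpha> t j k = int_a (t (j - 1)) (t j) (t (j + 1)) (kern \<alpha> (t k))"
  using assms by (simp add: coef_a_def int_a_def kern_def tau_def)

lemma coef_c_eq:
  assumes "1 \<le> j" "j < k"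
  shows "coef_c \<alpha> t j k = int_c (t (j - 1)) (t j) (t (j + 1)) (kern \<alpha> (t k))"
  using assms by (simp add: coef_c_def int_c_def kern_def tau_def)

text \<open>Increment \<open>j\<close> occurs in the interpolants of two neighbouring intervals,
  once with a c-coefficient and once with an a-coefficient; for \<open>j = 1\<close> there is no
  earlier interval. The value 0 at \<open>j = 0\<close> makes the first entry of a row its first
  increment.\<close>

definition dcoef :: "(nat \<Rightarrow> real) \<Rightarrow> nat \<Rightarrow> (real \<Rightarrow> real) \<Rightarrow> real" where
  "dcoef t j \<phi> = (if j = 0 then 0
     else (if j = 1 then 0 else int_c (t (j - 2)) (t (j - 1)) (t j) \<phi>)
       - int_a (t (j - 1)) (t j) (t (j + 1)) \<phi>)"

definition ratios_ok :: "(nat \<Rightarrow> real) \<Rightarrow> bool" where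
  "ratios_ok t \<longleftrightarrow> (\<forall>j\<ge>2. 1 / ratio t (j + 1) \<ge> 1 / ((ratio t j)\<^sup>2 * (1 + ratio t j)) - 3)"

lemma dcoef_diff:
  assumes "1 \<le> j" "continuous_on {..t j} \<phi>" "continuous_on {..t j} \<psi>" "is_mesh t"
  shows "dcoef t j (\<lambda>s. \<phi> s - \<psi> s) = dcoef t j \<phi> - dcoef t j \<psi>"
proof -
  have "continuous_on {p..q} \<phi>" "continuous_on {p..q} \<psi>" if "q \<le> t j" for p q
    using assms that by (auto elim!: continuous_on_subset)
  moreover have "t (j - 1) \<le> t j" using is_meshD[OF assms(4), of "j - 1" j] assms(1) by simp
  ultimately show ?thesis by (simp add: dcoef_def int_a_diff int_c_diff)
qed

lemma dcoef_le:
  assumes m: "is_mesh t" and r: "ratios_ok t" and j: "1 \<le> j" and k: "conv_kernel (t j) \<phi>"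
  shows "dcoef t j \<phi> \<le> \<phi> (t j) + int_c (t (j - 1)) (t j) (t (j + 1)) \<phi>"
proof (cases "j = 1")
  case True
  have t: "t 0 < t 1" "t 1 < t 2" using is_meshD[OF m] by auto
  have "- \<phi> (t 1) \<le> int_a (t 0) (t 1) (t 2) \<phi>" "0 \<le> int_c (t 0) (t 1) (t 2) \<phi>"
    using True t
    by (auto intro!: int_a_bounds(2) int_c_nonneg conv_kernel_continuous[OF k] conv_kernel_mono[OF k])
  thus ?thesis using True by (simp add: dcoef_def numeral_2_eq_2)
next
  case False
  obtain i where i: "j = Suc (Suc i)" using that[of "j - 2"] False j by simp
  have "1 / ratio t (j + 1) \<ge> 1 / ((ratio t j)\<^sup>2 * (1 + ratio t j)) - 3"
    using r False j by (auto simp: ratios_ok_def)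
  thus ?thesis
    using int_c_minus_int_a_le[of "t (j - 2)" "t (j - 1)" "t j" "t (j + 1)" \<phi>] k is_meshD[OF m]
    by (simp add: dcoef_def i ratio_def tau_def)
qed

lemma dcoef_Suc_ge:
  assumes m: "is_mesh t" and j: "1 \<le> j" and k: "conv_kernel (t (j + 1)) \<phi>"
  shows "\<phi> (t j) + int_c (t (j - 1)) (t j) (t (j + 1)) \<phi> \<le> dcoef t (j + 1) \<phi>"
proof -
  have "int_a (t j) (t (j + 1)) (t (j + 2)) \<phi> \<le> - \<phi> (t j)"
    by (intro int_a_bounds(1) conv_kernel_continuous[OF k] conv_kernel_mono[OF k] is_meshD[OF m]) auto
  thus ?thesis using j by (simp add: dcoef_def)
qed

lemma dcoef_1_nonneg:
  assumes m: "is_mesh t" and k: "conv_kernel (t 1) \<phi>"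
  shows "0 \<le> dcoef t 1 \<phi>"
proof -
  have t: "t 0 < t 1" "t 1 < t 2" using is_meshD[OF m] by auto
  have "int_a (t 0) (t 1) (t 2) \<phi> \<le> - \<phi> (t 0)"
    by (intro int_a_bounds(1) conv_kernel_continuous[OF k] conv_kernel_mono[OF k] t order.refl)
  moreover have "0 \<le> \<phi> (t 0)" using k t by (auto simp: conv_kernel_def)
  ultimately show ?thesis by (simp add: dcoef_def numeral_2_eq_2)
qed

lemma conv_kernel_le:
  assumes "conv_kernel b \<phi>" "c \<le> b"
  shows "conv_kernel c \<phi>"
  unfolding conv_kernel_def
proof (intro conjI allI impI)
  fix p assume p: "p \<le> c"
  then obtain m where "m \<ge> 0" "antimono_on {..p} (\<lambda>s. \<phi> s - m * s)" "mono_on {p..b} (\<lambda>s. \<phi> s - m * s)"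
    using assms unfolding conv_kernel_def by (meson order.trans)
  thus "\<exists>m\<ge>0. antimono_on {..p} (\<lambda>s. \<phi> s - m * s) \<and> mono_on {p..c} (\<lambda>s. \<phi> s - m * s)"
    using assms(2) by (intro exI[of _ m]) (auto elim!: mono_on_subset)
qed (use assms in \<open>auto simp: conv_kernel_def elim!: continuous_on_subset mono_on_subset\<close>)

lemma dcoef_mono:
  assumes m: "is_mesh t" and r: "ratios_ok t" and j: "1 \<le> j" and k: "conv_kernel (t j) \<phi>"
  shows "dcoef t (j - 1) \<phi> \<le> dcoef t j \<phi>"
proof (cases "j = 1")
  case True
  thus ?thesis using dcoef_1_nonneg[OF m, of \<phi>] k by (simp add: dcoef_def)
next
  case False
  obtain i where i: "j = i + 1" "1 \<le> i" using that[of "j - 1"] False j by simp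
  have "conv_kernel (t i) \<phi>" using k is_meshD[OF m, of i j] i by (intro conv_kernel_le[OF k]) auto
  thus ?thesis using dcoef_le[OF m r i(2)] dcoef_Suc_ge[OF m i(2), of \<phi>] k i by fastforce
qed

lemma dcoef_kern_mono:
  assumes "is_mesh t" "ratios_ok t" "0 < \<alpha>" "1 \<le> i" "i < n"
  shows "dcoef t (i - 1) (kern \<alpha> (t n)) \<le> dcoef t i (kern \<alpha> (t n))"
  using assms by (intro dcoef_mono conv_kernel_kern is_meshD) auto

lemma dcoef_kern_diff:
  assumes m: "is_mesh t" and a: "0 < \<alpha>" and i: "i < k" "k \<le> l"
  shows "dcoef t i (\<lambda>s. kern \<alpha> (t k) s - kern \<alpha> (t l) s) = dcoef t i (kern \<alpha> (t k)) - dcoef t i (kern \<alpha> (t l))"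
proof (cases "i = 0")
  case False
  have "t i < t k" "t i < t l" using is_meshD[OF m] i by auto
  hence "conv_kernel (t i) (kern \<alpha> (t k))" "conv_kernel (t i) (kern \<alpha> (t l))"
    by (auto intro!: conv_kernel_kern a)
  thus ?thesis using False by (intro dcoef_diff m) (auto simp: conv_kernel_def)
qed (simp add: dcoef_def)

lemma dcoef_kern_mixed:
  assumes m: "is_mesh t" and r: "ratios_ok t" and a: "0 < \<alpha>" and i: "1 \<le> i" "i < k"
  shows "dcoef t i (kern \<alpha> (t (k + 1))) - dcoef t (i - 1) (kern \<alpha> (t (k + 1)))
    \<le> dcoef t i (kern \<alpha> (t k)) - dcoef t (i - 1) (kern \<alpha> (t k))"
proof -
  have "conv_kernel (t i) (\<lambda>s. kern \<alpha> (t k) s - kern \<alpha> (t (k + 1)) s)"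
    by (intro conv_kernel_kern_diff a less_imp_le is_meshD[OF m] i) auto
  from dcoef_mono[OF m r i(1) this] show ?thesis
    using dcoef_kern_diff[OF m a, of i k "k + 1"] dcoef_kern_diff[OF m a, of "i - 1" k "k + 1"] i by simp
qed

section \<open>Closed forms of the coefficients\<close>

lemma has_integral_affine_kern:
  fixes \<alpha> p q T u v w :: real
  assumes a: "0 < \<alpha>" "\<alpha> < 1" and pq: "p \<le> q" "q \<le> T"
  shows "((\<lambda>s. (2 * s - u - v) / w * (1 / (T - s) powr \<alpha>)) has_integral
    ((2 * T - u - v) * ((T - p) powr (1 - \<alpha>) - (T - q) powr (1 - \<alpha>)) / (1 - \<alpha>)
      - 2 * ((T - p) powr (2 - \<alpha>) - (T - q) powr (2 - \<alpha>)) / (2 - \<alpha>)) / w) {p..q}"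
proof -
  \<comment> \<open>Since \<open>2 * s - u - v = (2 * T - u - v) - 2 * (T - s)\<close>, the
    integrand is a combination of two powers of \<open>T - s\<close>.\<close>
  define F where "F s = (- (2 * T - u - v) * (T - s) powr (1 - \<alpha>) / (1 - \<alpha>)
      + 2 * (T - s) powr (2 - \<alpha>) / (2 - \<alpha>)) / w" for s
  have "((\<lambda>s. (2 * s - u - v) / w * (1 / (T - s) powr \<alpha>)) has_integral (F q - F p)) {p..q}"
  \<comment> \<open>For \<open>q = T\<close> the integrand is singular at the right end;
    \<open>F\<close> is still continuous there because both of its exponents are positive.\<close>
  proof (rule fundamental_theorem_of_calculus_interior[OF pq(1)])
    show "continuous_on {p..q} F"
      unfolding F_def divide_inverse using pq a
      by (intro continuous_intros continuous_on_powr') auto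
    fix s assume s: "s \<in> {p<..<q}"
    hence sT: "0 < T - s" using pq by auto
    have d: "((\<lambda>s. (T - s) powr c / c) has_real_derivative - ((T - s) powr (c - 1))) (at s)" if "c \<noteq> 0" for c
      using sT that by (auto intro!: derivative_eq_intros simp: field_simps)
    have "(F has_real_derivative
       (- (2 * T - u - v) * - ((T - s) powr (1 - \<alpha> - 1)) + 2 * - ((T - s) powr (2 - \<alpha> - 1))) / w) (at s)"
      unfolding F_def times_divide_eq_right[symmetric]
      using a by (intro DERIV_cdivide DERIV_add DERIV_cmult d) auto
    moreover have "(T - s) powr (1 - \<alpha> - 1) = 1 / (T - s) powr \<alpha>"
      by (simp add: powr_minus_divide)
    moreover have "(T - s) powr (2 - \<alpha> - 1) = (T - s) / (T - s) powr \<alpha>"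
      using sT powr_diff[of "T - s" 1 \<alpha>] by simp
    moreover have "(- (2 * T - u - v) * - (1 / K) + 2 * - ((T - s) / K)) / w = (2 * s - u - v) / w * (1 / K)" for K
      by (simp add: divide_inverse algebra_simps)
    ultimately have "(F has_real_derivative (2 * s - u - v) / w * (1 / (T - s) powr \<alpha>)) (at s)"
      by metis
    thus "(F has_vector_derivative (2 * s - u - v) / w * (1 / (T - s) powr \<alpha>)) (at s)"
      by (simp add: has_real_derivative_iff_has_vector_derivative)
  qed
  moreover have "F q - F p = ((2 * T - u - v) * ((T - p) powr (1 - \<alpha>) - (T - q) powr (1 - \<alpha>)) / (1 - \<alpha>)
      - 2 * ((T - p) powr (2 - \<alpha>) - (T - q) powr (2 - \<alpha>)) / (2 - \<alpha>)) / w"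
    unfolding F_def divide_inverse by (simp add: algebra_simps)
  ultimately show ?thesis by simp
qed

lemma mult_diff_div:
  fixes d e A B :: real
  assumes "d \<noteq> 0" "e \<noteq> 0"
  shows "d * e * (A / d - B / e) = e * A - d * B"
  using assms by (simp add: right_diff_distrib)

text \<open>The factor \<open>(1 - \<alpha>) * (2 - \<alpha>)\<close> clears the denominators of the
  primitive and equals \<open>Gamma (3 - \<alpha>) / Gamma (1 - \<alpha>)\<close>, the factor
  between the operator and the normalisation of the \<open>g_coef\<close>.\<close>

lemma coef_diag_eq:
  assumes a: "0 < \<alpha>" "\<alpha> < 1" and m: "is_mesh t" and k: "2 \<le> k"
  shows "(1 - \<alpha>) * (2 - \<alpha>) * coef_a \<alpha> t k k
      = \<alpha> * tau t k powr (- \<alpha>) * ((ratio t k)\<^sup>2 / (1 + ratio t k))"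
    and "(1 - \<alpha>) * (2 - \<alpha>) * coef_c \<alpha> t k k
      = tau t k powr (- \<alpha>) * (2 - \<alpha> / (1 + ratio t k))"
proof -
  obtain i where i: "k = Suc (Suc i)" using k that[of "k - 2"] by simp
  define g h where "g = tau t (k - 1)" and "h = tau t k"
  have pos: "0 < g" "0 < h" using is_meshD[OF m] i by (auto simp: g_def h_def tau_def)
  have rho: "ratio t k = h / g" by (simp add: ratio_def g_def h_def)
  have th: "t k - t (k - 1) = h" by (simp add: h_def tau_def)
  have gh: "tau t (k - Suc 0) = g" "tau t k = h" "t k - t (k - Suc 0) = h"
    using th by (simp_all add: g_def h_def)
  have tle: "t (k - 1) \<le> t k" using pos th by simp
  define H where "H = h powr (- \<alpha>)"
  have H: "h powr (1 - \<alpha>) = h * H" "h powr (2 - \<alpha>) = h^2 * H"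
    using pos powr_add[of h 1 "- \<alpha>"] powr_add[of h 2 "- \<alpha>"] by (simp_all add: H_def)
  have a0: "1 - \<alpha> \<noteq> 0" "2 - \<alpha> \<noteq> 0" using a by auto
  have frac: "(1 - \<alpha>) * (2 - \<alpha>) * (A / (1 - \<alpha>) - B / (2 - \<alpha>)) = (2 - \<alpha>) * A - (1 - \<alpha>) * B" for A B
    using a0 by (simp add: mult_diff_div)
  have N: "(1 - \<alpha>) * (2 - \<alpha>) * ((X * (h * H) / (1 - \<alpha>) - 2 * (h^2 * H) / (2 - \<alpha>)) / w)
     = h * H * (X * (2 - \<alpha>) - 2 * h * (1 - \<alpha>)) / w" for X w
  proof -
    have "(1 - \<alpha>) * (2 - \<alpha>) * (X * (h * H) / (1 - \<alpha>) - 2 * (h^2 * H) / (2 - \<alpha>))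
      = h * H * (X * (2 - \<alpha>) - 2 * h * (1 - \<alpha>))"
      unfolding frac by (simp add: power2_eq_square algebra_simps)
    thus ?thesis by (metis times_divide_eq_right)
  qed
  have "coef_a \<alpha> t k k = (h * (h * H) / (1 - \<alpha>) - 2 * (h^2 * H) / (2 - \<alpha>)) / (g * (g + h))"
    using has_integral_affine_kern[OF a tle order.refl, of "t (k - 1)" "t k" "g * (g + h)"] a
    by (simp add: coef_a_def integral_unique gh H)
  hence "(1 - \<alpha>) * (2 - \<alpha>) * coef_a \<alpha> t k k = h * H * (h * (2 - \<alpha>) - 2 * h * (1 - \<alpha>)) / (g * (g + h))"
    unfolding N[symmetric] by simp
  also have "\<dots> = \<alpha> * H * ((ratio t k)\<^sup>2 / (1 + ratio t k))"
    unfolding rho using pos by (simp add: field_simps power2_eq_square)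
  finally show "(1 - \<alpha>) * (2 - \<alpha>) * coef_a \<alpha> t k k
      = \<alpha> * tau t k powr (- \<alpha>) * ((ratio t k)\<^sup>2 / (1 + ratio t k))"
    by (simp add: H_def h_def)
  have "2 * t k - t (k - 2) - t (k - 1) = 2 * h + g"
    by (simp add: h_def g_def tau_def i)
  hence "coef_c \<alpha> t k k = ((2 * h + g) * (h * H) / (1 - \<alpha>) - 2 * (h^2 * H) / (2 - \<alpha>)) / (h * (g + h))"
    using has_integral_affine_kern[OF a tle order.refl, of "t (k - 2)" "t (k - 1)" "h * (g + h)"] a
    by (simp add: coef_c_def integral_unique gh H)
  hence "(1 - \<alpha>) * (2 - \<alpha>) * coef_c \<alpha> t k k = h * H * ((2 * h + g) * (2 - \<alpha>) - 2 * h * (1 - \<alpha>)) / (h * (g + h))"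
    unfolding N[symmetric] by simp
  also have "(2 * h + g) * (2 - \<alpha>) - 2 * h * (1 - \<alpha>) = 2 * (g + h) - \<alpha> * g" by (simp add: algebra_simps)
  also have "h * H * (2 * (g + h) - \<alpha> * g) / (h * (g + h)) = H * (2 - \<alpha> * g / (g + h))"
  proof -
    have "(2 * (g + h) - \<alpha> * g) / (g + h) = 2 - \<alpha> * g / (g + h)" using pos by (simp add: field_simps)
    thus ?thesis using pos by (metis less_irrefl mult.assoc mult_divide_mult_cancel_left times_divide_eq_right)
  qed
  also have "\<alpha> * g / (g + h) = \<alpha> / (1 + ratio t k)"
    unfolding rho using pos by (simp add: field_simps)
  finally show "(1 - \<alpha>) * (2 - \<alpha>) * coef_c \<alpha> t k k = tau t k powr (- \<alpha>) * (2 - \<alpha> / (1 + ratio t k))"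
    by (simp add: H_def h_def)
qed

text \<open>This coefficient enters \<open>dcoef t k (kern \<alpha> (t (k + 1)))\<close> and, for
  \<open>k = 1\<close>, the first entry of \<open>mat_C\<close>. Together with
  \<open>coef_a \<alpha> t (k + 1) (k + 1)\<close> it produces the terms of \<open>next_term\<close>
  in the following ratio.\<close>

lemma coef_a_next_eq:
  assumes a: "0 < \<alpha>" "\<alpha> < 1" and m: "is_mesh t" and k: "1 \<le> k"
  defines "x \<equiv> ratio t (k + 1)"
  shows "(1 - \<alpha>) * (2 - \<alpha>) * coef_a \<alpha> t k (k + 1)
      = tau t k powr (- \<alpha>) * ((\<alpha> * x - 2 * (1 - \<alpha>)) * (1 + x) powr (- \<alpha>) - \<alpha> * x powr (2 - \<alpha>) / (1 + x))"
proof -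
  define h l where "h = tau t k" and "l = tau t (k + 1)"
  have pos: "0 < h" "0 < l" using is_meshD[OF m] k by (auto simp: h_def l_def tau_def)
  have x: "l = h * x" "0 < x" using pos by (simp_all add: x_def ratio_def h_def l_def)
  have th: "t (k + 1) - t (k - 1) = h * (1 + x)" "t (k + 1) - t k = h * x"
    using k unfolding distrib_left mult_1_right x(1)[symmetric] by (simp_all add: h_def l_def tau_def)
  have lk: "tau t (Suc k) = h * x" using x by (simp add: l_def)
  have tle: "t (k - 1) \<le> t k" "t k \<le> t (k + 1)" using is_meshD[OF m, of "k - 1" k] is_meshD[OF m, of k "k + 1"] k by auto
  define H Z V where "H = h powr (- \<alpha>)" and "Z = (1 + x) powr (- \<alpha>)" and "V = x powr (2 - \<alpha>)"
  have H: "(h * (1 + x)) powr (1 - \<alpha>) = h * (1 + x) * H * Z" "(h * (1 + x)) powr (2 - \<alpha>) = h^2 * (1 + x)^2 * H * Z"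
    using pos x powr_add[of "h * (1 + x)" 1 "- \<alpha>"] powr_add[of "h * (1 + x)" 2 "- \<alpha>"]
    by (simp_all add: H_def Z_def powr_mult power_mult_distrib)
  have V: "(h * x) powr (2 - \<alpha>) = h^2 * H * V" 
    using pos powr_add[of h 2 "- \<alpha>"] x by (simp add: V_def H_def powr_mult)
  have V1: "x * (h * x) powr (1 - \<alpha>) = h * H * V" 
    using pos powr_add[of h 1 "- \<alpha>"] powr_add[of x 1 "1 - \<alpha>"] x by (simp add: V_def H_def powr_mult)
  have a0: "1 - \<alpha> \<noteq> 0" "2 - \<alpha> \<noteq> 0" using a by auto
  have "coef_a \<alpha> t k (k + 1) = (h * x * ((h * (1 + x)) powr (1 - \<alpha>) - (h * x) powr (1 - \<alpha>)) / (1 - \<alpha>)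
      - 2 * ((h * (1 + x)) powr (2 - \<alpha>) - (h * x) powr (2 - \<alpha>)) / (2 - \<alpha>)) / (h * (h + h * x))"
    using has_integral_affine_kern[OF a tle, of "t k" "t (k + 1)" "h * (h + h * x)"] th lk
    by (simp add: coef_a_def integral_unique flip: h_def)
  also have "\<dots> = (h * x * (h * (1 + x) * H * Z) / (1 - \<alpha>) - h * (h * H * V) / (1 - \<alpha>)
      - 2 * (h^2 * (1 + x)^2 * H * Z - h^2 * H * V) / (2 - \<alpha>)) / (h * (h + h * x))"
    unfolding V1[symmetric] unfolding H V by (simp add: right_diff_distrib diff_divide_distrib mult.assoc)
  also have "\<dots> = H * ((x * (1 + x) * Z - V) / (1 - \<alpha>) - 2 * ((1 + x)^2 * Z - V) / (2 - \<alpha>)) / (1 + x)"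
  proof -
    have *: "h * (h + h * x) = h^2 * (1 + x)" by (simp add: power2_eq_square algebra_simps)
    have "h * x * (h * (1 + x) * H * Z) / (1 - \<alpha>) - h * (h * H * V) / (1 - \<alpha>)
      - 2 * (h^2 * (1 + x)^2 * H * Z - h^2 * H * V) / (2 - \<alpha>)
      = h^2 * (H * ((x * (1 + x) * Z - V) / (1 - \<alpha>) - 2 * ((1 + x)^2 * Z - V) / (2 - \<alpha>)))"
      by (simp add: power2_eq_square algebra_simps diff_divide_distrib)
    thus ?thesis unfolding * using pos by simp
  qed
  finally have "(1 - \<alpha>) * (2 - \<alpha>) * coef_a \<alpha> t k (k + 1)
     = H * ((1 - \<alpha>) * (2 - \<alpha>) * ((x * (1 + x) * Z - V) / (1 - \<alpha>) - 2 * ((1 + x)^2 * Z - V) / (2 - \<alpha>))) / (1 + x)"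
    by simp
  also have "(1 - \<alpha>) * (2 - \<alpha>) * ((x * (1 + x) * Z - V) / (1 - \<alpha>) - 2 * ((1 + x)^2 * Z - V) / (2 - \<alpha>))
     = (1 + x) * ((\<alpha> * x - 2 * (1 - \<alpha>)) * Z) - \<alpha> * V"
    unfolding mult_diff_div[OF a0] by (simp add: power2_eq_square algebra_simps)
  also have "H * ((1 + x) * ((\<alpha> * x - 2 * (1 - \<alpha>)) * Z) - \<alpha> * V) / (1 + x)
     = H * ((\<alpha> * x - 2 * (1 - \<alpha>)) * Z - \<alpha> * V / (1 + x))"
  proof -
    have "((1 + x) * ((\<alpha> * x - 2 * (1 - \<alpha>)) * Z) - \<alpha> * V) / (1 + x) = (\<alpha> * x - 2 * (1 - \<alpha>)) * Z - \<alpha> * V / (1 + x)"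
      using x by (simp add: diff_divide_distrib)
    thus ?thesis by (metis times_divide_eq_right)
  qed
  finally show ?thesis by (simp add: H_def Z_def V_def h_def)
qed

section \<open>The constants and the step ratios\<close>

text \<open>The equation says that \<open>rho_low\<close> is a fixed point of the first-branch bound
  \<open>r\<^sup>2 * (1 + r) / (1 - 3 * r\<^sup>2 * (1 + r))\<close>. Expanded, it is
  \<open>h r = 1\<close> with \<open>h\<close> increasing, so the root is unique and can be located
  by evaluating \<open>h\<close> at 7/20.\<close>

lemma rho_low_root: "0 < rho_low" "rho_low * (1 + rho_low) = 1 - 3 * rho_low\<^sup>2 * (1 + rho_low)"
  and rho_low_gt: "7/20 < rho_low"
proof -
  define h where "h r = r + 4 * r^2 + 3 * r^3" for r :: real
  have h: "r * (1 + r) = 1 - 3 * r\<^sup>2 * (1 + r) \<longleftrightarrow> h r = 1" for r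
    unfolding h_def by (auto simp: algebra_simps power2_eq_square power3_eq_cube)
  have mono: "h r < h s" if "0 \<le> r" "r < s" for r s
    unfolding h_def using that by (intro add_strict_mono mult_strict_left_mono power_strict_mono) auto
  have "\<exists>r\<ge>7/20. r \<le> 1 \<and> h r = 1"
    by (rule IVT') (auto simp: h_def power2_eq_square power3_eq_cube intro!: continuous_intros)
  then obtain r where r: "7/20 \<le> r" "h r = 1" by auto
  have "\<exists>!r::real. r > 0 \<and> r * (1 + r) = 1 - 3 * r\<^sup>2 * (1 + r)"
    unfolding h
  proof (rule ex1I[of _ r])
    fix s :: real assume "0 < s \<and> h s = 1"
    thus "s = r" using mono[of r s] mono[of s r] r by (cases s r rule: linorder_cases) auto
  qed (use r in auto)
  from theI'[OF this] show *: "0 < rho_low" "rho_low * (1 + rho_low) = 1 - 3 * rho_low\<^sup>2 * (1 + rho_low)"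
    unfolding rho_low_def by auto
  show "7/20 < rho_low"
  proof (rule ccontr)
    assume "\<not> 7/20 < rho_low"
    hence "h rho_low \<le> h (7/20)" using mono[of rho_low "7/20"] *(1) by (metis less_eq_real_def not_le)
    also have "\<dots> < 1" by (simp add: h_def power2_eq_square power3_eq_cube)
    finally show False using *(2) unfolding h by simp
  qed
qed

text \<open>The quadratic equation says that at \<open>r = rho_high\<close> the third-branch bound
  has fallen to \<open>rho_low\<close>. Sorted by \<open>rho_low\<close> and evaluated beyond 21/5,
  its left side is positive already with 7/20 in place of \<open>rho_low\<close>.\<close>

lemma rho_high_root: "0 < rho_high" "(1 + rho_low) * rho_high\<^sup>2 = (4 + 3 * rho_low) * rho_high + (2 + rho_low)"
  and rho_high_le: "rho_high \<le> 21/5"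
proof -
  define A B where "A = (4 + 3 * rho_low) / (1 + rho_low)" and "B = (2 + rho_low) / (1 + rho_low)"
  have AB: "0 < A" "0 < B" using rho_low_root(1) by (simp_all add: A_def B_def)
  have H: "rho_high = (1/2) * (A + sqrt (A\<^sup>2 + 4 * B))"
    by (simp add: rho_high_def A_def B_def)
  show pos: "0 < rho_high" unfolding H using AB by (intro mult_pos_pos add_pos_nonneg) auto
  have "(2 * rho_high - A)\<^sup>2 = A\<^sup>2 + 4 * B" 
  proof -
    have "2 * rho_high - A = sqrt (A\<^sup>2 + 4 * B)" unfolding H by (simp add: algebra_simps)
    thus ?thesis using AB by simp
  qed
  hence "rho_high\<^sup>2 = A * rho_high + B" by (simp add: power2_eq_square algebra_simps)
  hence "(1 + rho_low) * rho_high\<^sup>2 = (1 + rho_low) * A * rho_high + (1 + rho_low) * B"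
    by (simp add: algebra_simps)
  thus *: "(1 + rho_low) * rho_high\<^sup>2 = (4 + 3 * rho_low) * rho_high + (2 + rho_low)"
    using rho_low_root(1) by (simp add: A_def B_def)
  show "rho_high \<le> 21/5"
  proof (rule ccontr)
    assume "\<not> rho_high \<le> 21/5"
    then obtain s where s: "rho_high = 21/5 + s" "0 < s"
      by (metis add_diff_cancel_left' add.commute diff_add_cancel diff_gt_0_iff_gt not_le)
    have "(rho_high\<^sup>2 - 4 * rho_high - 2) + rho_low * (rho_high\<^sup>2 - 3 * rho_high - 1) = 0"
      using * by (simp add: algebra_simps)
    moreover have e: "rho_high\<^sup>2 - 4 * rho_high - 2 = s\<^sup>2 + 22/5 * s - 29/25"
      "rho_high\<^sup>2 - 3 * rho_high - 1 = s\<^sup>2 + 27/5 * s + 101/25"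
      unfolding s by (simp_all add: power2_eq_square algebra_simps)
    moreover have "rho_low * (s\<^sup>2 + 27/5 * s + 101/25) \<ge> 7/20 * (s\<^sup>2 + 27/5 * s + 101/25)"
      using rho_low_gt s by (intro mult_right_mono) auto
    ultimately have "s\<^sup>2 + 22/5 * s - 29/25 + rho_low * (s\<^sup>2 + 27/5 * s + 101/25) = 0"
      "rho_low * (s\<^sup>2 + 27/5 * s + 101/25) \<ge> 7/20 * (s\<^sup>2 + 27/5 * s + 101/25)"
      unfolding e by auto
    hence "s\<^sup>2 + 22/5 * s - 29/25 + 7/20 * (s\<^sup>2 + 27/5 * s + 101/25) \<le> 0" by linarith
    moreover have "0 \<le> s\<^sup>2" by simp
    ultimately show False using s(2) by (simp add: algebra_simps)
  qed
qed

lemma xi1_root: "0 < xi1" "xi1\<^sup>2 * (1 + xi1) = rho_high / (1 + 3 * rho_high)"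
proof -
  let ?y = "rho_high / (1 + 3 * rho_high)"
  have H: "0 < rho_high" by (rule rho_high_root)
  \<comment> \<open>A zero denominator would make the quotient 0, which differs from
    \<open>rho_high\<close>.\<close>
  have y: "y / (1 - 3 * y) = rho_high \<longleftrightarrow> y = ?y" for y
  proof -
    have "1 - 3 * ?y = 1 / (1 + 3 * rho_high)" using H by (simp add: field_simps)
    hence "?y / (1 - 3 * ?y) = rho_high" using H by simp
    moreover have "y = ?y" if "y / (1 - 3 * y) = rho_high"
    proof -
      have "1 - 3 * y \<noteq> 0" using that H by (metis div_by_0 less_irrefl)
      hence "y = rho_high * (1 - 3 * y)" using that by (simp add: field_simps)
      thus ?thesis using H by (simp add: field_simps)
    qed
    ultimately show ?thesis by metis
  qed
  have mono: "r\<^sup>2 * (1 + r) < s\<^sup>2 * (1 + s)" if "0 \<le> r" "r < s" for r s :: real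
    using that by (intro mult_strict_mono power_strict_mono) auto
  have "\<exists>r\<ge>0. r \<le> 1 \<and> r\<^sup>2 * (1 + r) = ?y"
    using H by (intro IVT') (auto simp: field_simps intro!: continuous_intros)
  then obtain r where r: "0 \<le> r" "r\<^sup>2 * (1 + r) = ?y" by auto
  hence "0 < r" using H by (cases "r = 0") auto
  hence "\<exists>!r. r > 0 \<and> r\<^sup>2 * (1 + r) = ?y"
    using r mono by (intro ex1I[of _ r]) (auto, metis less_imp_le less_irrefl linorder_less_linear)
  hence "\<exists>!r. r > 0 \<and> r\<^sup>2 * (1 + r) / (1 - 3 * r\<^sup>2 * (1 + r)) = rho_high"
    unfolding y[symmetric] by (simp add: mult.assoc)
  from theI'[OF this] show "0 < xi1" "xi1\<^sup>2 * (1 + xi1) = ?y"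
    unfolding xi1_def[symmetric] y[symmetric] by (simp_all add: mult.assoc)
qed

lemma xi2_root: "0 < xi2" "- xi2\<^sup>2 + 4 * xi2 + 2 = rho_high * (xi2\<^sup>2 - 3 * xi2 - 1)"
proof -
  have H: "0 < rho_high" by (rule rho_high_root)
  define p where "p r = rho_high * (r\<^sup>2 - 3 * r - 1) - (- r\<^sup>2 + 4 * r + 2)" for r :: real
  have "\<exists>r\<ge>0. r \<le> 10 \<and> p r = 0"
    using H by (intro IVT') (auto simp: p_def intro!: continuous_intros)
  then obtain r where r: "0 \<le> r" "p r = 0" by auto
  have "0 < r" using r H by (cases "r = 0") (auto simp: p_def)
  \<comment> \<open>The quotient \<open>p s / s\<close> is strictly increasing for positive
    \<open>s\<close>; the identity is its difference at two points, multiplied by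
    \<open>s * s'\<close>.\<close>
  have uniq: "s = s'" if "0 < s" "0 < s'" "p s = 0" "p s' = 0" for s s'
  proof -
    have "s' * p s - s * p s' = (s - s') * ((1 + rho_high) * (s * s') + (2 + rho_high))"
      unfolding p_def by (simp add: algebra_simps power2_eq_square)
    moreover have "0 < (1 + rho_high) * (s * s') + (2 + rho_high)"
      using that H by (intro add_pos_pos mult_pos_pos) auto
    ultimately show ?thesis using that by simp
  qed
  have p: "(- (r\<^sup>2) + 4 * r + 2) / (r\<^sup>2 - 3 * r - 1) = rho_high \<longleftrightarrow> p r = 0" if "0 < r" for r
  proof (cases "r\<^sup>2 - 3 * r - 1 = 0")
    case True
    hence "- r\<^sup>2 + 4 * r + 2 = r + 1" by linarith
    thus ?thesis unfolding p_def True using H that by simp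
  next
    case False
    thus ?thesis by (auto simp: p_def divide_eq_eq)
  qed
  have "\<exists>!r. r > 0 \<and> (- (r\<^sup>2) + 4 * r + 2) / (r\<^sup>2 - 3 * r - 1) = rho_high"
    using \<open>0 < r\<close> r(2) uniq p by (intro ex1I[of _ r]) auto
  from theI'[OF this] show "0 < xi2" "- xi2\<^sup>2 + 4 * xi2 + 2 = rho_high * (xi2\<^sup>2 - 3 * xi2 - 1)"
    unfolding xi2_def[symmetric] using p[of xi2] by (auto simp: p_def)
qed

text \<open>The first-branch bound is the condition for the monotone kernel, and the third-branch
  bound is the condition behind \<open>g_bracket_pos\<close>. By the choice of \<open>xi1\<close>
  and \<open>xi2\<close>, each bound stays below \<open>rho_high\<close> on its own branch.
  Elsewhere the two conditions follow from \<open>r' < rho_high\<close> or from the size of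
  \<open>r\<close>.\<close>

lemma ratio_step:
  assumes r: "rho_low < r" "r < rho_high"
    and low: "r < xi1 \<Longrightarrow> rho_low < r' \<and> r' \<le> r\<^sup>2 * (1 + r) / (1 - 3 * r\<^sup>2 * (1 + r))"
    and mid: "xi1 \<le> r \<Longrightarrow> r \<le> xi2 \<Longrightarrow> rho_low < r' \<and> r' < rho_high"
    and high: "xi2 < r \<Longrightarrow> rho_low < r' \<and> r' \<le> (- (r\<^sup>2) + 4 * r + 2) / (r\<^sup>2 - 3 * r - 1)"
  shows "rho_low < r'" "r' < rho_high" "1 / r' \<ge> 1 / (r\<^sup>2 * (1 + r)) - 3"
    "r' * (r\<^sup>2 - 3 * r - 1) \<le> - r\<^sup>2 + 4 * r + 2"
proof -
  have pos: "0 < rho_low" "0 < rho_high" "0 < r" using rho_low_root rho_high_root r by auto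
  show l: "rho_low < r'" using low mid high by linarith
  define y y1 where "y = r\<^sup>2 * (1 + r)" and "y1 = rho_high / (1 + 3 * rho_high)"
  have y0: "0 < y" using pos by (simp add: y_def)
  have y1: "0 < y1" "y1 < 1/3" "1 / y1 - 3 = 1 / rho_high"
    using pos by (simp_all add: y1_def field_simps)
  have xi1: "xi1\<^sup>2 * (1 + xi1) = y1" "0 < xi1" using xi1_root by (simp_all add: y1_def)
  have "r' < rho_high \<and> 1 / r' \<ge> 1 / y - 3 \<and> r' * (r\<^sup>2 - 3 * r - 1) \<le> - r\<^sup>2 + 4 * r + 2"
  proof -
    consider "r < xi1" | "xi1 \<le> r" "r \<le> xi2" | "xi1 \<le> r" "xi2 < r" by linarith
    thus ?thesis
    proof cases
      case 1
      have "y < xi1\<^sup>2 * (1 + xi1)"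
        unfolding y_def using 1 pos by (intro mult_strict_mono power_strict_mono) auto
      hence y: "y < y1" by (simp add: xi1)
      have r': "r' \<le> y / (1 - 3 * y)" using low[OF 1] by (simp add: y_def mult.assoc)
      have "1 / rho_high < 1 / y - 3" using y y0 y1 by (simp flip: y1(3) add: divide_strict_left_mono)
      also have e: "1 / y - 3 = 1 / (y / (1 - 3 * y))" using y0 by (simp add: field_simps)
      finally have "y / (1 - 3 * y) < rho_high"
        using pos y y1 y0 by (simp add: field_simps)
      moreover have "1 / (y / (1 - 3 * y)) \<le> 1 / r'"
        using r' l pos y y1 y0 by (intro divide_left_mono mult_pos_pos divide_pos_pos) auto
      moreover have "r' * (r\<^sup>2 - 3 * r - 1) \<le> - r\<^sup>2 + 4 * r + 2"
      proof -
        have "xi1 < 1"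
        proof (rule ccontr)
          assume "\<not> xi1 < 1"
          hence "1\<^sup>2 * (1 + 1) \<le> xi1\<^sup>2 * (1 + xi1)" by (intro mult_mono power_mono) auto
          thus False using xi1 y1 by simp
        qed
        hence "r * r \<le> r" using 1 pos mult_right_mono[of r 1 r] by simp
        hence "r\<^sup>2 - 3 * r - 1 \<le> 0" "0 \<le> - r\<^sup>2 + 4 * r + 2"
          using pos unfolding power2_eq_square by linarith+
        moreover have "0 < r'" using l pos by linarith
        ultimately show ?thesis by (meson mult_nonneg_nonpos less_imp_le order.trans)
      qed
      ultimately show ?thesis using r' e by auto
    next
      case 2
      have r': "0 < r'" "r' < rho_high" using mid[OF 2] l pos by auto
      have "xi1\<^sup>2 * (1 + xi1) \<le> y"
        unfolding y_def using 2 xi1 by (intro mult_mono power_mono) auto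
      hence "1 / y \<le> 1 / y1" using y0 y1(1) xi1(1) by (intro divide_left_mono) auto
      hence "1 / y - 3 \<le> 1 / y1 - 3" by (rule diff_right_mono)
      also have "\<dots> \<le> 1 / r'" using y1(3) r' by (simp add: divide_left_mono)
      moreover have "r' * (r\<^sup>2 - 3 * r - 1) \<le> - r\<^sup>2 + 4 * r + 2"
      proof (cases "r\<^sup>2 - 3 * r - 1 \<le> 0")
        case True
        hence "r' * (r\<^sup>2 - 3 * r - 1) \<le> 0" using r' by (simp add: mult_nonneg_nonpos)
        thus ?thesis using True pos by linarith
      next
        case False
        \<comment> \<open>The identity from the uniqueness of \<open>xi2\<close> again: the sign of
          \<open>r - xi2\<close> tells on which side of \<open>rho_high\<close> the third-branch
          bound lies.\<close>
        have "xi2 * (rho_high * (r\<^sup>2 - 3 * r - 1) - (- r\<^sup>2 + 4 * r + 2))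
            - r * (rho_high * (xi2\<^sup>2 - 3 * xi2 - 1) - (- xi2\<^sup>2 + 4 * xi2 + 2))
           = (r - xi2) * ((1 + rho_high) * (r * xi2) + (2 + rho_high))"
          by (simp add: algebra_simps power2_eq_square)
        also have "\<dots> \<le> 0" using 2 pos xi2_root(1) by (intro mult_nonpos_nonneg) auto
        finally have "rho_high * (r\<^sup>2 - 3 * r - 1) \<le> - r\<^sup>2 + 4 * r + 2"
          using xi2_root by (simp add: mult_le_0_iff)
        moreover have "r' * (r\<^sup>2 - 3 * r - 1) \<le> rho_high * (r\<^sup>2 - 3 * r - 1)"
          using r' False by (intro mult_right_mono) auto
        ultimately show ?thesis by linarith
      qed
      ultimately show ?thesis using r' by auto
    next
      case 3
      define e where "e = r\<^sup>2 - 3 * r - 1"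
      have "0 < (r - xi2) * ((1 + rho_high) * (r * xi2) + (2 + rho_high))"
        using 3 pos xi2_root(1) by (intro mult_pos_pos add_pos_pos) auto
      also have "\<dots> = xi2 * (rho_high * e - (- r\<^sup>2 + 4 * r + 2))
            - r * (rho_high * (xi2\<^sup>2 - 3 * xi2 - 1) - (- xi2\<^sup>2 + 4 * xi2 + 2))"
        by (simp add: e_def algebra_simps power2_eq_square)
      finally have p: "- r\<^sup>2 + 4 * r + 2 < rho_high * e"
        using xi2_root by (simp add: zero_less_mult_iff)
      have e: "0 < e"
      \<comment> \<open>The right side of the third condition is \<open>- e + r + 1\<close>, which
        is positive when \<open>e\<close> is not, in conflict with \<open>p\<close>.\<close>
      proof (rule ccontr)
        assume "\<not> 0 < e"
        hence "rho_high * e \<le> 0" "r\<^sup>2 - 3 * r - 1 \<le> 0" using pos by (auto simp: mult_nonneg_nonpos e_def)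
        thus False using p pos by linarith
      qed
      have r': "r' \<le> (- r\<^sup>2 + 4 * r + 2) / e" using high[OF 3(2)] by (simp add: e_def)
      hence "r' * e \<le> - r\<^sup>2 + 4 * r + 2" using e by (simp add: pos_le_divide_eq)
      moreover have "r' < rho_high"
      proof -
        have "(- r\<^sup>2 + 4 * r + 2) / e < rho_high" using p e by (simp add: pos_divide_less_eq)
        thus ?thesis using r' by linarith
      qed
      moreover have "1 / y - 3 \<le> 1 / r'"
      proof -
        have "1 < r"
        proof (rule ccontr)
          assume "\<not> 1 < r"
          hence "r * r \<le> r" using pos mult_right_mono[of r 1 r] by simp
          thus False using e pos unfolding e_def power2_eq_square by linarith
        qed
        hence "1\<^sup>2 * (1 + 1) \<le> y" unfolding y_def by (intro mult_mono power_mono) auto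
        hence "1 / y \<le> 3" by (simp add: field_simps)
        moreover have "0 < 1 / r'" using l pos by simp
        ultimately show ?thesis by linarith
      qed
      ultimately show ?thesis by (simp add: e_def)
    qed
  qed
  thus "r' < rho_high" "1 / r' \<ge> 1 / (r\<^sup>2 * (1 + r)) - 3" "r' * (r\<^sup>2 - 3 * r - 1) \<le> - r\<^sup>2 + 4 * r + 2"
    by (auto simp: y_def)
qed

section \<open>Lower bounds for the diagonal\<close>

lemma ratio_pos:
  assumes "is_mesh t" "2 \<le> k"
  shows "0 < ratio t k"
proof -
  have "t (k - 1) < t k" "t (k - 1 - 1) < t (k - 1)"
    using assms by (auto intro!: is_meshD[of t])
  thus ?thesis by (simp add: ratio_def tau_def)
qed

lemma tau_pos:
  assumes "is_mesh t" "1 \<le> k"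
  shows "0 < tau t k"
  using is_meshD[of t "k - 1" k] assms by (simp add: tau_def)

text \<open>The bounds on the diagonal left over once the monotone part has been split off. Both rest on
  \<open>dcoef_le\<close> at \<open>j = k - 1\<close>, applied to \<open>kern \<alpha> (t k) - kern \<alpha> (t (k + 1))\<close>
  and to \<open>kern \<alpha> (t k)\<close>.\<close>

lemma diag_gap:
  assumes a: "0 < \<alpha>" "\<alpha> < 1" and m: "is_mesh t" and r: "ratios_ok t" and k: "2 \<le> k"
  shows "\<alpha> * tau t k powr (- \<alpha>) * (next_term \<alpha> (ratio t (k + 1)) + 2 * ratio t k / (1 + ratio t k))
    \<le> (1 - \<alpha>) * (2 - \<alpha>) * (2 * (coef_c \<alpha> t (k - 1) k + coef_c \<alpha> t k k)
        - dcoef t (k - 1) (kern \<alpha> (t k))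
        - (dcoef t k (kern \<alpha> (t (k + 1))) - dcoef t (k - 1) (kern \<alpha> (t (k + 1))))
        - coef_a \<alpha> t (k + 1) (k + 1))" (is "?l \<le> ?N * ?E")
    and "\<alpha> * tau t k powr (- \<alpha>) * ((1 + \<alpha>) * (2 - \<alpha>) / \<alpha> + 2 * ratio t k / (1 + ratio t k))
    \<le> (1 - \<alpha>) * (2 - \<alpha>) * (2 * (coef_c \<alpha> t (k - 1) k + coef_c \<alpha> t k k) - dcoef t (k - 1) (kern \<alpha> (t k)))"
      (is "?l' \<le> ?N * ?E'")
proof -
  obtain i where i: "k = Suc (Suc i)" using k that[of "k - 2"] by simp
  define h \<rho> x where "h = tau t k" and "\<rho> = ratio t k" and "x = ratio t (k + 1)"
  define H Z V where "H = h powr (- \<alpha>)" and "Z = (1 + x) powr (- \<alpha>)" and "V = x powr (2 - \<alpha>)"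
  have pos: "0 < h" "0 < \<rho>" "0 < x"
    using tau_pos[OF m, of k] ratio_pos[OF m, of k] ratio_pos[OF m, of "k + 1"] k by (auto simp: h_def \<rho>_def x_def)
  have H0: "0 < H" using pos by (simp add: H_def)
  have tk1: "tau t (k + 1) = h * x" using pos by (simp add: x_def ratio_def h_def)
  define \<phi> where "\<phi> = (\<lambda>s. kern \<alpha> (t k) s - kern \<alpha> (t (k + 1)) s)"
  have lt: "t (k - 1) < t k" "t (k - 1) < t (k + 1)" "t k < t (k + 1)" using is_meshD[OF m] k by auto
  define C where "C T = int_c (t (k - 2)) (t (k - 1)) (t k) (kern \<alpha> T)" for T
  have ck: "conv_kernel (t (k - 1)) (kern \<alpha> (t k))" "conv_kernel (t (k - 1)) (kern \<alpha> (t (k + 1)))"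
    using lt by (auto intro!: conv_kernel_kern a)
  have sub: "k - 1 - 1 = k - 2" "k - 1 + 1 = k" and k1: "1 \<le> k - 1" using k by auto
  have cc: "coef_c \<alpha> t (k - 1) k = C (t k)"
    using coef_c_eq[of "k - 1" k \<alpha> t] by (simp add: C_def i)
  have C0: "0 \<le> C (t k)"
    unfolding C_def using lt ck(1) is_meshD[OF m, of "k - 2" "k - 1"] k
    by (intro int_c_nonneg conv_kernel_continuous[OF ck(1)] conv_kernel_mono[OF ck(1)]) auto
  have kv: "kern \<alpha> (t k) (t (k - 1)) = H" "kern \<alpha> (t (k + 1)) (t (k - 1)) = H * Z"
  proof -
    have "t k - t (k - 1) = h" by (simp add: h_def tau_def)
    thus "kern \<alpha> (t k) (t (k - 1)) = H" by (simp add: kern_def H_def powr_minus_divide)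
    have "t (k + 1) - t (k - 1) = h * (1 + x)"
      using tk1 by (simp add: h_def tau_def algebra_simps)
    thus "kern \<alpha> (t (k + 1)) (t (k - 1)) = H * Z"
      using pos by (simp add: kern_def H_def Z_def powr_minus_divide powr_mult)
  qed
  have "dcoef t (k - 1) \<phi> \<le> \<phi> (t (k - 1)) + int_c (t (k - 2)) (t (k - 1)) (t k) \<phi>"
    using dcoef_le[OF m r, of "k - 1" \<phi>] conv_kernel_kern_diff[OF a(1) lt(1), of "t (k + 1)"] lt k
    by (simp add: \<phi>_def sub flip: numeral_2_eq_2)
  moreover have "dcoef t (k - 1) \<phi> = dcoef t (k - 1) (kern \<alpha> (t k)) - dcoef t (k - 1) (kern \<alpha> (t (k + 1)))"
    unfolding \<phi>_def using k by (intro dcoef_kern_diff m a) auto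
  moreover have "int_c (t (k - 2)) (t (k - 1)) (t k) \<phi> = C (t k) - C (t (k + 1))"
    unfolding \<phi>_def C_def using ck by (intro int_c_diff conv_kernel_continuous[of "t (k - 1)"]) auto
  ultimately have d1: "dcoef t (k - 1) (kern \<alpha> (t k)) - dcoef t (k - 1) (kern \<alpha> (t (k + 1)))
     \<le> H - H * Z + C (t k) - C (t (k + 1))"
    using kv by (simp add: \<phi>_def)
  have d2: "dcoef t k (kern \<alpha> (t (k + 1))) = C (t (k + 1)) - coef_a \<alpha> t k (k + 1)"
    using k by (simp add: dcoef_def C_def coef_a_eq)
  have d3: "dcoef t (k - 1) (kern \<alpha> (t k)) \<le> H + C (t k)"
    using dcoef_le[OF m r k1, of "kern \<alpha> (t k)"] ck(1) kv(1) k by (simp add: C_def sub flip: numeral_2_eq_2)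
  have N0: "0 \<le> ?N" using a by simp
  have c1: "?N * coef_c \<alpha> t k k = H * (2 - \<alpha> / (1 + \<rho>))"
    using coef_diag_eq(2)[OF a m k] by (simp add: H_def h_def \<rho>_def)
  have c2: "?N * coef_a \<alpha> t k (k + 1) = H * ((\<alpha> * x - 2 * (1 - \<alpha>)) * Z - \<alpha> * (V / (1 + x)))"
    using coef_a_next_eq[OF a m, of k] k by (simp add: H_def h_def Z_def V_def x_def)
  have c3: "?N * coef_a \<alpha> t (k + 1) (k + 1) = \<alpha> * H * (V / (1 + x))"
  proof -
    have "?N * coef_a \<alpha> t (k + 1) (k + 1) = \<alpha> * (h * x) powr (- \<alpha>) * (x\<^sup>2 / (1 + x))"
      using coef_diag_eq(1)[OF a m, of "k + 1"] k unfolding tk1 x_def by simp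
    moreover have "(h * x) powr (- \<alpha>) * x\<^sup>2 = H * V"
      using pos powr_add[of x 2 "- \<alpha>"] by (simp add: H_def V_def powr_mult)
    ultimately show ?thesis by (metis mult.assoc times_divide_eq_right)
  qed
  define w where "w = 1 / (1 + \<rho>)"
  have w: "\<alpha> / (1 + \<rho>) = \<alpha> * w" "2 * \<rho> / (1 + \<rho>) = 2 - 2 * w"
    using pos by (simp_all add: w_def field_simps)
  define Q where "Q = (1 + \<alpha>) * (2 - \<alpha>) / \<alpha>"
  have Q: "(1 + \<alpha>) * (2 - \<alpha>) = \<alpha> * Q" using a by (simp add: Q_def)
  have Gq: "next_term \<alpha> x = Q + (x - 1 + \<alpha>) * Z - 2 * (V / (1 + x))"
    by (simp add: next_term_def Q_def Z_def V_def powr_minus_divide)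
  \<comment> \<open>In this combination \<open>C (t (k + 1))\<close> cancels between
    \<open>d1\<close> and \<open>d2\<close>, and one copy of the nonnegative \<open>C (t k)\<close>
    is dropped.\<close>
  have "?N * (2 * coef_c \<alpha> t k k + coef_a \<alpha> t k (k + 1) - (H - H * Z) - coef_a \<alpha> t (k + 1) (k + 1)) \<le> ?N * ?E"
    using d1 d2 C0 N0 unfolding cc by (intro mult_left_mono) auto
  also have "?N * (2 * coef_c \<alpha> t k k + coef_a \<alpha> t k (k + 1) - (H - H * Z) - coef_a \<alpha> t (k + 1) (k + 1))
    = 2 * (?N * coef_c \<alpha> t k k) + ?N * coef_a \<alpha> t k (k + 1) - ?N * (H - H * Z) - ?N * coef_a \<alpha> t (k + 1) (k + 1)"
    by (simp add: algebra_simps)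
  also have "\<dots> = H * ((1 + \<alpha>) * (2 - \<alpha>) + \<alpha> * ((x - 1 + \<alpha>) * Z) - \<alpha> * (2 * (V / (1 + x))) + \<alpha> * (2 - 2 * w))"
    unfolding c1 c2 c3 w by (simp add: algebra_simps power2_eq_square)
  also have "\<dots> = \<alpha> * H * (next_term \<alpha> x + 2 * \<rho> / (1 + \<rho>))"
    unfolding Gq Q w by (simp add: algebra_simps)
  finally show "?l \<le> ?N * ?E" by (simp add: H_def h_def x_def \<rho>_def)
  have "?N * (2 * coef_c \<alpha> t k k - H) \<le> ?N * ?E'"
    using d3 C0 N0 unfolding cc by (intro mult_left_mono) auto
  also have "?N * (2 * coef_c \<alpha> t k k - H) = 2 * (?N * coef_c \<alpha> t k k) - ?N * H"
    by (simp add: algebra_simps)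
  also have "\<dots> = H * ((1 + \<alpha>) * (2 - \<alpha>) + \<alpha> * (2 - 2 * w))"
    unfolding c1 w by (simp add: algebra_simps power2_eq_square)
  also have "\<dots> = \<alpha> * H * ((1 + \<alpha>) * (2 - \<alpha>) / \<alpha> + 2 * \<rho> / (1 + \<rho>))"
    unfolding Q_def[symmetric] Q w by (simp add: algebra_simps)
  finally show "?l' \<le> ?N * ?E'" by (simp add: H_def h_def \<rho>_def)
qed

lemma g_hat_min_eig:
  "g_hat \<alpha> t = (2 - \<alpha>) * (1 - \<alpha>) * tau t 1 powr \<alpha>
     * min_eig (mat_C \<alpha> t $ 1 $ 1) (- coef_a \<alpha> t 2 2) (mat_C \<alpha> t $ 2 $ 2)"
  by (simp add: g_hat_def Let_def min_eig_def mat_C_def power2_eq_square)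

text \<open>The numbers \<open>2 * beta1\<close> and \<open>2 * beta2\<close> are the diagonal that
  \<open>sum_of_squares_repr\<close> prescribes in the first two rows, with \<open>dcoef t 1\<close>
  reduced to a single a-coefficient.\<close>

lemma mat_C_11: "mat_C \<alpha> t $ 1 $ 1 = 2 / ((1 - \<alpha>) * tau t 1 powr \<alpha>) + coef_a \<alpha> t 1 2"
  by (simp add: mat_C_def beta1_def)

lemma mat_C_22: "mat_C \<alpha> t $ 2 $ 2 = 2 * (coef_c \<alpha> t 1 2 + coef_c \<alpha> t 2 2)
    - dcoef t 1 (kern \<alpha> (t 2)) - (dcoef t 2 (kern \<alpha> (t 3)) - dcoef t 1 (kern \<alpha> (t 3))) - coef_a \<alpha> t 3 3"
  by (simp add: mat_C_def beta2_def d23_def dcoef_def coef_a_eq coef_c_eq numeral_2_eq_2 numeral_3_eq_3 field_simps)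

text \<open>Multiplied by \<open>N\<close> and divided by \<open>tau t 1 powr (- \<alpha>)\<close>,
  the entries depend only on \<alpha> and the ratios, up to replacing the second diagonal entry by
  its lower bound from \<open>diag_gap\<close> at \<open>k = 2\<close>. The determinant condition
  then is \<open>det_ineq\<close>, after the common factor \<open>\<alpha> * (R * (R * B))\<close>
  is split off.\<close>

lemma min_eig_C_pos:
  assumes a: "0 < \<alpha>" "\<alpha> < 1" and m: "is_mesh t" and r: "ratios_ok t"
    and x: "1/3 \<le> ratio t 3" "ratio t 3 \<le> 21/5"
    and c: "2 + 2 / (1 + ratio t 3) + 4 * ratio t 2 / (1 + ratio t 2)
           - ratio t 2 ^ 3 / (1 + ratio t 2)\<^sup>2 \<ge> 0"
  shows "0 < min_eig (mat_C \<alpha> t $ 1 $ 1) (- coef_a \<alpha> t 2 2) (mat_C \<alpha> t $ 2 $ 2)"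
proof (rule min_eig_pos)
  define b x T1 N where "b = ratio t 2" and "x = ratio t 3" and "T1 = tau t 1" and "N = (1 - \<alpha>) * (2 - \<alpha>)"
  define P where "P = 2 * (2 - \<alpha>) + (\<alpha> * b - 2 * (1 - \<alpha>)) * (1 + b) powr (- \<alpha>) - \<alpha> * b powr (2 - \<alpha>) / (1 + b)"
  have pos: "0 < T1" "0 < b" "0 < x" using tau_pos[OF m, of 1] ratio_pos[OF m] by (auto simp: T1_def b_def x_def)
  have t2: "tau t 2 = T1 * b" using pos by (simp add: b_def T1_def ratio_def)
  have N: "0 < N" using a by (simp add: N_def)
  define R where "R = T1 powr (- \<alpha>)"
  have R: "0 < R" using pos by (simp add: R_def)
  define B where "B = b powr (- \<alpha>)"
  have B: "0 < B" using pos by (simp add: B_def)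
  have t2p: "tau t 2 powr (- \<alpha>) = R * B" unfolding t2 using pos by (simp add: powr_mult R_def B_def)
  have det: "0 < P" "\<alpha> * b powr (4 - \<alpha>) / (1 + b)\<^sup>2 < P * (next_term \<alpha> x + 2 * b / (1 + b))"
    using det_ineq[OF a pos(2) x[folded x_def] c[folded b_def x_def]] unfolding P_def by auto
  have C11: "N * mat_C \<alpha> t $ 1 $ 1 = R * P"
  proof -
    have "N * (2 / ((1 - \<alpha>) * T1 powr \<alpha>)) = R * (2 * (2 - \<alpha>))"
      using a by (simp add: N_def R_def powr_minus_divide)
    moreover have "N * coef_a \<alpha> t 1 2 = R * ((\<alpha> * b - 2 * (1 - \<alpha>)) * (1 + b) powr (- \<alpha>) - \<alpha> * b powr (2 - \<alpha>) / (1 + b))"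
      using coef_a_next_eq[OF a m, of 1] by (simp add: N_def R_def T1_def b_def numeral_2_eq_2)
    ultimately show ?thesis unfolding mat_C_11 P_def T1_def[symmetric] distrib_left by (simp add: algebra_simps)
  qed
  have C22: "\<alpha> * (R * B) * (next_term \<alpha> x + 2 * b / (1 + b)) \<le> N * mat_C \<alpha> t $ 2 $ 2"
    using diag_gap(1)[OF a m r, of 2] unfolding mat_C_22 t2p N_def b_def x_def
    by (simp add: numeral_2_eq_2 numeral_3_eq_3)
  have a22: "N * coef_a \<alpha> t 2 2 = \<alpha> * (R * B) * (b\<^sup>2 / (1 + b))"
    using coef_diag_eq(1)[OF a m, of 2] unfolding t2p N_def b_def by simp
  have "0 < N * mat_C \<alpha> t $ 1 $ 1" unfolding C11 using R det by simp
  thus p: "0 < mat_C \<alpha> t $ 1 $ 1" using N by (simp add: zero_less_mult_iff)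
  have "(N * coef_a \<alpha> t 2 2)\<^sup>2 = (\<alpha> * (R * (R * B))) * (\<alpha> * (B * b^4) / (1 + b)\<^sup>2)"
    unfolding a22 by (simp add: power_mult_distrib power_divide power2_eq_square numeral_eq_Suc)
  also have "B * b^4 = b powr (4 - \<alpha>)" using pos powr_add[of b 4 "- \<alpha>"] by (simp add: B_def)
  also have "(\<alpha> * (R * (R * B))) * (\<alpha> * b powr (4 - \<alpha>) / (1 + b)\<^sup>2) < (\<alpha> * (R * (R * B))) * (P * (next_term \<alpha> x + 2 * b / (1 + b)))"
    using det(2) a R B by (intro mult_strict_left_mono) auto
  also have "\<dots> = R * P * (\<alpha> * (R * B) * (next_term \<alpha> x + 2 * b / (1 + b)))" by (simp add: algebra_simps)
  also have "\<dots> \<le> R * P * (N * mat_C \<alpha> t $ 2 $ 2)" using C22 R det by (intro mult_left_mono) auto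
  finally have "N\<^sup>2 * (coef_a \<alpha> t 2 2)\<^sup>2 < N\<^sup>2 * (mat_C \<alpha> t $ 1 $ 1 * mat_C \<alpha> t $ 2 $ 2)"
    unfolding C11[symmetric] by (simp add: power_mult_distrib power2_eq_square algebra_simps)
  thus "(- coef_a \<alpha> t 2 2)\<^sup>2 < mat_C \<alpha> t $ 1 $ 1 * mat_C \<alpha> t $ 2 $ 2"
    using N by simp
qed

text \<open>Cross-multiplied, \<open>c\<close> says that \<open>r * (r - 2) / (1 + r)\<close> is at
  most \<open>1 + 1 / (1 + x)\<close>, the limit of \<open>next_term\<close> at \<alpha> = 1;
  \<open>next_term_ge\<close> makes the inequality strict.\<close>

lemma g_bracket_pos:
  fixes \<alpha> x r :: real
  assumes a: "0 < \<alpha>" "\<alpha> < 1" and x: "0 < x" "x \<le> 21/5" and r: "0 < r"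
    and c: "x * (r\<^sup>2 - 3 * r - 1) \<le> - r\<^sup>2 + 4 * r + 2"
  shows "0 < next_term \<alpha> x - r * (r - 2) / (1 + r)"
proof -
  have "r * (r - 2) / (1 + r) \<le> (2 + x) / (1 + x)"
    using c x r by (simp add: frac_le_eq field_simps power2_eq_square)
  also have "\<dots> = 1 + 1 / (1 + x)" using x by (simp add: field_simps)
  also have "\<dots> < next_term \<alpha> x"
  proof -
    have "0 < (1 - \<alpha>) * (2 + 3/2 * x) / (1 + x)"
      using a x by (intro divide_pos_pos mult_pos_pos) auto
    thus ?thesis using next_term_ge[OF a x] by linarith
  qed
  finally show ?thesis by simp
qed

text \<open>The first term exceeds its limit 2 at \<alpha> = 1, and the second stays below 2 as long
  as \<open>r\<^sup>2 - 4 * r - 2\<close> is not positive.\<close>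

lemma g_last_bracket_pos:
  fixes \<alpha> r :: real
  assumes a: "0 < \<alpha>" "\<alpha> < 1" and r: "0 < r" "r \<le> 21/5"
  shows "0 < (1 + \<alpha>) * (2 - \<alpha>) / \<alpha> - r * (r - 2) / (1 + r)"
proof -
  have "2 * (1 + r) - r * (r - 2) = r * (21/5 - r) + (2 - r / 5)" by (simp add: algebra_simps)
  also have "\<dots> \<ge> 0" using r by (intro add_nonneg_nonneg mult_nonneg_nonneg) auto
  finally have "r * (r - 2) \<le> 2 * (1 + r)" by simp
  hence "r * (r - 2) / (1 + r) \<le> 2" using r by (simp add: pos_divide_le_eq)
  also have "2 < (1 + \<alpha>) * (2 - \<alpha>) / \<alpha>"
  proof -
    have "0 < (1 - \<alpha>) * (2 + \<alpha>)" using a by simp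
    thus ?thesis using a by (simp add: field_simps)
  qed
  finally show ?thesis by simp
qed

section \<open>The bilinear form\<close>

lemma in_L2_integrable_mult:
  assumes "in_L2 \<Omega> f" "in_L2 \<Omega> g"
  shows "integrable (lebesgue_on \<Omega>) (\<lambda>x. f x * g x)"
proof (rule Bochner_Integration.integrable_bound)
  show "integrable (lebesgue_on \<Omega>) (\<lambda>x. (f x)\<^sup>2 + (g x)\<^sup>2)"
    using assms by (auto simp: in_L2_def)
  show "(\<lambda>x. f x * g x) \<in> borel_measurable (lebesgue_on \<Omega>)"
    using assms by (auto simp: in_L2_def)
  have "\<bar>a * b\<bar> \<le> a\<^sup>2 + b\<^sup>2" for a b :: real
  proof -
    have "\<bar>a * b\<bar> \<le> 2 * \<bar>a * b\<bar>" by simp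
    also have "\<dots> \<le> a\<^sup>2 + b\<^sup>2"
      using sum_squares_bound[of "\<bar>a\<bar>" "\<bar>b\<bar>"] by (simp add: abs_mult mult.assoc)
    finally show ?thesis .
  qed
  thus "AE x in lebesgue_on \<Omega>. norm (f x * g x) \<le> norm ((f x)\<^sup>2 + (g x)\<^sup>2)"
    by auto
qed

lemma in_L2_add:
  assumes "in_L2 \<Omega> f" "in_L2 \<Omega> g"
  shows "in_L2 \<Omega> (\<lambda>x. f x + g x)"
proof -
  have "(\<lambda>x. (f x + g x)\<^sup>2) = (\<lambda>x. (f x)\<^sup>2 + 2 * (f x * g x) + (g x)\<^sup>2)"
    by (auto simp: power2_eq_square algebra_simps)
  thus ?thesis using assms in_L2_integrable_mult[OF assms] by (auto simp: in_L2_def)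
qed

lemma in_L2_cmult: "in_L2 \<Omega> f \<Longrightarrow> in_L2 \<Omega> (\<lambda>x. c * f x)"
  by (auto simp: in_L2_def power_mult_distrib)

lemma in_L2_diff: "in_L2 \<Omega> f \<Longrightarrow> in_L2 \<Omega> g \<Longrightarrow> in_L2 \<Omega> (\<lambda>x. f x - g x)"
  using in_L2_add[OF _ in_L2_cmult[of \<Omega> g "-1"], of f] by simp

lemma in_L2_sum: "(\<And>i. i \<in> I \<Longrightarrow> in_L2 \<Omega> (f i)) \<Longrightarrow> in_L2 \<Omega> (\<lambda>x. \<Sum>i\<in>I. f i x)"
proof (induction I rule: infinite_finite_induct)
  case (insert i I)
  thus ?case using in_L2_add[of \<Omega> "f i"] by simp
qed (auto simp: in_L2_def)

text \<open>The derivatives of the three Lagrange basis polynomials add up to zero, so the nodal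
  values enter only through increments; splitting the middle term accordingly yields the two
  weights.\<close>

lemma deriv_H2:
  assumes m: "is_mesh t" and j: "1 \<le> j"
  shows "deriv (H2 t u j x) s
    = - ((2 * s - t j - t (j + 1)) / (tau t j * (tau t j + tau t (j + 1)))) * delta t u j x
      + (2 * s - t (j - 1) - t j) / (tau t (j + 1) * (tau t j + tau t (j + 1))) * delta t u (j + 1) x"
proof -
  define q h l where "q = t j" and "h = tau t j" and "l = tau t (j + 1)"
  have pos: "0 < h" "0 < l" using tau_pos[OF m, of j] tau_pos[OF m, of "j + 1"] j by (auto simp: h_def l_def)
  have t: "t (j - 1) = q - h" "t (j + 1) = q + l" by (auto simp: q_def h_def l_def tau_def)
  have e: "h * (- h - l) = - (h * (h + l))" "l + h = h + l" by (simp_all add: algebra_simps)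
  define u0 u1 u2 where "u0 = u (q - h) x" and "u1 = u q x" and "u2 = u (q + l) x"
  have "H2 t u j x = (\<lambda>s. u0 * ((s - q) * (s - (q + l))) / (h * (h + l))
     - u1 * ((s - (q - h)) * (s - (q + l))) / (h * l) + u2 * ((s - (q - h)) * (s - q)) / ((h + l) * l))"
    by (rule ext) (simp add: H2_def t[simplified] e u0_def u1_def u2_def flip: q_def)
  moreover have "((\<lambda>s. u0 * ((s - q) * (s - (q + l))) / (h * (h + l))
     - u1 * ((s - (q - h)) * (s - (q + l))) / (h * l) + u2 * ((s - (q - h)) * (s - q)) / ((h + l) * l))
    has_real_derivative (u0 * (2 * s - 2 * q - l) / (h * (h + l)) - u1 * (2 * s - 2 * q + h - l) / (h * l)
      + u2 * (2 * s - 2 * q + h) / ((h + l) * l))) (at s)"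
    using pos by (auto intro!: derivative_eq_intros) (simp add: divide_inverse algebra_simps)
  ultimately have "deriv (H2 t u j x) s = u0 * (2 * s - 2 * q - l) / (h * (h + l))
      - u1 * (2 * s - 2 * q + h - l) / (h * l) + u2 * (2 * s - 2 * q + h) / ((h + l) * l)"
    by (simp add: DERIV_imp_deriv)
  also have "u1 * (2 * s - 2 * q + h - l) / (h * l)
     = u1 * (2 * s - 2 * q - l) / (h * (h + l)) + u1 * (2 * s - 2 * q + h) / ((h + l) * l)"
    using pos by (simp add: divide_simps) (simp add: algebra_simps)
  also have "u0 * (2 * s - 2 * q - l) / (h * (h + l))
      - (u1 * (2 * s - 2 * q - l) / (h * (h + l)) + u1 * (2 * s - 2 * q + h) / ((h + l) * l))
      + u2 * (2 * s - 2 * q + h) / ((h + l) * l)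
     = - ((2 * s - 2 * q - l) / (h * (h + l))) * (u1 - u0) + (2 * s - 2 * q + h) / (l * (h + l)) * (u2 - u1)"
    by (simp add: divide_inverse algebra_simps)
  finally have "deriv (H2 t u j x) s
     = - ((2 * s - 2 * q - l) / (h * (h + l))) * (u1 - u0) + (2 * s - 2 * q + h) / (l * (h + l)) * (u2 - u1)" .
  moreover have "2 * s - t j - t (j + 1) = 2 * s - 2 * q - l" "2 * s - t (j - 1) - t j = 2 * s - 2 * q + h"
    unfolding t q_def[symmetric] by simp_all
  moreover have "delta t u j x = u1 - u0" "delta t u (j + 1) x = u2 - u1"
    unfolding delta_def t u0_def u1_def u2_def q_def[symmetric] add_diff_cancel_right' by simp_all
  ultimately show ?thesis by (simp only: h_def l_def)
qed

lemma integral_combine_kern: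
  fixes \<alpha> p q T d e :: real
  assumes a: "0 < \<alpha>" "\<alpha> < 1" and pq: "p \<le> q" "q \<le> T"
  shows "integral {p..q} (\<lambda>s. (- ((2 * s - u - v) / w) * d + (2 * s - u' - v') / w' * e) / (T - s) powr \<alpha>)
    = - integral {p..q} (\<lambda>s. (2 * s - u - v) / w * (1 / (T - s) powr \<alpha>)) * d
      + integral {p..q} (\<lambda>s. (2 * s - u' - v') / w' * (1 / (T - s) powr \<alpha>)) * e"
proof -
  have i: "(\<lambda>s. (2 * s - u - v) / w * (1 / (T - s) powr \<alpha>)) integrable_on {p..q}" for u v w
    using has_integral_affine_kern[OF a pq] by blast
  have "((\<lambda>s. - ((2 * s - u - v) / w * (1 / (T - s) powr \<alpha>)) * d + (2 * s - u' - v') / w' * (1 / (T - s) powr \<alpha>) * e)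
     has_integral (- integral {p..q} (\<lambda>s. (2 * s - u - v) / w * (1 / (T - s) powr \<alpha>)) * d
      + integral {p..q} (\<lambda>s. (2 * s - u' - v') / w' * (1 / (T - s) powr \<alpha>)) * e)) {p..q}"
    by (intro has_integral_add has_integral_mult_left has_integral_neg integrable_integral i)
  moreover have "(- A * d + B * e) / K = - (A * (1 / K)) * d + B * (1 / K) * e" for A B K :: real
    by (simp add: divide_inverse algebra_simps)
  ultimately show ?thesis by (simp only: integral_unique)
qed

lemma sum_shift_kernel:
  fixes a c x :: "nat \<Rightarrow> real"
  shows "(\<Sum>j=1..m. - a j * x j + c j * x (j + 1))
    = (\<Sum>j=1..m. ((if j = 1 then 0 else c (j - 1)) - a j) * x j) + (if m = 0 then 0 else c m * x (m + 1))"
  by (induction m) (auto simp: algebra_simps)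

lemma Gamma_3_minus:
  assumes "0 < \<alpha>" "\<alpha> < (1::real)"
  shows "Gamma (3 - \<alpha>) = (1 - \<alpha>) * (2 - \<alpha>) * Gamma (1 - \<alpha>)" "0 < Gamma (1 - \<alpha>)"
    "Gamma (2 - \<alpha>) = (1 - \<alpha>) * Gamma (1 - \<alpha>)"
proof -
  have "1 - \<alpha> \<noteq> 0" "2 - \<alpha> \<noteq> 0" using assms by auto
  hence "1 - \<alpha> \<notin> \<int>\<^sub>\<le>\<^sub>0" "2 - \<alpha> \<notin> \<int>\<^sub>\<le>\<^sub>0" using assms by (auto elim!: nonpos_Ints_cases')
  note this[THEN Gamma_plus1]
  moreover have "1 - \<alpha> + 1 = 2 - \<alpha>" "2 - \<alpha> + 1 = 3 - \<alpha>" by simp_all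
  ultimately show "Gamma (2 - \<alpha>) = (1 - \<alpha>) * Gamma (1 - \<alpha>)"
    and "Gamma (3 - \<alpha>) = (1 - \<alpha>) * (2 - \<alpha>) * Gamma (1 - \<alpha>)"
    by simp_all
  show "0 < Gamma (1 - \<alpha>)" using assms by (intro Gamma_real_pos) auto
qed

definition diag_coef :: "real \<Rightarrow> (nat \<Rightarrow> real) \<Rightarrow> nat \<Rightarrow> real" where
  "diag_coef \<alpha> t k = (if k = 1 then 1 / ((1 - \<alpha>) * tau t 1 powr \<alpha>) else coef_c \<alpha> t (k - 1) k + coef_c \<alpha> t k k)"

text \<open>The interpolant \<open>H2 t u (k - 1)\<close> is used on two intervals. On the second
  one it contributes \<open>coef_a \<alpha> t k k\<close> to increment \<open>k - 1\<close>, which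
  is the subdiagonal correction, and \<open>coef_c \<alpha> t k k\<close> to the diagonal. The
  c-coefficient of the interval before also lands on the diagonal, where
  \<open>sum_shift_kernel\<close> runs past the last entry of the row.\<close>

lemma L2_op_eq:
  assumes a: "0 < \<alpha>" "\<alpha> < 1" and m: "is_mesh t" and k: "1 \<le> k"
  shows "Gamma (1 - \<alpha>) * L2_op \<alpha> t u k x
    = (\<Sum>j=1..<k. dcoef t j (kern \<alpha> (t k)) * delta t u j x) + diag_coef \<alpha> t k * delta t u k x
      - (if 2 \<le> k then coef_a \<alpha> t k k * delta t u (k - 1) x else 0)"
proof (cases "k = 1")
  case True
  thus ?thesis using Gamma_3_minus[OF a] by (simp add: L2_op_def delta_def diag_coef_def)
next
  case False
  hence k2: "2 \<le> k" using k by simp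
  obtain i where i: "k = Suc (Suc i)" using k2 that[of "k - 2"] by simp
  define y where "y j = delta t u j x" for j
  have piece: "integral {t (j - 1)..t j} (\<lambda>s. deriv (H2 t u j x) s / (t k - s) powr \<alpha>)
      = - coef_a \<alpha> t j k * y j + coef_c \<alpha> t j k * y (j + 1)" if "1 \<le> j" "j < k" for j
  proof -
    have le: "t (j - 1) \<le> t j" "t j \<le> t k" using is_meshD[OF m, of "j - 1" j] is_meshD[OF m, of j k] that by auto
    show ?thesis unfolding deriv_H2[OF m that(1)] integral_combine_kern[OF a le]
      using that by (simp add: coef_a_def coef_c_def y_def)
  qed
  have last: "integral {t (k - 1)..t k} (\<lambda>s. deriv (H2 t u (k - 1) x) s / (t k - s) powr \<alpha>)
      = - coef_a \<alpha> t k k * y (k - 1) + coef_c \<alpha> t k k * y k"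
  proof -
    have k1: "1 \<le> k - 1" "k - 1 + 1 = k" "k - 1 - 1 = k - 2" using k2 by auto
    have le: "t (k - 1) \<le> t k" using is_meshD[OF m, of "k - 1" k] k by auto
    show ?thesis unfolding deriv_H2[OF m k1(1)] k1(2,3) integral_combine_kern[OF a le order.refl]
      by (simp add: coef_a_def coef_c_def y_def)
  qed
  have "Gamma (1 - \<alpha>) * L2_op \<alpha> t u k x
    = (\<Sum>j=1..k - 1. - coef_a \<alpha> t j k * y j + coef_c \<alpha> t j k * y (j + 1))
      - coef_a \<alpha> t k k * y (k - 1) + coef_c \<alpha> t k k * y k"
  proof -
    have "(\<Sum>j=1..k - 1. integral {t (j - 1)..t j} (\<lambda>s. deriv (H2 t u j x) s / (t k - s) powr \<alpha>))
       = (\<Sum>j=1..k - 1. - coef_a \<alpha> t j k * y j + coef_c \<alpha> t j k * y (j + 1))"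
      using k by (intro sum.cong piece) auto
    thus ?thesis using False Gamma_3_minus(2)[OF a] unfolding L2_op_def last by simp
  qed
  also have "(\<Sum>j=1..k - 1. - coef_a \<alpha> t j k * y j + coef_c \<alpha> t j k * y (j + 1))
     = (\<Sum>j=1..<k. dcoef t j (kern \<alpha> (t k)) * y j) + coef_c \<alpha> t (k - 1) k * y k"
  proof -
    have "(\<Sum>j=1..k - 1. ((if j = 1 then 0 else coef_c \<alpha> t (j - 1) k) - coef_a \<alpha> t j k) * y j)
       = (\<Sum>j=1..<k. dcoef t j (kern \<alpha> (t k)) * y j)"
    proof (rule sum.cong)
      fix j assume j: "j \<in> {1..<k}"
      have "coef_c \<alpha> t (j - 1) k = int_c (t (j - 2)) (t (j - 1)) (t j) (kern \<alpha> (t k))" if "j \<noteq> 1"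
      proof -
        have "1 \<le> j - 1" "j - 1 < k" "j - 1 - 1 = j - 2" "j - 1 + 1 = j" using that j by auto
        thus ?thesis using coef_c_eq[of "j - 1" k \<alpha> t] by simp
      qed
      thus "((if j = 1 then 0 else coef_c \<alpha> t (j - 1) k) - coef_a \<alpha> t j k) * y j = dcoef t j (kern \<alpha> (t k)) * y j"
        using j coef_a_eq[of j k \<alpha> t] by (simp add: dcoef_def)
    qed (use k2 in auto)
    moreover have "k - 1 \<noteq> 0" "k - 1 + 1 = k" using k2 by auto
    ultimately show ?thesis
      using sum_shift_kernel[of "\<lambda>j. coef_a \<alpha> t j k" y "\<lambda>j. coef_c \<alpha> t j k" "k - 1"] by simp
  qed
  finally show ?thesis using k2 by (simp add: diag_coef_def y_def algebra_simps)
qed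

lemma min_eig_scale:
  assumes "0 \<le> c"
  shows "min_eig (c * p) (c * q) (c * r) = c * min_eig p q r"
proof -
  have "(c * p - c * r)\<^sup>2 + 4 * (c * q)\<^sup>2 = c\<^sup>2 * ((p - r)\<^sup>2 + 4 * q\<^sup>2)"
    by (simp add: power2_eq_square algebra_simps)
  hence "sqrt ((c * p - c * r)\<^sup>2 + 4 * (c * q)\<^sup>2) = c * sqrt ((p - r)\<^sup>2 + 4 * q\<^sup>2)"
    using assms by (simp add: real_sqrt_mult)
  thus ?thesis by (simp add: min_eig_def distrib_left right_diff_distrib)
qed

lemma quad_form_g_coef_le:
  fixes x :: "nat \<Rightarrow> real"
  assumes a: "0 < \<alpha>" "\<alpha> < 1" and m: "is_mesh t" and r: "ratios_ok t" and n: "2 \<le> n"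
  shows "(\<Sum>k=1..n. g_coef \<alpha> t n k * (x k)\<^sup>2)
    \<le> 2 * ((1 - \<alpha>) * (2 - \<alpha>)) * (\<Sum>k=1..n. ((\<Sum>j=1..<k. dcoef t j (kern \<alpha> (t k)) * x j) + diag_coef \<alpha> t k * x k
      - (if 2 \<le> k then coef_a \<alpha> t k k * x (k - 1) else 0)) * x k)"
proof -
  define N where "N = (1 - \<alpha>) * (2 - \<alpha>)"
  have N: "0 < N" using a by (simp add: N_def)
  define S where "S k j = dcoef t j (kern \<alpha> (t k))" for k j
  have Na: "N * coef_a \<alpha> t k k = \<alpha> * tau t k powr (- \<alpha>) * ((ratio t k)\<^sup>2 / (1 + ratio t k))" if "2 \<le> k" for k
    using coef_diag_eq(1)[OF a m that] by (simp add: N_def)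
  have a0: "0 \<le> coef_a \<alpha> t k k" if "2 \<le> k" for k
  proof -
    have "0 \<le> N * coef_a \<alpha> t k k"
      unfolding Na[OF that] using a ratio_pos[OF m that] by simp
    thus ?thesis using N by (simp add: zero_le_mult_iff)
  qed
  \<comment> \<open>Joins the two contributions of \<open>\<rho>\<close>: the term from
    \<open>diag_gap\<close> and the charge for the subdiagonal entry of row \<open>k\<close>
    itself.\<close>
  have bracket: "\<alpha> * H * (X + 2 * \<rho> / (1 + \<rho>)) - \<alpha> * H * (\<rho>\<^sup>2 / (1 + \<rho>)) = \<alpha> * H * (X - \<rho> * (\<rho> - 2) / (1 + \<rho>))"
    for H X \<rho> :: real
    by (simp add: divide_inverse algebra_simps power2_eq_square)
  have split: "(\<Sum>k=1..n. f k) = f 1 + f 2 + (\<Sum>k=3..n. f k)" for f :: "nat \<Rightarrow> real"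
    using n by (simp add: sum.atLeast_Suc_atMost numeral_eq_Suc)
  \<comment> \<open>The prefactor of \<open>g_hat\<close> cancels
    \<open>1 / tau t 1 powr \<alpha>\<close> and leaves \<open>N\<close>, which passes into the
    eigenvalue by homogeneity.\<close>
  have g12: "g_coef \<alpha> t n k = min_eig (N * mat_C \<alpha> t $ 1 $ 1) (- (N * coef_a \<alpha> t 2 2)) (N * mat_C \<alpha> t $ 2 $ 2)"
    if "k \<le> 2" for k
    using that tau_pos[OF m, of 1] min_eig_scale[of N "mat_C \<alpha> t $ 1 $ 1" "- coef_a \<alpha> t 2 2" "mat_C \<alpha> t $ 2 $ 2"] N
    by (simp add: g_coef_def g_hat_min_eig N_def mult.commute)
  have "(\<Sum>k=1..n. g_coef \<alpha> t n k * (x k)\<^sup>2)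
     = min_eig (N * mat_C \<alpha> t $ 1 $ 1) (- (N * coef_a \<alpha> t 2 2)) (N * mat_C \<alpha> t $ 2 $ 2) * ((x 1)\<^sup>2 + (x 2)\<^sup>2)
       + (\<Sum>k=3..n. g_coef \<alpha> t n k * (x k)\<^sup>2)"
    unfolding split using g12[of 1] g12[of 2] by (simp add: distrib_left)
  also have "\<dots> \<le> 2 * (\<Sum>k=1..n. ((\<Sum>j=1..<k. N * S k j * x j) + N * diag_coef \<alpha> t k * x k
      - (if 2 \<le> k then N * coef_a \<alpha> t k k * x (k - 1) else 0)) * x k)"
  proof (rule quad_form_lower[OF n])
    show "N * S k 0 = 0" for k by (simp add: S_def dcoef_def)
    show "N * S n (i - 1) \<le> N * S n i" if "1 \<le> i" "i < n" for i
      unfolding S_def using dcoef_kern_mono[OF m r a(1) that] N by simp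
    show "N * S (k + 1) i - N * S (k + 1) (i - 1) \<le> N * S k i - N * S k (i - 1)" if "1 \<le> i" "i < k" "k < n" for i k
      unfolding S_def right_diff_distrib[symmetric] using dcoef_kern_mixed[OF m r a(1) that(1,2)] N by simp
    show "0 \<le> N * coef_a \<alpha> t k k" if "2 \<le> k" "k \<le> n" for k
      using a0[OF that(1)] N by simp
    show "N * mat_C \<alpha> t $ 1 $ 1 \<le> 2 * (N * diag_coef \<alpha> t 1) - N * S 1 (1 - 1)
       - (if 1 < n then N * S (1 + 1) 1 - N * S (1 + 1) (1 - 1) else 0)"
    proof -
      have "S (1 + 1) 1 = - coef_a \<alpha> t 1 2" "S (1 + 1) 0 = 0" "S 1 0 = 0"
        by (simp_all add: S_def dcoef_def coef_a_eq numeral_2_eq_2)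
      thus ?thesis unfolding mat_C_11 using n by (simp add: diag_coef_def algebra_simps)
    qed
    show "N * mat_C \<alpha> t $ 2 $ 2 \<le> 2 * (N * diag_coef \<alpha> t 2) - N * S 2 (2 - 1)
       - (if 2 < n then N * S (2 + 1) 2 - N * S (2 + 1) (2 - 1) else 0) - (if 2 < n then N * coef_a \<alpha> t 3 3 else 0)"
    proof -
      \<comment> \<open>The matrix involves the third row even for \<open>n = 2\<close>; the terms
        then missing from the form are nonnegative, so the bound persists.\<close>
      have "S 3 1 \<le> S 3 2" unfolding S_def using dcoef_kern_mono[OF m r a(1), of 2 3] by simp
      hence "mat_C \<alpha> t $ 2 $ 2 \<le> 2 * diag_coef \<alpha> t 2 - S 2 1 - (if 2 < n then S 3 2 - S 3 1 else 0)
          - (if 2 < n then coef_a \<alpha> t 3 3 else 0)"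
        unfolding mat_C_22 using a0[of 3] by (simp add: S_def diag_coef_def)
      hence "N * mat_C \<alpha> t $ 2 $ 2 \<le> N * (2 * diag_coef \<alpha> t 2 - S 2 1 - (if 2 < n then S 3 2 - S 3 1 else 0)
          - (if 2 < n then coef_a \<alpha> t 3 3 else 0))"
        using N by (intro mult_left_mono) auto
      thus ?thesis by (cases "2 < n") (simp_all add: right_diff_distrib mult.left_commute)
    qed
    fix k assume k: "3 \<le> k" "k \<le> n"
    hence k2: "2 \<le> k" by simp
    have tp: "\<alpha> / tau t k powr \<alpha> = \<alpha> * tau t k powr (- \<alpha>)" by (simp add: powr_minus_divide)
    show "g_coef \<alpha> t n k \<le> 2 * (N * diag_coef \<alpha> t k) - N * S k (k - 1)
       - (if k < n then N * S (k + 1) k - N * S (k + 1) (k - 1) else 0) - N * coef_a \<alpha> t k k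
       - (if k < n then N * coef_a \<alpha> t (k + 1) (k + 1) else 0)"
    proof (cases "k < n")
      case True
      have "g_coef \<alpha> t n k = \<alpha> * tau t k powr (- \<alpha>) * (next_term \<alpha> (ratio t (k + 1)) - ratio t k * (ratio t k - 2) / (1 + ratio t k))"
      proof -
        have "\<not> k \<le> 2" "k \<le> n - 1" using k True by auto
        thus ?thesis unfolding g_coef_def next_term_def tp by simp
      qed
      also have "\<dots> = \<alpha> * tau t k powr (- \<alpha>) * (next_term \<alpha> (ratio t (k + 1)) + 2 * ratio t k / (1 + ratio t k)) - N * coef_a \<alpha> t k k"
        unfolding Na[OF k2] bracket ..
      also have "\<dots> \<le> N * (2 * (coef_c \<alpha> t (k - 1) k + coef_c \<alpha> t k k) - S k (k - 1)
        - (S (k + 1) k - S (k + 1) (k - 1)) - coef_a \<alpha> t (k + 1) (k + 1)) - N * coef_a \<alpha> t k k"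
        using diag_gap(1)[OF a m r k2] by (simp add: N_def S_def)
      finally show ?thesis using True k by (simp add: diag_coef_def algebra_simps)
    next
      case False
      hence kn: "k = n" using k by simp
      have "g_coef \<alpha> t n k = \<alpha> * tau t k powr (- \<alpha>) * ((1 + \<alpha>) * (2 - \<alpha>) / \<alpha> - ratio t k * (ratio t k - 2) / (1 + ratio t k))"
      proof -
        have "\<not> k \<le> 2" "\<not> k \<le> n - 1" using k kn by auto
        thus ?thesis unfolding g_coef_def kn tp[unfolded kn] by simp
      qed
      also have "\<dots> = \<alpha> * tau t k powr (- \<alpha>) * ((1 + \<alpha>) * (2 - \<alpha>) / \<alpha> + 2 * ratio t k / (1 + ratio t k)) - N * coef_a \<alpha> t k k"
        unfolding Na[OF k2] bracket ..
      also have "\<dots> \<le> N * (2 * (coef_c \<alpha> t (k - 1) k + coef_c \<alpha> t k k) - S k (k - 1)) - N * coef_a \<alpha> t k k"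
        using diag_gap(2)[OF a m r k2] by (simp add: N_def S_def)
      finally show ?thesis using False k by (simp add: diag_coef_def algebra_simps)
    qed
  qed
  also have "\<dots> = 2 * N * (\<Sum>k=1..n. ((\<Sum>j=1..<k. S k j * x j) + diag_coef \<alpha> t k * x k
      - (if 2 \<le> k then coef_a \<alpha> t k k * x (k - 1) else 0)) * x k)"
    unfolding mult.assoc sum_distrib_left[of N]
    by (intro arg_cong[of _ _ "(*) 2"] sum.cong refl) (auto simp: algebra_simps sum_distrib_left)
  finally show ?thesis by (simp add: N_def S_def)
qed

text \<open>The inequality holds pointwise in space, with the increments at a fixed point as the
  vector of the quadratic form; integration over the domain gives the claim.\<close>

lemma B_form_ge:
  fixes \<Omega> :: "'a::euclidean_space set"
  assumes a: "0 < \<alpha>" "\<alpha> < 1" and m: "is_mesh t" and r: "ratios_ok t" and n: "2 \<le> n"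
    and u: "\<And>k. in_L2 \<Omega> (u (t k))"
  shows "(\<Sum>k=1..n. g_coef \<alpha> t n k / (2 * Gamma (3 - \<alpha>)) * (L2_norm \<Omega> (delta t u k))\<^sup>2) \<le> B_form \<Omega> \<alpha> t n u"
proof -
  define c where "c = 1 / Gamma (1 - \<alpha>)"
  have G0: "0 < Gamma (1 - \<alpha>)" "0 < Gamma (3 - \<alpha>)" using Gamma_3_minus[OF a] a by auto
  have dL: "in_L2 \<Omega> (delta t u k)" for k
    using in_L2_diff[OF u[of k] u[of "k - 1"]] by (simp add: delta_def[abs_def])
  have op: "L2_op \<alpha> t u k x
    = c * ((\<Sum>j=1..<k. dcoef t j (kern \<alpha> (t k)) * delta t u j x) + diag_coef \<alpha> t k * delta t u k x
      - (if 2 \<le> k then coef_a \<alpha> t k k * delta t u (k - 1) x else 0))" if "1 \<le> k" for k x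
    unfolding L2_op_eq[OF a m that, symmetric] using G0 by (simp add: c_def)
  have opL: "in_L2 \<Omega> (L2_op \<alpha> t u k)" if "1 \<le> k" for k
  proof -
    have "L2_op \<alpha> t u k = (\<lambda>x. c * ((\<Sum>j=1..<k. dcoef t j (kern \<alpha> (t k)) * delta t u j x) + diag_coef \<alpha> t k * delta t u k x
      - (if 2 \<le> k then coef_a \<alpha> t k k else 0) * delta t u (k - 1) x))"
      using op[OF that] by (intro ext) simp
    thus ?thesis by (simp only:) (intro in_L2_cmult in_L2_diff in_L2_add in_L2_sum dL)
  qed
  have norm: "(L2_norm \<Omega> (delta t u k))\<^sup>2 = (LINT x|lebesgue_on \<Omega>. (delta t u k x)\<^sup>2)" for k
    by (simp add: L2_norm_def L2_inner_def power2_eq_square integral_nonneg_AE)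
  have "(\<Sum>k=1..n. g_coef \<alpha> t n k / (2 * Gamma (3 - \<alpha>)) * (L2_norm \<Omega> (delta t u k))\<^sup>2)
    = (LINT x|lebesgue_on \<Omega>. (\<Sum>k=1..n. g_coef \<alpha> t n k / (2 * Gamma (3 - \<alpha>)) * (delta t u k x)\<^sup>2))"
    unfolding norm using dL by (subst Bochner_Integration.integral_sum) (auto simp: in_L2_def)
  also have "\<dots> \<le> (LINT x|lebesgue_on \<Omega>. (\<Sum>k=1..n. L2_op \<alpha> t u k x * delta t u k x))"
  proof (intro integral_mono Bochner_Integration.integrable_sum)
    fix k assume k: "k \<in> {1..n}"
    show "integrable (lebesgue_on \<Omega>) (\<lambda>x. g_coef \<alpha> t n k / (2 * Gamma (3 - \<alpha>)) * (delta t u k x)\<^sup>2)"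
      using dL[of k] by (auto simp: in_L2_def)
    show "integrable (lebesgue_on \<Omega>) (\<lambda>x. L2_op \<alpha> t u k x * delta t u k x)"
      using k by (intro in_L2_integrable_mult opL dL) auto
  next
    fix x
    have "(\<Sum>k=1..n. g_coef \<alpha> t n k / (2 * Gamma (3 - \<alpha>)) * (delta t u k x)\<^sup>2)
      = 1 / (2 * Gamma (3 - \<alpha>)) * (\<Sum>k=1..n. g_coef \<alpha> t n k * (delta t u k x)\<^sup>2)"
      by (simp add: sum_distrib_left)
    also have "\<dots> \<le> 1 / (2 * Gamma (3 - \<alpha>)) * (2 * ((1 - \<alpha>) * (2 - \<alpha>)) * (\<Sum>k=1..n. ((\<Sum>j=1..<k. dcoef t j (kern \<alpha> (t k)) * delta t u j x) + diag_coef \<alpha> t k * delta t u k x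
      - (if 2 \<le> k then coef_a \<alpha> t k k * delta t u (k - 1) x else 0)) * delta t u k x))"
      using G0 by (intro mult_left_mono quad_form_g_coef_le a m r n) auto
    also have "\<dots> = c * (\<Sum>k=1..n. ((\<Sum>j=1..<k. dcoef t j (kern \<alpha> (t k)) * delta t u j x) + diag_coef \<alpha> t k * delta t u k x
      - (if 2 \<le> k then coef_a \<alpha> t k k * delta t u (k - 1) x else 0)) * delta t u k x)"
      unfolding Gamma_3_minus(1)[OF a] using a by (simp add: c_def)
    also have "\<dots> = (\<Sum>k=1..n. L2_op \<alpha> t u k x * delta t u k x)"
      unfolding sum_distrib_left by (intro sum.cong refl) (simp only: op atLeastAtMost_iff mult.assoc)
    finally show "(\<Sum>k=1..n. g_coef \<alpha> t n k / (2 * Gamma (3 - \<alpha>)) * (delta t u k x)\<^sup>2)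
      \<le> (\<Sum>k=1..n. L2_op \<alpha> t u k x * delta t u k x)" .
  qed
  also have "\<dots> = B_form \<Omega> \<alpha> t n u"
    unfolding B_form_def L2_inner_def
    by (intro Bochner_Integration.integral_sum in_L2_integrable_mult opL dL) auto
  finally show ?thesis .
qed

section \<open>Scale invariance of the eigenvalue factor\<close>

lemma integral_affine_kern_scale:
  fixes \<alpha> p q T u v w l :: real
  assumes a: "0 < \<alpha>" "\<alpha> < 1" and pq: "p \<le> q" "q \<le> T" and l: "0 < l"
  shows "integral {l * p..l * q} (\<lambda>s. (2 * s - l * u - l * v) / (l\<^sup>2 * w) * (1 / (l * T - s) powr \<alpha>))
    = l powr (- \<alpha>) * integral {p..q} (\<lambda>s. (2 * s - u - v) / w * (1 / (T - s) powr \<alpha>))"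
proof -
  define L where "L = l powr (- \<alpha>)"
  have L: "l powr (1 - \<alpha>) = l * L" "l powr (2 - \<alpha>) = l\<^sup>2 * L"
    using l powr_add[of l 1 "- \<alpha>"] powr_add[of l 2 "- \<alpha>"] by (simp_all add: L_def)
  have p: "(l * T - l * s) powr (1 - \<alpha>) = l * L * (T - s) powr (1 - \<alpha>)"
    "(l * T - l * s) powr (2 - \<alpha>) = l\<^sup>2 * L * (T - s) powr (2 - \<alpha>)" if "s \<le> T" for s
    unfolding right_diff_distrib[symmetric] L[symmetric] using l that by (simp_all add: powr_mult)
  have pT: "p \<le> T" using pq by simp
  have lpq: "l * p \<le> l * q" "l * q \<le> l * T" using pq l by auto
  have "(2 * (l * T) - l * u - l * v) * (l * L * A - l * L * B) / (1 - \<alpha>) - 2 * (l\<^sup>2 * L * C - l\<^sup>2 * L * D) / (2 - \<alpha>)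
     = l\<^sup>2 * (L * ((2 * T - u - v) * (A - B) / (1 - \<alpha>) - 2 * (C - D) / (2 - \<alpha>)))" for A B C D
    by (simp add: divide_inverse algebra_simps power2_eq_square)
  hence "((2 * (l * T) - l * u - l * v) * (l * L * A - l * L * B) / (1 - \<alpha>) - 2 * (l\<^sup>2 * L * C - l\<^sup>2 * L * D) / (2 - \<alpha>)) / (l\<^sup>2 * w)
     = L * (((2 * T - u - v) * (A - B) / (1 - \<alpha>) - 2 * (C - D) / (2 - \<alpha>)) / w)" for A B C D
    using l by simp
  thus ?thesis
    unfolding integral_unique[OF has_integral_affine_kern[OF a lpq]]
      integral_unique[OF has_integral_affine_kern[OF a pq]] p[OF pT] p[OF pq(2)] L_def[symmetric] .
qed

text \<open>Counting degrees: the weight contributes \<open>1 / l\<close>, the measure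
  \<open>l\<close> and the kernel \<open>l powr (- \<alpha>)\<close>. The scaling is assumed only up
  to index \<open>n\<close> because two ratios determine no more than the first four mesh
  points.\<close>

lemma coef_scale:
  assumes a: "0 < \<alpha>" "\<alpha> < 1" and l: "0 < l" and m: "is_mesh t" and t': "\<And>i. i \<le> n \<Longrightarrow> t' i = l * t i"
    and jk: "1 \<le> j" "j \<le> k" "k \<le> n"
  shows "coef_a \<alpha> t' j k = l powr (- \<alpha>) * coef_a \<alpha> t j k" "coef_c \<alpha> t' j k = l powr (- \<alpha>) * coef_c \<alpha> t j k"
proof -
  have tau': "tau t' i = l * tau t i" if "i \<le> n" for i
    using that by (simp add: tau_def t' right_diff_distrib)
  have w: "l * A * (l * B + l * C) = l\<^sup>2 * (A * (B + C))" for A B C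
    by (simp add: power2_eq_square algebra_simps)
  have o: "t (j - 1) \<le> t j" "t j \<le> t k"
    using is_meshD[OF m, of "j - 1" j] is_meshD[OF m, of j k] jk by (cases "j = k"; simp)+
  note sc = integral_affine_kern_scale[OF a o l]
  show "coef_a \<alpha> t' j k = l powr (- \<alpha>) * coef_a \<alpha> t j k"
  proof (cases "j < k")
    case True
    thus ?thesis using jk sc[of "t j" "t (j + 1)"] by (simp add: coef_a_def tau' t' w)
  next
    case False
    hence "j = k" using jk by simp
    thus ?thesis using jk sc[of "t (k - 1)" "t k"] by (simp add: coef_a_def tau' t' w)
  qed
  show "coef_c \<alpha> t' j k = l powr (- \<alpha>) * coef_c \<alpha> t j k"
  proof (cases "j < k")
    case True
    thus ?thesis using jk sc[of "t (j - 1)" "t j"] by (simp add: coef_c_def tau' t' w)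
  next
    case False
    hence "j = k" using jk by simp
    thus ?thesis using jk sc[of "t (k - 2)" "t (k - 1)"] by (simp add: coef_c_def tau' t' w)
  qed
qed

text \<open>Both meshes start at 0, so equal \<open>ratio t 2\<close> and \<open>ratio t 3\<close>
  make them proportional up to index 3. All entries of \<open>mat_C\<close> then scale by
  \<open>l powr (- \<alpha>)\<close>, and \<open>tau t 1 powr \<alpha>\<close> undoes this.\<close>

lemma g_hat_cong_ratio:
  assumes a: "0 < \<alpha>" "\<alpha> < 1" and m: "is_mesh t" "is_mesh t'"
    and r: "ratio t' 2 = ratio t 2" "ratio t' 3 = ratio t 3"
  shows "g_hat \<alpha> t' = g_hat \<alpha> t"
proof -
  define l where "l = tau t' 1 / tau t 1"
  have tp: "0 < tau t 1" "0 < tau t 2" "0 < tau t' 1" "0 < tau t' 2" using tau_pos m by auto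
  have l: "0 < l" using tp by (simp add: l_def)
  have scale: "C = l * A" if "C / D = A / B" "D = l * B" "0 < B" for A B C D
  proof -
    have "C = A / B * D" using that l by (metis less_irrefl mult_pos_pos nonzero_eq_divide_eq)
    thus ?thesis using that by simp
  qed
  have q: "tau t' 2 / tau t' 1 = tau t 2 / tau t 1" "tau t' 3 / tau t' 2 = tau t 3 / tau t 2"
    using r by (simp_all add: ratio_def)
  have l1: "tau t' 1 = l * tau t 1" using tp by (simp add: l_def)
  have l2: "tau t' 2 = l * tau t 2" by (rule scale[OF q(1) l1 tp(1)])
  have l3: "tau t' 3 = l * tau t 3" by (rule scale[OF q(2) l2 tp(2)])
  have "t 0 = 0" "t' 0 = 0" using m by (auto simp: is_mesh_def)
  with l1 l2 l3 have t0: "t' 0 = l * t 0" "t' 1 = l * t 1" "t' 2 = l * t 2" "t' 3 = l * t 3"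
    by (auto simp: tau_def numeral_2_eq_2 numeral_3_eq_3 algebra_simps)
  have t': "t' i = l * t i" if "i \<le> 3" for i
  proof -
    have "i = 0 \<or> i = 1 \<or> i = 2 \<or> i = 3" using that by auto
    thus ?thesis using t0 by auto
  qed
  define L where "L = l powr (- \<alpha>)"
  note sc = coef_scale[OF a l m(1), of 3 t', OF t', folded L_def]
  have t1: "tau t' 1 powr \<alpha> = tau t 1 powr \<alpha> / L"
    using tp l by (simp add: l_def L_def powr_mult powr_minus_divide powr_divide)
  have C11: "mat_C \<alpha> t' $ 1 $ 1 = L * mat_C \<alpha> t $ 1 $ 1"
    unfolding mat_C_11 t1 by (simp add: sc algebra_simps)
  have C22: "mat_C \<alpha> t' $ 2 $ 2 = L * mat_C \<alpha> t $ 2 $ 2"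
    by (simp add: mat_C_def beta2_def d23_def sc) (simp add: algebra_simps)
  have a22: "- coef_a \<alpha> t' 2 2 = L * (- coef_a \<alpha> t 2 2)" by (simp add: sc)
  have "0 < L" using l by (simp add: L_def)
  thus ?thesis unfolding g_hat_min_eig C11 C22 a22 t1 by (subst min_eig_scale) auto
qed

theorem theorem3p2:
  fixes \<Omega> :: "(real^'d) set" and \<alpha> :: real and t :: "nat \<Rightarrow> real"
  assumes "open \<Omega>" and "connected \<Omega>" and "\<Omega> \<noteq> {}"
    and "0 < \<alpha>" and "\<alpha> < 1"
    and "is_mesh t"
    and "rho_low < ratio t 2"
    and "rho_low < ratio t 3" and "ratio t 3 < rho_high"
    and "2 + 2 / (1 + ratio t 3) + 4 * ratio t 2 / (1 + ratio t 2)
           - ratio t 2 ^ 3 / (1 + ratio t 2)\<^sup>2 \<ge> 0"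
    and "1 / ratio t 3 \<ge> 1 / ((ratio t 2)\<^sup>2 * (1 + ratio t 2)) - 3"
    and "\<And>k. 3 \<le> k \<Longrightarrow> rho_low < ratio t k \<Longrightarrow> ratio t k < xi1 \<Longrightarrow>
           rho_low < ratio t (k + 1) \<and>
           ratio t (k + 1) \<le> (ratio t k)\<^sup>2 * (1 + ratio t k)
                              / (1 - 3 * (ratio t k)\<^sup>2 * (1 + ratio t k))"
    and "\<And>k. 3 \<le> k \<Longrightarrow> xi1 \<le> ratio t k \<Longrightarrow> ratio t k \<le> xi2 \<Longrightarrow>
           rho_low < ratio t (k + 1) \<and> ratio t (k + 1) < rho_high"
    and "\<And>k. 3 \<le> k \<Longrightarrow> xi2 < ratio t k \<Longrightarrow> ratio t k < rho_high \<Longrightarrow>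
           rho_low < ratio t (k + 1) \<and>
           ratio t (k + 1) \<le> (- ((ratio t k)\<^sup>2) + 4 * ratio t k + 2)
                              / ((ratio t k)\<^sup>2 - 3 * ratio t k - 1)"
  shows "(\<forall>(u :: real \<Rightarrow> real^'d \<Rightarrow> real) n. 2 \<le> n \<longrightarrow> (\<forall>k. in_L2 \<Omega> (u (t k))) \<longrightarrow>
            B_form \<Omega> \<alpha> t n u
              \<ge> (\<Sum>k = 1..n. g_coef \<alpha> t n k / (2 * Gamma (3 - \<alpha>)) * (L2_norm \<Omega> (delta t u k))\<^sup>2)
          \<and> (\<Sum>k = 1..n. g_coef \<alpha> t n k / (2 * Gamma (3 - \<alpha>)) * (L2_norm \<Omega> (delta t u k))\<^sup>2) \<ge> 0)
       \<and> (\<forall>n k. 2 \<le> n \<longrightarrow> 1 \<le> k \<longrightarrow> k \<le> n \<longrightarrow> g_coef \<alpha> t n k > 0)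
       \<and> (\<forall>t'. is_mesh t' \<longrightarrow> ratio t' 2 = ratio t 2 \<longrightarrow> ratio t' 3 = ratio t 3 \<longrightarrow>
            g_hat \<alpha> t' = g_hat \<alpha> t)"
proof -
  note a = assms(4,5) and m = assms(6)
  \<comment> \<open>The range of one ratio supplies the guards of the branch hypotheses, and
    \<open>ratio_step\<close> returns the range of the next.\<close>
  have range: "rho_low < ratio t k \<and> ratio t k < rho_high" if "3 \<le> k" for k
    using that
  proof (induction k rule: dec_induct)
    case (step k)
    thus ?case using ratio_step(1,2)[of "ratio t k" "ratio t (k + 1)"] assms(12,13,14)[of k] by simp
  qed (use assms in auto)
  have step: "1 / ratio t (k + 1) \<ge> 1 / ((ratio t k)\<^sup>2 * (1 + ratio t k)) - 3"
    "ratio t (k + 1) * ((ratio t k)\<^sup>2 - 3 * ratio t k - 1) \<le> - (ratio t k)\<^sup>2 + 4 * ratio t k + 2" if "3 \<le> k" for k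
    using ratio_step(3,4)[of "ratio t k" "ratio t (k + 1)"] range[OF that] assms(12,13,14)[OF that] by auto
  have bounds: "1/3 \<le> ratio t k" "0 < ratio t k" "ratio t k \<le> 21/5" if "3 \<le> k" for k
    using range[OF that] rho_low_gt rho_high_le by linarith+
  have r: "ratios_ok t"
    unfolding ratios_ok_def
  proof (intro allI impI)
    fix j :: nat assume "2 \<le> j"
    \<comment> \<open>For \<open>j = 2\<close> this is an explicit hypothesis; the branches yield it
      from 3 on.\<close>
    thus "1 / ratio t (j + 1) \<ge> 1 / ((ratio t j)\<^sup>2 * (1 + ratio t j)) - 3"
      using step(1)[of j] assms(11) by (cases "j = 2") auto
  qed
  have g: "0 < g_coef \<alpha> t n k" if "2 \<le> n" "1 \<le> k" "k \<le> n" for n k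
  proof -
    have "k \<le> 2 \<or> 3 \<le> k \<and> k < n \<or> 3 \<le> k \<and> k = n" using that by linarith
    then consider "k \<le> 2" | "3 \<le> k" "k < n" | "3 \<le> k" "k = n" by blast
    thus ?thesis
    proof cases
      case 1
      have "0 < g_hat \<alpha> t"
        unfolding g_hat_min_eig
        using min_eig_C_pos[OF a m r bounds(1,3) assms(10)] a tau_pos[OF m, of 1]
        by (intro mult_pos_pos) auto
      thus ?thesis using 1 tau_pos[OF m, of 1] by (simp add: g_coef_def)
    next
      case 2
      have "0 < next_term \<alpha> (ratio t (k + 1)) - ratio t k * (ratio t k - 2) / (1 + ratio t k)"
        using 2 by (intro g_bracket_pos a bounds step) auto
      thus ?thesis using 2 a tau_pos[OF m, of k] by (simp add: g_coef_def next_term_def)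
    next
      case 3
      have "0 < (1 + \<alpha>) * (2 - \<alpha>) / \<alpha> - ratio t k * (ratio t k - 2) / (1 + ratio t k)"
        using 3 by (intro g_last_bracket_pos a bounds) auto
      thus ?thesis using 3 a tau_pos[OF m, of k] by (simp add: g_coef_def)
    qed
  qed
  have G3: "0 < Gamma (3 - \<alpha>)" using Gamma_3_minus[OF a] a by simp
  show ?thesis
  proof (intro conjI allI impI)
    fix u :: "real \<Rightarrow> real^'d \<Rightarrow> real" and n :: nat
    assume n: "2 \<le> n" and u: "\<forall>k. in_L2 \<Omega> (u (t k))"
    show "B_form \<Omega> \<alpha> t n u \<ge> (\<Sum>k = 1..n. g_coef \<alpha> t n k / (2 * Gamma (3 - \<alpha>)) * (L2_norm \<Omega> (delta t u k))\<^sup>2)"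
      using u by (intro B_form_ge a m r n) auto
    show "(\<Sum>k = 1..n. g_coef \<alpha> t n k / (2 * Gamma (3 - \<alpha>)) * (L2_norm \<Omega> (delta t u k))\<^sup>2) \<ge> 0"
      using n G3 by (intro sum_nonneg mult_nonneg_nonneg divide_nonneg_nonneg less_imp_le[OF g]) auto
  qed (use g g_hat_cong_ratio[OF a m] in auto)
qed

end
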